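(* For the Dynkin diagram of type $B_n$, the variety $\mathcal{M}_{B_n}$ is isomorphic to the complement in $\mathbb{C}^{n+1}/\mathbb{C}$ of the Shi arrangement, i.e. of the hyperplanes $z_b-z_a=0$ and $z_b-z_a=1$ for $1\le a<b\le n+1$. Here $\mathbb{C}^{n+1}/\mathbb{C}$ is the quotient of $\mathbb{C}^{n+1}$, with coordinates $(z_1,\dots,z_{n+1})$, by the line spanned by the all-ones vector.
   Context: Let $P_{2n+2}$ be the convex $(2n+2)$-gon with vertices cyclically labeled $1,2,\dots,n+1,\bar1,\bar2,\dots,\overline{n+1}$. Let $\Pi$ be the set consisting of the long diagonals $[i,\bar i]=(i,\bar i)$ for $1\le i\le n+1$, and the pairs of centrally symmetric (non-long) diagonals $[i,j]=\{(i,j),(\bar i,\bar j)\}$ for $1\le i<j-1<n+1$ and $[i,\bar j]=\{(i,\bar j),(j,\bar i)\}$ for $1\le i<j\le n+1$, $(i,j)\ne(1,n+1)$ (sides of the polygon excluded; $|\Pi|=n^2+n$). $\Pi$ indexes the mutable cluster variables of a cluster algebra of type $B_n$. The type $B_n$ compatibility degree $(\gamma\|\omega)$ is the number of crossings (in the interior of the polygon) of one of the diagonals representing $\gamma$ with the diagonals representing $\omega$; for example $([1,\bar1]\|[2,\bar3])=2$ and $([2,\bar3]\|[1,\bar1])=1$. The cluster configuration space is $\mathcal{M}_{B_n}=\operatorname{Spec}\big(\mathbb{C}[u_\gamma^{\pm1}\mid\gamma\in\Pi]/I\big)$, where $I$ is generated by the elements $u_\gamma+\prod_{\omega\in\Pi}u_\omega^{(\omega\|\gamma)}-1$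 for $\gamma\in\Pi$. *)

theory Defs
  imports
    "HOL-Analysis.Abstract_Topology"
    "HOL-Library.Poly_Mapping"
    "HOL-Algebra.QuotRing"
begin

section \<open>Affine schemes over the complex numbers\<close>

text \<open>
  A ringed space over the complex numbers. The component \<open>sections X U\<close> is the ring of sections
  over an open set \<open>U\<close>, \<open>restr X U V\<close> is the restriction map from \<open>U\<close> to \<open>V\<close>, and
  \<open>scalar X U c\<close> is the image of the complex number \<open>c\<close> in \<open>sections X U\<close>.
  The last three are only meaningful on open sets.
\<close>

record ('p, 's) ringed_space =
  points :: "'p topology"
  sections :: "'p set \<Rightarrow> 's ring"
  restr :: "'p set \<Rightarrow> 'p set \<Rightarrow> 's \<Rightarrow> 's"
  scalar :: "'p set \<Rightarrow> complex \<Rightarrow> 's"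

definition preim :: "('p, 's) ringed_space \<Rightarrow> ('p \<Rightarrow> 'q) \<Rightarrow> 'q set \<Rightarrow> 'p set" where
  "preim X f V = {x \<in> topspace (points X). f x \<in> V}"

text \<open>
  Isomorphism of ringed spaces over the complex numbers: a homeomorphism \<open>f\<close> together with an
  isomorphism \<open>\<phi>\<close> from the structure sheaf of \<open>Y\<close> to the direct image of that of \<open>X\<close>. The
  induced maps on stalks are then ring isomorphisms and hence automatically local, so that
  between schemes this is isomorphism of schemes over the complex numbers.
\<close>

definition isomorphic_over_C ::
    "('p, 's) ringed_space \<Rightarrow> ('q, 't) ringed_space \<Rightarrow> bool" where
  "isomorphic_over_C X Y \<longleftrightarrow> (\<exists>f \<phi>.
     homeomorphic_map (points X) (points Y) f \<and>
     (\<forall>V. openin (points Y) V \<longrightarrow>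
        \<phi> V \<in> ring_iso (sections Y V) (sections X (preim X f V)) \<and>
        (\<forall>c. \<phi> V (scalar Y V c) = scalar X (preim X f V) c)) \<and>
     (\<forall>V W. openin (points Y) V \<and> openin (points Y) W \<and> W \<subseteq> V \<longrightarrow>
        (\<forall>s \<in> carrier (sections Y V).
           \<phi> W (restr Y V W s) = restr X (preim X f V) (preim X f W) (\<phi> V s))))"

definition open_subspace :: "('p, 's) ringed_space \<Rightarrow> 'p set \<Rightarrow> ('p, 's) ringed_space" where
  "open_subspace X U = X\<lparr>points := subtopology (points X) U\<rparr>"

definition vanishing :: "('a, 'm) ring_scheme \<Rightarrow> 'a set \<Rightarrow> 'a set set" where
  "vanishing R S = {P. primeideal P R \<and> S \<subseteq> P}"

definition zariski :: "('a, 'm) ring_scheme \<Rightarrow> 'a set topology" where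
  "zariski R = topology (\<lambda>U. \<exists>S \<subseteq> carrier R. U = {P. primeideal P R} - vanishing R S)"

text \<open>
  The fraction \<open>a / s\<close> in the localization of \<open>R\<close> at the prime ideal \<open>P\<close>, as the class of all
  pairs \<open>(b, t)\<close> such that \<open>v (a t - b s) = 0\<close> for some \<open>v\<close> outside \<open>P\<close>.
\<close>

definition loc_frac :: "('a, 'm) ring_scheme \<Rightarrow> 'a set \<Rightarrow> 'a \<Rightarrow> 'a \<Rightarrow> ('a \<times> 'a) set" where
  "loc_frac R P a s = {(b, t). b \<in> carrier R \<and> t \<in> carrier R - P \<and>
     (\<exists>v \<in> carrier R - P.
        v \<otimes>\<^bsub>R\<^esub> ((a \<otimes>\<^bsub>R\<^esub> t) \<ominus>\<^bsub>R\<^esub> (b \<otimes>\<^bsub>R\<^esub> s)) = \<zero>\<^bsub>R\<^esub>)}"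

definition localization :: "('a, 'm) ring_scheme \<Rightarrow> 'a set \<Rightarrow> ('a \<times> 'a) set ring" where
  "localization R P =
    \<lparr>carrier = {loc_frac R P a s |a s. a \<in> carrier R \<and> s \<in> carrier R - P},
     mult = (\<lambda>X Y. \<Union>(a, s)\<in>X. \<Union>(b, t)\<in>Y. loc_frac R P (a \<otimes>\<^bsub>R\<^esub> b) (s \<otimes>\<^bsub>R\<^esub> t)),
     one = loc_frac R P \<one>\<^bsub>R\<^esub> \<one>\<^bsub>R\<^esub>,
     zero = loc_frac R P \<zero>\<^bsub>R\<^esub> \<one>\<^bsub>R\<^esub>,
     add = (\<lambda>X Y. \<Union>(a, s)\<in>X. \<Union>(b, t)\<in>Y.
              loc_frac R P ((a \<otimes>\<^bsub>R\<^esub> t) \<oplus>\<^bsub>R\<^esub> (b \<otimes>\<^bsub>R\<^esub> s)) (s \<otimes>\<^bsub>R\<^esub> t))\<rparr>"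

text \<open>
  Sections of the structure sheaf: functions assigning to each prime ideal \<open>P\<close> in \<open>U\<close> an element
  of the localization at \<open>P\<close> and locally given by a single fraction.
\<close>

definition regular_sections ::
    "('a, 'm) ring_scheme \<Rightarrow> 'a set set \<Rightarrow> ('a set \<Rightarrow> ('a \<times> 'a) set) set" where
  "regular_sections R U = {s \<in> (\<Pi>\<^sub>E P\<in>U. carrier (localization R P)).
     \<forall>P\<in>U. \<exists>V a g. openin (zariski R) V \<and> P \<in> V \<and> V \<subseteq> U \<and>
       a \<in> carrier R \<and> g \<in> carrier R \<and> (\<forall>Q\<in>V. g \<notin> Q \<and> s Q = loc_frac R Q a g)}"

definition structure_sheaf ::
    "('a, 'm) ring_scheme \<Rightarrow> 'a set set \<Rightarrow> ('a set \<Rightarrow> ('a \<times> 'a) set) ring" where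
  "structure_sheaf R U =
    \<lparr>carrier = regular_sections R U,
     mult = (\<lambda>s t. \<lambda>P\<in>U. s P \<otimes>\<^bsub>localization R P\<^esub> t P),
     one = (\<lambda>P\<in>U. \<one>\<^bsub>localization R P\<^esub>),
     zero = (\<lambda>P\<in>U. \<zero>\<^bsub>localization R P\<^esub>),
     add = (\<lambda>s t. \<lambda>P\<in>U. s P \<oplus>\<^bsub>localization R P\<^esub> t P)\<rparr>"

text \<open>
  The spectrum of an algebra over the complex numbers, given as a commutative ring \<open>R\<close> with
  structure map \<open>\<iota>\<close>.
\<close>

definition Spec :: "('a, 'm) ring_scheme \<Rightarrow> (complex \<Rightarrow> 'a) \<Rightarrow>
    ('a set, 'a set \<Rightarrow> ('a \<times> 'a) set) ringed_space" where
  "Spec R \<iota> =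
    \<lparr>points = zariski R,
     sections = structure_sheaf R,
     restr = (\<lambda>U V s. restrict s V),
     scalar = (\<lambda>U c. \<lambda>P\<in>U. loc_frac R P (\<iota> c) \<one>\<^bsub>R\<^esub>)\<rparr>"

lemma (in cring) istopology_zariski:
  "istopology (\<lambda>U. \<exists>S \<subseteq> carrier R. U = {P. primeideal P R} - vanishing R S)"
  unfolding istopology_def
proof (intro conjI allI impI)
  fix U V
  assume "\<exists>S \<subseteq> carrier R. U = {P. primeideal P R} - vanishing R S"
    and "\<exists>S \<subseteq> carrier R. V = {P. primeideal P R} - vanishing R S"
  then obtain S T where S: "S \<subseteq> carrier R" "U = {P. primeideal P R} - vanishing R S"
    and T: "T \<subseteq> carrier R" "V = {P. primeideal P R} - vanishing R T" by blast
  let ?W = "{s \<otimes> t |s t. s \<in> S \<and> t \<in> T}"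
  have "?W \<subseteq> P \<longleftrightarrow> S \<subseteq> P \<or> T \<subseteq> P" if P: "primeideal P R" for P
  proof -
    interpret primeideal P R by (rule P)
    show ?thesis
    proof
      assume W: "?W \<subseteq> P"
      show "S \<subseteq> P \<or> T \<subseteq> P"
      proof (rule ccontr)
        assume "\<not> (S \<subseteq> P \<or> T \<subseteq> P)"
        then obtain s t where st: "s \<in> S" "s \<notin> P" "t \<in> T" "t \<notin> P" by blast
        then have "s \<otimes> t \<in> P" using W by blast
        then show False using I_prime[of s t] st S(1) T(1) by blast
      qed
    next
      assume "S \<subseteq> P \<or> T \<subseteq> P"
      then have "s \<otimes> t \<in> P" if "s \<in> S" "t \<in> T" for s t
        using that S(1) T(1) I_l_closed[of t s] I_r_closed[of s t] by (meson subsetD)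
      then show "?W \<subseteq> P" by (auto simp del: subset_iff)
    qed
  qed
  then have W: "?W \<subseteq> P \<longleftrightarrow> S \<subseteq> P \<or> T \<subseteq> P" if "primeideal P R" for P
    using that by simp
  have "U \<inter> V = {P. primeideal P R} - vanishing R ?W"
  proof (rule Set.set_eqI)
    fix P
    show "P \<in> U \<inter> V \<longleftrightarrow> P \<in> {P. primeideal P R} - vanishing R ?W"
      unfolding S(2) T(2) vanishing_def Int_iff Diff_iff mem_Collect_eq[of P] using W[of P] by argo
  qed
  moreover have "?W \<subseteq> carrier R" using S(1) T(1) by (auto intro: m_closed)
  ultimately show "\<exists>S \<subseteq> carrier R. U \<inter> V = {P. primeideal P R} - vanishing R S"
    by (intro exI[of _ ?W] conjI)
next
  fix \<K>
  assume "\<forall>K\<in>\<K>. \<exists>S \<subseteq> carrier R. K = {P. primeideal P R} - vanishing R S"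
  then obtain f where f: "\<And>K. K \<in> \<K> \<Longrightarrow> f K \<subseteq> carrier R \<and>
      K = {P. primeideal P R} - vanishing R (f K)" by metis
  have mem: "P \<in> K \<longleftrightarrow> primeideal P R \<and> \<not> f K \<subseteq> P" if "K \<in> \<K>" for P K
  proof -
    have "P \<in> K \<longleftrightarrow> P \<in> {P. primeideal P R} - vanishing R (f K)"
      using f[OF that] by argo
    then show ?thesis unfolding vanishing_def by auto
  qed
  have "\<Union>\<K> = {P. primeideal P R} - vanishing R (\<Union>(f ` \<K>))"
  proof (rule Set.set_eqI)
    fix P
    have "P \<in> \<Union>\<K> \<longleftrightarrow> primeideal P R \<and> (\<exists>K\<in>\<K>. \<not> f K \<subseteq> P)"
      using mem by auto
    also have "\<dots> \<longleftrightarrow> P \<in> {P. primeideal P R} - vanishing R (\<Union>(f ` \<K>))"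
      unfolding vanishing_def by (auto simp: UN_subset_iff)
    finally show "P \<in> \<Union>\<K> \<longleftrightarrow> P \<in> {P. primeideal P R} - vanishing R (\<Union>(f ` \<K>))" .
  qed
  moreover have "\<Union>(f ` \<K>) \<subseteq> carrier R" using f by blast
  ultimately show "\<exists>S \<subseteq> carrier R. \<Union>\<K> = {P. primeideal P R} - vanishing R S"
    by (intro exI[of _ "\<Union>(f ` \<K>)"] conjI)
qed

lemma (in cring) openin_zariski:
  "openin (zariski R) U \<longleftrightarrow> (\<exists>S \<subseteq> carrier R. U = {P. primeideal P R} - vanishing R S)"
  by (simp add: zariski_def topology_inverse'[OF istopology_zariski])


section \<open>Polynomial and Laurent polynomial rings\<close>

text \<open>
  The elements of the type \<open>('v \<Rightarrow>\<^sub>0 'e) \<Rightarrow>\<^sub>0 complex\<close> only involving variables from \<open>V\<close>: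
  polynomials for exponents \<open>'e = nat\<close>, Laurent polynomials for \<open>'e = int\<close>.
\<close>

definition mpoly_ring :: "'v set \<Rightarrow> (('v \<Rightarrow>\<^sub>0 'e::comm_semiring_1) \<Rightarrow>\<^sub>0 complex) ring" where
  "mpoly_ring V =
    \<lparr>carrier = {p. \<forall>m \<in> Poly_Mapping.keys p. Poly_Mapping.keys m \<subseteq> V},
     mult = (*), one = 1, zero = 0, add = (+)\<rparr>"

definition var :: "'v \<Rightarrow> (('v \<Rightarrow>\<^sub>0 'e::comm_semiring_1) \<Rightarrow>\<^sub>0 complex)" where
  "var v = Poly_Mapping.single (Poly_Mapping.single v 1) 1"

definition const :: "complex \<Rightarrow> (('v \<Rightarrow>\<^sub>0 'e::comm_semiring_1) \<Rightarrow>\<^sub>0 complex)" where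
  "const c = Poly_Mapping.single 0 c"

definition mpoly_eval :: "('v \<Rightarrow> complex) \<Rightarrow> (('v \<Rightarrow>\<^sub>0 nat) \<Rightarrow>\<^sub>0 complex) \<Rightarrow> complex" where
  "mpoly_eval z p = (\<Sum>m \<in> Poly_Mapping.keys p. Poly_Mapping.lookup p m *
     (\<Prod>v \<in> Poly_Mapping.keys m. z v ^ Poly_Mapping.lookup m v))"

lemma cring_mpoly_ring:
  "cring (mpoly_ring V :: (('v \<Rightarrow>\<^sub>0 'e::comm_semiring_1) \<Rightarrow>\<^sub>0 complex) ring)"
proof -
  let ?C = "{p :: ('v \<Rightarrow>\<^sub>0 'e) \<Rightarrow>\<^sub>0 complex. \<forall>m \<in> Poly_Mapping.keys p. Poly_Mapping.keys m \<subseteq> V}"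
  have add: "p + q \<in> ?C" if "p \<in> ?C" "q \<in> ?C" for p q
    using that Poly_Mapping.keys_add[of p q] by blast
  have uminus: "- p \<in> ?C" if "p \<in> ?C" for p
    using that by (simp add: in_keys_iff)
  have mult: "p * q \<in> ?C" if p: "p \<in> ?C" and q: "q \<in> ?C" for p q
  proof -
    have "Poly_Mapping.keys m \<subseteq> V" if m: "m \<in> Poly_Mapping.keys (p * q)" for m
    proof -
      obtain a b where "m = a + b" "a \<in> Poly_Mapping.keys p" "b \<in> Poly_Mapping.keys q"
        using subsetD[OF keys_mult m] by blast
      then show ?thesis using p q Poly_Mapping.keys_add[of a b] by blast
    qed
    then show ?thesis by blast
  qed
  let ?R = "mpoly_ring V :: (('v \<Rightarrow>\<^sub>0 'e) \<Rightarrow>\<^sub>0 complex) ring"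
  have R: "carrier ?R = ?C" "mult ?R = (*)" "one ?R = 1" "zero ?R = 0" "add ?R = (+)"
    by (simp_all add: mpoly_ring_def)
  have zero: "0 \<in> ?C" and one: "1 \<in> ?C" by simp_all
  have "abelian_group ?R"
  proof (rule abelian_groupI, unfold R)
    fix x y z :: "('v \<Rightarrow>\<^sub>0 'e) \<Rightarrow>\<^sub>0 complex"
    show "x + y + z = x + (y + z)" by (rule add.assoc)
    show "x + y = y + x" by (rule add.commute)
    show "0 + x = x" by (rule add_0_left)
    show "x + y \<in> ?C" if "x \<in> ?C" "y \<in> ?C" using that by (rule add)
    show "\<exists>y\<in>?C. y + x = 0" if "x \<in> ?C"
      using uminus[OF that] by (intro bexI[of _ "- x"] left_minus)
  qed (rule zero)
  moreover have "Group.comm_monoid ?R"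
  proof (rule comm_monoidI, unfold R)
    fix x y z :: "('v \<Rightarrow>\<^sub>0 'e) \<Rightarrow>\<^sub>0 complex"
    show "x * y * z = x * (y * z)" by (rule mult.assoc)
    show "x * y = y * x" by (rule mult.commute)
    show "1 * x = x" by (rule mult_1_left)
    show "x * y \<in> ?C" if "x \<in> ?C" "y \<in> ?C" using that by (rule mult)
  qed (rule one)
  ultimately show ?thesis
    by (rule cringI) (simp only: R distrib_right)
qed


section \<open>The cluster configuration space of type B\<close>

text \<open>
  The vertices of the polygon are numbered cyclically by \<open>1, \<dots>, 2n+2\<close>: the label \<open>i\<close> is the
  number \<open>i\<close> and the label \<open>i\<close>-bar is the number \<open>n+1+i\<close>. A diagonal is the set of its two end
  points, and a member of \<open>B_index n\<close> is the set of the (one or two) diagonals representing it.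
\<close>

definition bar :: "nat \<Rightarrow> nat \<Rightarrow> nat" where
  "bar n i = n + 1 + i"

definition B_index :: "nat \<Rightarrow> nat set set set" where
  "B_index n =
     {{{i, bar n i}} |i. 1 \<le> i \<and> i \<le> n + 1} \<union>
     {{{i, j}, {bar n i, bar n j}} |i j. 1 \<le> i \<and> i < j - 1 \<and> j - 1 < n + 1} \<union>
     {{{i, bar n j}, {j, bar n i}} |i j. 1 \<le> i \<and> i < j \<and> j \<le> n + 1 \<and> (i, j) \<noteq> (1, n + 1)}"

text \<open>
  Two diagonals of a convex polygon meet in its interior iff their end points are four distinct
  vertices which alternate around the boundary.
\<close>

definition crosses :: "nat set \<Rightarrow> nat set \<Rightarrow> bool" where
  "crosses d e \<longleftrightarrow> (\<exists>p q r s. p < q \<and> q < r \<and> r < s \<and>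
     (d = {p, r} \<and> e = {q, s} \<or> d = {q, s} \<and> e = {p, r}))"

text \<open>The choice of the representative \<open>d\<close> is immaterial, see \<open>compat_degree_eq\<close> below.\<close>

definition compat_degree :: "nat set set \<Rightarrow> nat set set \<Rightarrow> nat" where
  "compat_degree \<gamma> \<omega> = card {e \<in> \<omega>. crosses (SOME d. d \<in> \<gamma>) e}"

definition B_relation :: "nat \<Rightarrow> nat set set \<Rightarrow> ((nat set set \<Rightarrow>\<^sub>0 int) \<Rightarrow>\<^sub>0 complex)" where
  "B_relation n \<gamma> = var \<gamma> + (\<Prod>\<omega> \<in> B_index n. var \<omega> ^ compat_degree \<omega> \<gamma>) - 1"

definition B_ideal :: "nat \<Rightarrow> ((nat set set \<Rightarrow>\<^sub>0 int) \<Rightarrow>\<^sub>0 complex) set" where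
  "B_ideal n = Idl\<^bsub>mpoly_ring (B_index n)\<^esub> (B_relation n ` B_index n)"

definition cluster_configuration_space_B where
  "cluster_configuration_space_B n =
     Spec (mpoly_ring (B_index n) Quot B_ideal n)
       (\<lambda>c. B_ideal n +>\<^bsub>mpoly_ring (B_index n)\<^esub> const c)"

definition opposite :: "nat \<Rightarrow> nat \<Rightarrow> nat" where
  "opposite n v = (if v \<le> n + 1 then v + (n + 1) else v - (n + 1))"

lemma crossesI:
  assumes "p < q" "q < r" "r < s"
  shows "crosses {p, r} {q, s}" "crosses {q, s} {p, r}"
  using assms unfolding crosses_def by blast+

lemma crosses_opposite:
  assumes "crosses d e" "d \<subseteq> {1..2 * n + 2}" "e \<subseteq> {1..2 * n + 2}"
  shows "crosses (opposite n ` d) (opposite n ` e)"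
proof -
  let ?\<sigma> = "opposite n"
  have *: "crosses {?\<sigma> p, ?\<sigma> r} {?\<sigma> q, ?\<sigma> s} \<and> crosses {?\<sigma> q, ?\<sigma> s} {?\<sigma> p, ?\<sigma> r}"
    if ord: "p < q" "q < r" "r < s" "1 \<le> p" "s \<le> 2 * n + 2" for p q r s
  proof -
    consider "s \<le> n + 1 \<or> p > n + 1" | "r \<le> n + 1" "n + 1 < s" | "q \<le> n + 1" "n + 1 < r"
      | "p \<le> n + 1" "n + 1 < q" by linarith
    then show ?thesis
    proof cases
      case 1
      then have "?\<sigma> p < ?\<sigma> q" "?\<sigma> q < ?\<sigma> r" "?\<sigma> r < ?\<sigma> s"
        using ord by (auto simp: opposite_def)
      from crossesI[OF this] show ?thesis by blast
    next
      case 2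
      then have "?\<sigma> s < ?\<sigma> p" "?\<sigma> p < ?\<sigma> q" "?\<sigma> q < ?\<sigma> r"
        using ord by (auto simp: opposite_def)
      from crossesI[OF this] show ?thesis by (simp only: insert_commute)
    next
      case 3
      then have "?\<sigma> r < ?\<sigma> s" "?\<sigma> s < ?\<sigma> p" "?\<sigma> p < ?\<sigma> q"
        using ord by (auto simp: opposite_def)
      from crossesI[OF this] show ?thesis by (simp only: insert_commute)
    next
      case 4
      then have "?\<sigma> q < ?\<sigma> r" "?\<sigma> r < ?\<sigma> s" "?\<sigma> s < ?\<sigma> p"
        using ord by (auto simp: opposite_def)
      from crossesI[OF this] show ?thesis by (simp only: insert_commute)
    qed
  qed
  obtain p q r s where ord: "p < q" "q < r" "r < s"
    and de: "d = {p, r} \<and> e = {q, s} \<or> d = {q, s} \<and> e = {p, r}"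
    using assms(1) unfolding crosses_def by blast
  have "1 \<le> p" "s \<le> 2 * n + 2" using de assms(2,3) by auto
  from *[OF ord this] show ?thesis using de by (elim disjE conjE) simp_all
qed

lemma B_index_cases:
  assumes "\<gamma> \<in> B_index n"
  obtains i where "i \<in> {1..n + 1}" "\<gamma> = {{i, bar n i}}"
    | i j where "i \<in> {1..n + 1}" "j \<in> {1..n + 1}" "\<gamma> = {{i, j}, {bar n i, bar n j}}"
    | i j where "i \<in> {1..n + 1}" "j \<in> {1..n + 1}" "\<gamma> = {{i, bar n j}, {j, bar n i}}"
proof -
  from assms show ?thesis
    unfolding B_index_def
  proof (elim UnE CollectE exE conjE)
    fix i assume "\<gamma> = {{i, bar n i}}" "1 \<le> i" "i \<le> n + 1"
    then show ?thesis using that(1) by simp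
  next
    fix i j assume "\<gamma> = {{i, j}, {bar n i, bar n j}}" "1 \<le> i" "i < j - 1" "j - 1 < n + 1"
    then have "i \<in> {1..n + 1}" "j \<in> {1..n + 1}" by auto
    then show ?thesis using that(2) \<open>\<gamma> = _\<close> by blast
  next
    fix i j assume "\<gamma> = {{i, bar n j}, {j, bar n i}}" "1 \<le> i" "i < j" "j \<le> n + 1"
    then show ?thesis using that(3)[of i j] by simp
  qed
qed

lemma B_index_subset:
  assumes "\<gamma> \<in> B_index n" "d \<in> \<gamma>"
  shows "d \<subseteq> {1..2 * n + 2}"
  using assms(1) by (cases rule: B_index_cases) (use assms(2) in \<open>auto simp: bar_def\<close>)

lemma B_index_opposite:
  assumes "\<gamma> \<in> B_index n" "d \<in> \<gamma>"
  shows "\<gamma> = {d, opposite n ` d}"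
proof -
  have *: "opposite n i = bar n i" "opposite n (bar n i) = i" if "i \<in> {1..n + 1}" for i
    using that by (simp_all add: opposite_def bar_def)
  from assms(1) show ?thesis
  proof (cases rule: B_index_cases)
    case (1 i)
    with assms(2) show ?thesis by (simp add: * insert_commute)
  next
    case (2 i j)
    then have "d = {i, j} \<or> d = {bar n i, bar n j}" using assms(2) by simp
    then show ?thesis using 2(3) *[OF 2(1)] *[OF 2(2)] by (elim disjE) (simp_all add: insert_commute)
  next
    case (3 i j)
    then have "d = {i, bar n j} \<or> d = {j, bar n i}" using assms(2) by simp
    then show ?thesis using 3(3) *[OF 3(1)] *[OF 3(2)] by (elim disjE) (simp_all add: insert_commute)
  qed
qed

lemma opposite_opposite:
  assumes "d \<subseteq> {1..2 * n + 2}"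
  shows "opposite n ` opposite n ` d = d"
proof -
  have "opposite n (opposite n v) = v" if "v \<in> d" for v
    using assms that by (auto simp: opposite_def)
  then show ?thesis by (simp add: image_image)
qed

lemma compat_degree_eq:
  assumes "\<gamma> \<in> B_index n" "\<omega> \<in> B_index n" "d \<in> \<gamma>"
  shows "compat_degree \<gamma> \<omega> = card {e \<in> \<omega>. crosses d e}"
proof -
  let ?\<sigma> = "(`) (opposite n)"
  have closed: "?\<sigma> e \<in> \<omega>" if "e \<in> \<omega>" for e
    using B_index_opposite[OF assms(2) that] by blast
  have sub: "e \<subseteq> {1..2 * n + 2}" if "e \<in> \<omega>" for e
    using B_index_subset[OF assms(2) that] .
  have d: "d \<subseteq> {1..2 * n + 2}" using B_index_subset[OF assms(1,3)] .
  have "bij_betw ?\<sigma> {e \<in> \<omega>. crosses d e} {e \<in> \<omega>. crosses (?\<sigma> d) e}"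
  proof (rule bij_betw_byWitness[of _ ?\<sigma>])
    show "?\<sigma> ` {e \<in> \<omega>. crosses d e} \<subseteq> {e \<in> \<omega>. crosses (?\<sigma> d) e}"
    proof safe
      fix e assume e: "e \<in> \<omega>" "crosses d e"
      show "?\<sigma> e \<in> \<omega>" using closed e by blast
      show "crosses (?\<sigma> d) (?\<sigma> e)" using crosses_opposite[OF e(2) d sub[OF e(1)]] .
    qed
    show "?\<sigma> ` {e \<in> \<omega>. crosses (?\<sigma> d) e} \<subseteq> {e \<in> \<omega>. crosses d e}"
    proof safe
      fix e assume e: "e \<in> \<omega>" "crosses (?\<sigma> d) e"
      show "?\<sigma> e \<in> \<omega>" using closed e by blast
      have "opposite n v \<in> {1..2 * n + 2}" if "v \<in> {1..2 * n + 2}" for v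
        using that by (auto simp: opposite_def)
      then have "?\<sigma> d \<subseteq> {1..2 * n + 2}" using d by blast
      from crosses_opposite[OF e(2) this sub[OF e(1)]]
      show "crosses d (?\<sigma> e)" by (simp only: opposite_opposite[OF d])
    qed
  qed (simp_all add: opposite_opposite[OF sub])
  then have "card {e \<in> \<omega>. crosses d e} = card {e \<in> \<omega>. crosses (?\<sigma> d) e}"
    by (rule bij_betw_same_card)
  moreover have "(SOME d'. d' \<in> \<gamma>) \<in> {d, ?\<sigma> d}"
    unfolding B_index_opposite[OF assms(1,3), symmetric] using assms(3) by (rule someI)
  ultimately show ?thesis unfolding compat_degree_def by (elim insertE emptyE) simp_all
qed


section \<open>The complement of the Shi arrangement\<close>

text \<open>
  The coordinate ring of the quotient of affine space by the line spanned by the all-ones vector: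
  the polynomials in \<open>z\<^sub>1, \<dots>, z\<^sub>n\<^sub>+\<^sub>1\<close> invariant under translation along that line.
\<close>

definition quotient_coordinate_ring :: "nat \<Rightarrow> ((nat \<Rightarrow>\<^sub>0 nat) \<Rightarrow>\<^sub>0 complex) ring" where
  "quotient_coordinate_ring n = (mpoly_ring {1..n + 1})
     \<lparr>carrier := {p \<in> carrier (mpoly_ring {1..n + 1}).
        \<forall>z t. mpoly_eval (\<lambda>i. z i + t) p = mpoly_eval z p}\<rparr>"

definition affine_space_mod_line where
  "affine_space_mod_line n = Spec (quotient_coordinate_ring n) const"

definition shi_hyperplanes :: "nat \<Rightarrow> ((nat \<Rightarrow>\<^sub>0 nat) \<Rightarrow>\<^sub>0 complex) set set set" where
  "shi_hyperplanes n =
     {vanishing (quotient_coordinate_ring n) {var b - var a - const c} |a b c.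
        1 \<le> a \<and> a < b \<and> b \<le> n + 1 \<and> c \<in> {0, 1}}"

definition shi_complement where
  "shi_complement n = open_subspace (affine_space_mod_line n)
     (topspace (points (affine_space_mod_line n)) - \<Union>(shi_hyperplanes n))"

end

theory Submission
  imports Defs "HOL-Computational_Algebra.Polynomial" "HOL-Algebra.Subrings"
begin

text \<open>
  Write \<open>N = n + 1\<close>, extend the coordinates by \<open>z\<^sub>k\<^sub>+\<^sub>N = z\<^sub>k + 1\<close> and let \<open>[p, q] = z\<^sub>q - z\<^sub>p\<close>, so that the
  Shi forms are, up to sign, the brackets \<open>[p, q]\<close> with \<open>p < q < p + N\<close>. Every element of \<open>\<Pi>\<close> is represented
  by a unique diagonal \<open>(i, j)\<close> with \<open>1 \<le> i \<le> N\<close> and \<open>i + 2 \<le> j \<le> i + N\<close>. The isomorphism sends the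
  variable of \<open>(i, i + N)\<close> to \<open>[i, i + N - 1]\<close> and that of \<open>(i, j)\<close> with \<open>j < i + N\<close> to the cross ratio
  \<open>[i - 1, j] [i, j - 1] / ([i, j] [i - 1, j - 1])\<close>. Solving for the brackets expresses each of them as
  a monomial in the variables. The defining relations say exactly that these monomials satisfy the
  Pluecker relations \<open>[i, j] [i - 1, j - 1] = [i - 1, j] [i, j - 1] + [j - 1, j] [i - 1, i]\<close>
  and \<open>[i - 1, i] = 1 - u\<close> for the variable \<open>u\<close> of \<open>(i, i + N)\<close>, and
  \<open>[p, p + N] = 1\<close> holds by construction. By downward induction on \<open>q - p\<close> it follows that the
  monomials are additive, \<open>[p, q] = [p, r] + [r, q]\<close>. Hence they are the values of the Shi forms at
  the point with \<open>z\<^sub>k - z\<^sub>k\<^sub>-\<^sub>1 = [k - 1, k]\<close>, which identifies the two coordinate rings.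
\<close>

section \<open>Spectra of localizations\<close>

text \<open>The exponents come from inverting a second difference. On exponents, the cross ratio
  formula says that the mixed second difference of \<open>[p, q]\<close> in \<open>p\<close> and
  \<open>q\<close> singles out one variable, and \<open>[p, p + N] = 1\<close> is the boundary
  value. The solution is the product of the variables of all translates \<open>(a, b)\<close> by
  multiples of \<open>N\<close> with \<open>a \<le> p\<close> and \<open>q < b\<close>. Counting
  translates that enclose a vertex evaluates the crossing products as well. The quotient by the
  ideal is not known to be a domain, so only brackets are ever cancelled: they are Laurent
  monomials, hence units. Injectivity does not come from an inverse ring map. A generic complex
  point satisfies the cluster relations, so an invariant polynomial sent into the ideal vanishes at
  all generic points; these are dense, and the polynomial is zero. Injectivity, invertible Shi forms
  and fractions together characterise a localization, and the geometric statement is the general one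
  for localizations.\<close>

context cring
begin

lemma mult_minus_eq_zero_iff:
  assumes "v \<in> carrier R" "x \<in> carrier R" "y \<in> carrier R"
  shows "v \<otimes> (x \<ominus> y) = \<zero> \<longleftrightarrow> v \<otimes> x = v \<otimes> y"
proof -
  have "v \<otimes> x = v \<otimes> (x \<ominus> y) \<oplus> v \<otimes> y" using assms by algebra
  moreover have "v \<otimes> (x \<ominus> y) = v \<otimes> x \<ominus> v \<otimes> y" using assms by algebra
  ultimately show ?thesis using assms by (auto simp: a_minus_def r_neg)
qed

lemma mem_loc_frac_iff:
  assumes "a \<in> carrier R" "s \<in> carrier R"
  shows "(b, t) \<in> loc_frac R P a s \<longleftrightarrow> b \<in> carrier R \<and> t \<in> carrier R - P \<and>
    (\<exists>v \<in> carrier R - P. v \<otimes> (a \<otimes> t) = v \<otimes> (b \<otimes> s))"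
  unfolding loc_frac_def using assms by (auto simp: mult_minus_eq_zero_iff)

lemma carrier_diff_prime_closed:
  assumes "primeideal P R" "s \<in> carrier R - P" "t \<in> carrier R - P"
  shows "s \<otimes> t \<in> carrier R - P"
  using primeideal.I_prime[OF assms(1)] assms(2,3) by auto

lemma one_notin_prime:
  assumes "primeideal P R"
  shows "\<one> \<in> carrier R - P"
  using primeideal.I_notcarr[OF assms] ideal.one_imp_carrier[OF primeideal.axioms(1)[OF assms]]
  by auto

lemma self_mem_loc_frac:
  assumes "primeideal P R" "a \<in> carrier R" "s \<in> carrier R - P"
  shows "(a, s) \<in> loc_frac R P a s"
  using assms one_notin_prime[OF assms(1)] by (auto simp: mem_loc_frac_iff)

text \<open>Transitivity of equality of fractions, applied in both directions, shows that any member
  of a class determines the class.\<close>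

lemma loc_frac_eqI:
  assumes P: "primeideal P R" and a: "a \<in> carrier R" "s \<in> carrier R - P"
    and b: "(b, t) \<in> loc_frac R P a s"
  shows "loc_frac R P a s = loc_frac R P b t"
proof -
  from a b obtain v where bt: "b \<in> carrier R" "t \<in> carrier R - P" and v: "v \<in> carrier R - P"
    and e: "v \<otimes> (a \<otimes> t) = v \<otimes> (b \<otimes> s)"
    by (auto simp: mem_loc_frac_iff)
  have *: "(c, r) \<in> loc_frac R P b' t'"
    if "a' \<in> carrier R" "s' \<in> carrier R - P" "b' \<in> carrier R" "t' \<in> carrier R - P"
      "v \<otimes> (a' \<otimes> t') = v \<otimes> (b' \<otimes> s')" "(c, r) \<in> loc_frac R P a' s'" for a' s' b' t' c r
  proof -
    from that obtain w where c: "c \<in> carrier R" "r \<in> carrier R - P" and w: "w \<in> carrier R - P"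
      and f: "w \<otimes> (a' \<otimes> r) = w \<otimes> (c \<otimes> s')"
      by (auto simp: mem_loc_frac_iff)
    have cl: "a' \<in> carrier R" "b' \<in> carrier R" "c \<in> carrier R" "s' \<in> carrier R" "t' \<in> carrier R"
      "r \<in> carrier R" "v \<in> carrier R" "w \<in> carrier R"
      using that c v w by auto
    \<comment> \<open>The witness is \<open>v \<otimes> w \<otimes> s'\<close>: the factor
      \<open>s'\<close> is the middle denominator, which lets both given equations be applied, and
      primality keeps the product outside \<open>P\<close>.\<close>
    have "(v \<otimes> w \<otimes> s') \<otimes> (b' \<otimes> r) = (v \<otimes> (b' \<otimes> s')) \<otimes> (w \<otimes> r)" using cl by algebra
    also have "\<dots> = (v \<otimes> (a' \<otimes> t')) \<otimes> (w \<otimes> r)" using that by simp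
    also have "\<dots> = (w \<otimes> (a' \<otimes> r)) \<otimes> (v \<otimes> t')" using cl by algebra
    also have "\<dots> = (w \<otimes> (c \<otimes> s')) \<otimes> (v \<otimes> t')" using f by simp
    also have "\<dots> = (v \<otimes> w \<otimes> s') \<otimes> (c \<otimes> t')" using cl by algebra
    finally have "(v \<otimes> w \<otimes> s') \<otimes> (b' \<otimes> r) = (v \<otimes> w \<otimes> s') \<otimes> (c \<otimes> t')" .
    moreover have "v \<otimes> w \<otimes> s' \<in> carrier R - P"
      using carrier_diff_prime_closed[OF P] v w that(2) by blast
    ultimately show ?thesis using c cl by (subst mem_loc_frac_iff) blast+
  qed
  show ?thesis
    using *[OF a bt e] *[OF bt a e[symmetric]] by auto
qed

lemma loc_frac_eq_iff:
  assumes P: "primeideal P R" and a: "a \<in> carrier R" "s \<in> carrier R - P"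
    and b: "b \<in> carrier R" "t \<in> carrier R - P"
  shows "loc_frac R P a s = loc_frac R P b t \<longleftrightarrow>
    (\<exists>v \<in> carrier R - P. v \<otimes> (a \<otimes> t) = v \<otimes> (b \<otimes> s))"
proof -
  have "loc_frac R P a s = loc_frac R P b t \<longleftrightarrow> (b, t) \<in> loc_frac R P a s"
    using loc_frac_eqI[OF P a] self_mem_loc_frac[OF P b] by blast
  also have "\<dots> \<longleftrightarrow> (\<exists>v \<in> carrier R - P. v \<otimes> (a \<otimes> t) = v \<otimes> (b \<otimes> s))"
    using a b by (subst mem_loc_frac_iff) auto
  finally show ?thesis .
qed

text \<open>Operations on the localization are unions over all pairs of representatives. If the
  value does not depend on the representatives, all members of this nonempty union coincide.\<close>

lemma UN_loc_frac_eq: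
  assumes P: "primeideal P R" and a: "a \<in> carrier R" "s \<in> carrier R - P"
    and b: "b \<in> carrier R" "t \<in> carrier R - P"
    and F: "\<And>a' s' b' t'. \<lbrakk>a' \<in> carrier R; s' \<in> carrier R - P; loc_frac R P a s = loc_frac R P a' s';
      b' \<in> carrier R; t' \<in> carrier R - P; loc_frac R P b t = loc_frac R P b' t'\<rbrakk>
      \<Longrightarrow> F a' s' b' t' = F a s b t"
  shows "(\<Union>(a', s')\<in>loc_frac R P a s. \<Union>(b', t')\<in>loc_frac R P b t. F a' s' b' t') = F a s b t"
proof -
  have mem: "c \<in> carrier R \<and> r \<in> carrier R - P \<and> loc_frac R P e q = loc_frac R P c r"
    if "(c, r) \<in> loc_frac R P e q" "e \<in> carrier R" "q \<in> carrier R - P" for c r e q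
    using loc_frac_eqI[OF P that(2,3,1)] that by (subst (asm) mem_loc_frac_iff) auto
  have eq: "F a' s' b' t' = F a s b t"
    if "(a', s') \<in> loc_frac R P a s" "(b', t') \<in> loc_frac R P b t" for a' s' b' t'
    using mem[OF that(1) a] mem[OF that(2) b] by (intro F) auto
  have "(\<Union>(a', s')\<in>loc_frac R P a s. \<Union>(b', t')\<in>loc_frac R P b t. F a' s' b' t') =
      (\<Union>x\<in>loc_frac R P a s. \<Union>y\<in>loc_frac R P b t. F a s b t)"
    by (intro SUP_cong refl) (auto simp: eq split: prod.split)
  then show ?thesis using self_mem_loc_frac[OF P a] self_mem_loc_frac[OF P b] by auto
qed

lemma localization_mult:
  assumes P: "primeideal P R" and a: "a \<in> carrier R" "s \<in> carrier R - P"
    and b: "b \<in> carrier R" "t \<in> carrier R - P"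
  shows "loc_frac R P a s \<otimes>\<^bsub>localization R P\<^esub> loc_frac R P b t = loc_frac R P (a \<otimes> b) (s \<otimes> t)"
proof -
  have *: "loc_frac R P (a' \<otimes> b') (s' \<otimes> t') = loc_frac R P (a \<otimes> b) (s \<otimes> t)"
    if a': "a' \<in> carrier R" "s' \<in> carrier R - P" "loc_frac R P a s = loc_frac R P a' s'"
    and b': "b' \<in> carrier R" "t' \<in> carrier R - P" "loc_frac R P b t = loc_frac R P b' t'" for a' s' b' t'
  proof -
    obtain v w where v: "v \<in> carrier R - P" "v \<otimes> (a \<otimes> s') = v \<otimes> (a' \<otimes> s)"
      and w: "w \<in> carrier R - P" "w \<otimes> (b \<otimes> t') = w \<otimes> (b' \<otimes> t)"
      using a'(3) b'(3) loc_frac_eq_iff[OF P a a'(1,2)] loc_frac_eq_iff[OF P b b'(1,2)] by auto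
    have cl: "a \<in> carrier R" "b \<in> carrier R" "s \<in> carrier R" "t \<in> carrier R" "v \<in> carrier R"
       "a' \<in> carrier R" "b' \<in> carrier R" "s' \<in> carrier R" "t' \<in> carrier R" "w \<in> carrier R"
      using a b a' b' v w by auto
    have "(v \<otimes> w) \<otimes> ((a' \<otimes> b') \<otimes> (s \<otimes> t)) = (v \<otimes> (a' \<otimes> s)) \<otimes> (w \<otimes> (b' \<otimes> t))"
      using cl by algebra
    also have "\<dots> = (v \<otimes> (a \<otimes> s')) \<otimes> (w \<otimes> (b \<otimes> t'))" using v w by simp
    also have "\<dots> = (v \<otimes> w) \<otimes> ((a \<otimes> b) \<otimes> (s' \<otimes> t'))" using cl by algebra
    finally show ?thesis
      using carrier_diff_prime_closed[OF P] v w a b a' b'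
      by (subst loc_frac_eq_iff[OF P]) (auto intro!: bexI[of _ "v \<otimes> w"])
  qed
  have "loc_frac R P a s \<otimes>\<^bsub>localization R P\<^esub> loc_frac R P b t =
     (\<Union>(a, s)\<in>loc_frac R P a s. \<Union>(b, t)\<in>loc_frac R P b t. loc_frac R P (a \<otimes> b) (s \<otimes> t))"
    by (simp add: localization_def)
  also have "\<dots> = loc_frac R P (a \<otimes> b) (s \<otimes> t)"
    by (rule UN_loc_frac_eq[OF P a b]) (rule *)
  finally show ?thesis .
qed

lemma localization_add:
  assumes P: "primeideal P R" and a: "a \<in> carrier R" "s \<in> carrier R - P"
    and b: "b \<in> carrier R" "t \<in> carrier R - P"
  shows "loc_frac R P a s \<oplus>\<^bsub>localization R P\<^esub> loc_frac R P b t =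
    loc_frac R P ((a \<otimes> t) \<oplus> (b \<otimes> s)) (s \<otimes> t)"
proof -
  let ?F = "\<lambda>a s b t. loc_frac R P ((a \<otimes> t) \<oplus> (b \<otimes> s)) (s \<otimes> t)"
  have *: "?F a' s' b' t' = ?F a s b t"
    if a': "a' \<in> carrier R" "s' \<in> carrier R - P" "loc_frac R P a s = loc_frac R P a' s'"
    and b': "b' \<in> carrier R" "t' \<in> carrier R - P" "loc_frac R P b t = loc_frac R P b' t'" for a' s' b' t'
  proof -
    obtain v w where v: "v \<in> carrier R - P" "v \<otimes> (a \<otimes> s') = v \<otimes> (a' \<otimes> s)"
      and w: "w \<in> carrier R - P" "w \<otimes> (b \<otimes> t') = w \<otimes> (b' \<otimes> t)"
      using a'(3) b'(3) loc_frac_eq_iff[OF P a a'(1,2)] loc_frac_eq_iff[OF P b b'(1,2)] by auto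
    have cl: "a \<in> carrier R" "b \<in> carrier R" "s \<in> carrier R" "t \<in> carrier R" "v \<in> carrier R"
       "a' \<in> carrier R" "b' \<in> carrier R" "s' \<in> carrier R" "t' \<in> carrier R" "w \<in> carrier R"
      using a b a' b' v w by auto
    have "(v \<otimes> w) \<otimes> (((a' \<otimes> t') \<oplus> (b' \<otimes> s')) \<otimes> (s \<otimes> t)) =
        (v \<otimes> (a' \<otimes> s)) \<otimes> (w \<otimes> (t \<otimes> t')) \<oplus> (w \<otimes> (b' \<otimes> t)) \<otimes> (v \<otimes> (s \<otimes> s'))"
      using cl by algebra
    also have "\<dots> = (v \<otimes> (a \<otimes> s')) \<otimes> (w \<otimes> (t \<otimes> t')) \<oplus> (w \<otimes> (b \<otimes> t')) \<otimes> (v \<otimes> (s \<otimes> s'))"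
      using v w by simp
    also have "\<dots> = (v \<otimes> w) \<otimes> (((a \<otimes> t) \<oplus> (b \<otimes> s)) \<otimes> (s' \<otimes> t'))" using cl by algebra
    finally show ?thesis
      using carrier_diff_prime_closed[OF P] v w a b a' b'
      by (subst loc_frac_eq_iff[OF P]) (auto intro!: bexI[of _ "v \<otimes> w"])
  qed
  have "loc_frac R P a s \<oplus>\<^bsub>localization R P\<^esub> loc_frac R P b t =
     (\<Union>(a, s)\<in>loc_frac R P a s. \<Union>(b, t)\<in>loc_frac R P b t. ?F a s b t)"
    by (simp add: localization_def)
  also have "\<dots> = ?F a s b t"
    by (rule UN_loc_frac_eq[OF P a b]) (rule *)
  finally show ?thesis .
qed

end

lemma primeideal_subset: "primeideal P R \<Longrightarrow> P \<subseteq> carrier R"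
  using additive_subgroup.a_subset[OF ideal.axioms(1)[OF primeideal.axioms(1)]] .

text \<open>\<open>R\<close> is recognised as the ring of fractions of \<open>A\<close> with
  denominators \<open>S\<close> without being constructed. Injectivity of \<open>h\<close> lets
  equations be pulled back from \<open>R\<close> to \<open>A\<close> with no annihilating
  factor.\<close>

locale localization_hom = A: cring A + R: cring R
  for A :: "('a, 'm) ring_scheme" and R :: "('b, 'k) ring_scheme" and h :: "'a \<Rightarrow> 'b" and S +
  assumes hom: "h \<in> ring_hom A R"
    and inj: "inj_on h (carrier A)"
    and S_carrier: "S \<subseteq> carrier A"
    and S_one: "\<one>\<^bsub>A\<^esub> \<in> S"
    and S_mult: "\<And>s t. s \<in> S \<Longrightarrow> t \<in> S \<Longrightarrow> s \<otimes>\<^bsub>A\<^esub> t \<in> S"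
    and S_units: "\<And>s. s \<in> S \<Longrightarrow> h s \<in> Units R"
    and fraction: "\<And>r. r \<in> carrier R \<Longrightarrow>
      \<exists>a \<in> carrier A. \<exists>s \<in> S. r \<otimes>\<^bsub>R\<^esub> h s = h a"
begin

section \<open>The correspondence between primes of the ring of fractions and primes avoiding the
  denominators\<close>

definition contraction :: "'b set \<Rightarrow> 'a set" where
  "contraction Q = {a \<in> carrier A. h a \<in> Q}"

definition extension :: "'a set \<Rightarrow> 'b set" where
  "extension P = {r \<in> carrier R. \<exists>a \<in> P. \<exists>s \<in> S. r \<otimes>\<^bsub>R\<^esub> h s = h a}"

lemma h_closed [simp]: "a \<in> carrier A \<Longrightarrow> h a \<in> carrier R"
  using ring_hom_closed[OF hom] .

lemma h_mult: "a \<in> carrier A \<Longrightarrow> b \<in> carrier A \<Longrightarrow> h (a \<otimes>\<^bsub>A\<^esub> b) = h a \<otimes>\<^bsub>R\<^esub> h b"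
  using ring_hom_mult[OF hom] .

lemma h_add: "a \<in> carrier A \<Longrightarrow> b \<in> carrier A \<Longrightarrow> h (a \<oplus>\<^bsub>A\<^esub> b) = h a \<oplus>\<^bsub>R\<^esub> h b"
  using ring_hom_add[OF hom] .

lemma h_one: "h \<one>\<^bsub>A\<^esub> = \<one>\<^bsub>R\<^esub>"
  using ring_hom_one[OF hom] .

lemma h_eqD: "h a = h b \<Longrightarrow> a \<in> carrier A \<Longrightarrow> b \<in> carrier A \<Longrightarrow> a = b"
  using inj by (auto dest: inj_onD)

lemma S_closed: "s \<in> S \<Longrightarrow> s \<in> carrier A"
  using S_carrier by blast

lemma ring_hom_ring: "ring_hom_ring A R h"
  using hom by (intro ring_hom_ringI2 A.ring_axioms R.ring_axioms)

lemma unit_notin_prime: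
  assumes "primeideal Q R" "u \<in> Units R"
  shows "u \<notin> Q"
proof
  assume u: "u \<in> Q"
  interpret primeideal Q R by fact
  have "u \<otimes>\<^bsub>R\<^esub> inv\<^bsub>R\<^esub> u \<in> Q" using u assms(2) I_r_closed by blast
  then show False using R.one_notin_prime[OF assms(1)] assms(2) by simp
qed

lemma prime_contraction: "primeideal Q R \<Longrightarrow> primeideal (contraction Q) A"
  unfolding contraction_def
  by (rule ring_hom_ring.primeideal_vimage[OF ring_hom_ring A.is_cring])

lemma contraction_disjoint: "primeideal Q R \<Longrightarrow> contraction Q \<inter> S = {}"
  using unit_notin_prime S_units unfolding contraction_def by blast

lemma mem_contraction_iff: "a \<in> carrier A \<Longrightarrow> a \<in> contraction Q \<longleftrightarrow> h a \<in> Q"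
  by (simp add: contraction_def)

text \<open>The denominator \<open>h s\<close> is a unit, hence outside \<open>Q\<close>, so
  membership passes between an element and its numerator.\<close>

lemma mem_prime_iff:
  assumes Q: "primeideal Q R" and "r \<in> carrier R" "a \<in> carrier A" "s \<in> S"
    and "r \<otimes>\<^bsub>R\<^esub> h s = h a"
  shows "r \<in> Q \<longleftrightarrow> a \<in> contraction Q"
proof -
  interpret primeideal Q R by fact
  have "h s \<notin> Q" using unit_notin_prime[OF Q S_units[OF \<open>s \<in> S\<close>]] .
  then have "r \<in> Q \<longleftrightarrow> r \<otimes>\<^bsub>R\<^esub> h s \<in> Q"
    using assms I_prime[of r "h s"] I_r_closed[of r "h s"] S_closed by auto
  then show ?thesis using assms by (simp add: mem_contraction_iff)
qed

lemma contraction_inj: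
  assumes "primeideal Q R" "primeideal Q' R" "contraction Q = contraction Q'"
  shows "Q = Q'"
proof -
  have "r \<in> Q \<longleftrightarrow> r \<in> Q'" if r: "r \<in> carrier R" for r
    using fraction[OF r] mem_prime_iff[OF assms(1) r] mem_prime_iff[OF assms(2) r] assms(3) by metis
  moreover have "Q \<subseteq> carrier R" "Q' \<subseteq> carrier R"
    using assms(1,2) by (simp_all add: primeideal_subset)
  ultimately show ?thesis by blast
qed

text \<open>The definition of \<open>extension\<close> may pick another fraction for
  \<open>r\<close>. Cross multiplication and injectivity of \<open>h\<close> compare the two
  numerators, and primality strips the denominator, which is outside \<open>P\<close>.\<close>

lemma extension_iff:
  assumes P: "primeideal P A" "P \<inter> S = {}"
    and r: "r \<in> carrier R" "a \<in> carrier A" "s \<in> S" "r \<otimes>\<^bsub>R\<^esub> h s = h a"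
  shows "r \<in> extension P \<longleftrightarrow> a \<in> P"
proof
  assume "r \<in> extension P"
  then obtain b t where b: "b \<in> P" "t \<in> S" "r \<otimes>\<^bsub>R\<^esub> h t = h b"
    unfolding extension_def by blast
  interpret primeideal P A by fact
  have cl: "b \<in> carrier A" "t \<in> carrier A" "s \<in> carrier A" using b r S_closed Icarr by auto
  have "h (a \<otimes>\<^bsub>A\<^esub> t) = (r \<otimes>\<^bsub>R\<^esub> h s) \<otimes>\<^bsub>R\<^esub> h t"
    unfolding r(4) using cl r(2) by (simp add: h_mult)
  also have "\<dots> = (r \<otimes>\<^bsub>R\<^esub> h t) \<otimes>\<^bsub>R\<^esub> h s" using cl r(1) by (simp add: R.m_ac)
  also have "\<dots> = h (b \<otimes>\<^bsub>A\<^esub> s)" using cl b by (simp add: h_mult)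
  finally have "a \<otimes>\<^bsub>A\<^esub> t = b \<otimes>\<^bsub>A\<^esub> s" using cl r by (intro h_eqD) auto
  then have "a \<otimes>\<^bsub>A\<^esub> t \<in> P" using b(1) cl I_r_closed by simp
  then show "a \<in> P" using I_prime[of a t] r cl b P(2) by auto
qed (use r in \<open>auto simp: extension_def\<close>)

lemma prime_extension:
  assumes P: "primeideal P A" "P \<inter> S = {}"
  shows "primeideal (extension P) R"
proof -
  interpret P: primeideal P A by fact
  have frac: "\<exists>a s. a \<in> carrier A \<and> s \<in> S \<and> s \<in> carrier A \<and> r \<otimes>\<^bsub>R\<^esub> h s = h a \<and>
      (r \<in> extension P \<longleftrightarrow> a \<in> P)" if "r \<in> carrier R" for r
    using fraction[OF that] extension_iff[OF P that] S_closed by blast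
  have sub: "extension P \<subseteq> carrier R" unfolding extension_def by blast
  \<comment> \<open>This equivalence yields absorption, primality and, through the factor -1,
    closure under negation.\<close>
  have mult: "x \<otimes>\<^bsub>R\<^esub> y \<in> extension P \<longleftrightarrow> x \<in> extension P \<or> y \<in> extension P"
    if xy: "x \<in> carrier R" "y \<in> carrier R" for x y
  proof -
    obtain a s b t where a: "a \<in> carrier A" "s \<in> S" "s \<in> carrier A" "x \<otimes>\<^bsub>R\<^esub> h s = h a"
        "x \<in> extension P \<longleftrightarrow> a \<in> P"
      and b: "b \<in> carrier A" "t \<in> S" "t \<in> carrier A" "y \<otimes>\<^bsub>R\<^esub> h t = h b"
        "y \<in> extension P \<longleftrightarrow> b \<in> P"
      using frac[OF xy(1)] frac[OF xy(2)] by blast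
    have "(x \<otimes>\<^bsub>R\<^esub> y) \<otimes>\<^bsub>R\<^esub> h (s \<otimes>\<^bsub>A\<^esub> t) = (x \<otimes>\<^bsub>R\<^esub> h s) \<otimes>\<^bsub>R\<^esub> (y \<otimes>\<^bsub>R\<^esub> h t)"
      using xy a(1-3) b(1-3) by (simp add: h_mult R.m_ac)
    also have "\<dots> = h (a \<otimes>\<^bsub>A\<^esub> b)" using a b by (simp add: h_mult)
    finally have "x \<otimes>\<^bsub>R\<^esub> y \<in> extension P \<longleftrightarrow> a \<otimes>\<^bsub>A\<^esub> b \<in> P"
      using xy a b S_mult by (intro extension_iff[OF P]) auto
    also have "\<dots> \<longleftrightarrow> a \<in> P \<or> b \<in> P"
      using a b P.I_prime P.I_l_closed P.I_r_closed by blast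
    finally show ?thesis using a b by simp
  qed
  have add: "x \<oplus>\<^bsub>R\<^esub> y \<in> extension P" if xy: "x \<in> extension P" "y \<in> extension P" for x y
  proof -
    have xy': "x \<in> carrier R" "y \<in> carrier R" using xy sub by auto
    obtain a s b t where a: "a \<in> carrier A" "s \<in> S" "s \<in> carrier A" "x \<otimes>\<^bsub>R\<^esub> h s = h a" "a \<in> P"
      and b: "b \<in> carrier A" "t \<in> S" "t \<in> carrier A" "y \<otimes>\<^bsub>R\<^esub> h t = h b" "b \<in> P"
      using frac[OF xy'(1)] frac[OF xy'(2)] xy by blast
    have "(x \<oplus>\<^bsub>R\<^esub> y) \<otimes>\<^bsub>R\<^esub> h (s \<otimes>\<^bsub>A\<^esub> t) =
        (x \<otimes>\<^bsub>R\<^esub> h s) \<otimes>\<^bsub>R\<^esub> h t \<oplus>\<^bsub>R\<^esub> (y \<otimes>\<^bsub>R\<^esub> h t) \<otimes>\<^bsub>R\<^esub> h s"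
      using xy' a(1-3) b(1-3) by (simp add: h_mult R.l_distr R.r_distr R.m_ac)
    also have "\<dots> = h (a \<otimes>\<^bsub>A\<^esub> t \<oplus>\<^bsub>A\<^esub> b \<otimes>\<^bsub>A\<^esub> s)" using a b by (simp add: h_mult h_add)
    finally have "x \<oplus>\<^bsub>R\<^esub> y \<in> extension P \<longleftrightarrow> a \<otimes>\<^bsub>A\<^esub> t \<oplus>\<^bsub>A\<^esub> b \<otimes>\<^bsub>A\<^esub> s \<in> P"
      using xy' a b S_mult by (intro extension_iff[OF P]) auto
    also have "\<dots>" using a b by (intro P.a_closed P.I_r_closed) auto
    finally show ?thesis by simp
  qed
  have zero: "\<zero>\<^bsub>R\<^esub> \<in> extension P"
  proof -
    have "h \<zero>\<^bsub>A\<^esub> = \<zero>\<^bsub>R\<^esub>" using ring_hom_zero[OF hom A.ring_axioms R.ring_axioms] .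
    then have z: "\<zero>\<^bsub>R\<^esub> \<otimes>\<^bsub>R\<^esub> h \<one>\<^bsub>A\<^esub> = h \<zero>\<^bsub>A\<^esub>" by (simp add: h_one)
    show ?thesis
      using extension_iff[OF P R.zero_closed A.zero_closed S_one z]
        additive_subgroup.zero_closed[OF P.additive_subgroup_axioms] by blast
  qed
  have "ideal (extension P) R"
  proof (rule idealI)
    show "subgroup (extension P) (add_monoid R)"
    proof (rule R.add.subgroupI)
      show "\<ominus>\<^bsub>R\<^esub> x \<in> extension P" if "x \<in> extension P" for x
      proof -
        have x: "x \<in> carrier R" using that sub by auto
        have "\<ominus>\<^bsub>R\<^esub> \<one>\<^bsub>R\<^esub> \<otimes>\<^bsub>R\<^esub> x \<in> extension P" using mult x that by simp
        then show ?thesis using x by (simp add: R.l_minus)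
      qed
    qed (use sub zero add in auto)
  qed (use mult sub R.ring_axioms in auto)
  moreover have "carrier R \<noteq> extension P"
  proof -
    have "\<one>\<^bsub>R\<^esub> \<otimes>\<^bsub>R\<^esub> h \<one>\<^bsub>A\<^esub> = h \<one>\<^bsub>A\<^esub>" by simp
    then have "\<one>\<^bsub>R\<^esub> \<notin> extension P"
      using P(2) S_one by (subst extension_iff[OF P]) auto
    then show ?thesis by auto
  qed
  ultimately show ?thesis using mult R.is_cring by (intro primeidealI) blast+
qed

lemma contraction_extension:
  assumes P: "primeideal P A" "P \<inter> S = {}"
  shows "contraction (extension P) = P"
proof -
  have "h a \<in> extension P \<longleftrightarrow> a \<in> P" if "a \<in> carrier A" for a
  proof (rule extension_iff[OF P _ that S_one])
    show "h a \<otimes>\<^bsub>R\<^esub> h \<one>\<^bsub>A\<^esub> = h a" using that by (simp add: h_one)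
  qed (use that in simp)
  moreover have "P \<subseteq> carrier A" using P(1) by (rule primeideal_subset)
  ultimately show ?thesis unfolding contraction_def by blast
qed

lemma contraction_image:
  "contraction ` {Q. primeideal Q R} = {P. primeideal P A \<and> P \<inter> S = {}}"
proof (intro equalityI subsetI)
  fix P assume "P \<in> contraction ` {Q. primeideal Q R}"
  then show "P \<in> {P. primeideal P A \<and> P \<inter> S = {}}"
    using prime_contraction contraction_disjoint by auto
next
  fix P assume "P \<in> {P. primeideal P A \<and> P \<inter> S = {}}"
  then show "P \<in> contraction ` {Q. primeideal Q R}"
    using prime_extension contraction_extension by (auto intro!: image_eqI[of _ _ "extension P"])
qed

end

section \<open>The Zariski topology under contraction\<close>

context cring
begin

lemma openin_zariski':
  "openin (zariski R) U \<longleftrightarrow> (\<exists>T \<subseteq> carrier R. U = {P. primeideal P R \<and> \<not> T \<subseteq> P})"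
proof -
  have "{P. primeideal P R} - vanishing R T = {P. primeideal P R \<and> \<not> T \<subseteq> P}" for T
    unfolding vanishing_def by blast
  then show ?thesis unfolding openin_zariski by simp
qed

lemma topspace_zariski: "topspace (zariski R) = {P. primeideal P R}"
proof -
  have "openin (zariski R) {P. primeideal P R}"
    unfolding openin_zariski'
  proof (intro exI[of _ "carrier R"] conjI subset_refl)
    show "{P. primeideal P R} = {P. primeideal P R \<and> \<not> carrier R \<subseteq> P}"
      using one_notin_prime by blast
  qed
  moreover have "topspace (zariski R) \<subseteq> {P. primeideal P R}"
    using openin_topspace[of "zariski R"] unfolding openin_zariski' by blast
  ultimately show ?thesis using openin_subset by blast
qed

end

context localization_hom
begin

lemma preimage_contraction:
  assumes "T \<subseteq> carrier A"
  shows "{Q. primeideal Q R \<and> contraction Q \<in> {P. primeideal P A \<and> \<not> T \<subseteq> P}} =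
    {Q. primeideal Q R \<and> \<not> h ` T \<subseteq> Q}"
proof -
  have "T \<subseteq> contraction Q \<longleftrightarrow> h ` T \<subseteq> Q" for Q
    using assms unfolding contraction_def by blast
  then show ?thesis using prime_contraction by auto
qed

lemma openin_preimage_contraction:
  assumes "openin (zariski A) V"
  shows "openin (zariski R) {Q. primeideal Q R \<and> contraction Q \<in> V}"
proof -
  obtain T where T: "T \<subseteq> carrier A" "V = {P. primeideal P A \<and> \<not> T \<subseteq> P}"
    using assms unfolding A.openin_zariski' by blast
  have "{Q. primeideal Q R \<and> contraction Q \<in> V} = {Q. primeideal Q R \<and> \<not> h ` T \<subseteq> Q}"
    unfolding T(2) by (rule preimage_contraction[OF T(1)])
  moreover have "h ` T \<subseteq> carrier R" using T(1) by auto
  ultimately show ?thesis unfolding R.openin_zariski' by blast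
qed

text \<open>Membership in a prime is decided by numerators, so the image of the open set given by
  \<open>T\<close> is given by the numerators of \<open>T\<close>, inside the open image of the
  whole spectrum.\<close>

lemma openin_image_contraction:
  assumes U: "openin (zariski A) {P. primeideal P A \<and> P \<inter> S = {}}"
    and W: "openin (zariski R) W"
  shows "openin (zariski A) (contraction ` W)"
proof -
  obtain T where T: "T \<subseteq> carrier R" "W = {Q. primeideal Q R \<and> \<not> T \<subseteq> Q}"
    using W unfolding R.openin_zariski' by blast
  define T' where "T' = {a \<in> carrier A. \<exists>t\<in>T. \<exists>s\<in>S. t \<otimes>\<^bsub>R\<^esub> h s = h a}"
  have T': "T \<subseteq> Q \<longleftrightarrow> T' \<subseteq> contraction Q" if Q: "primeideal Q R" for Q
  proof
    assume "T \<subseteq> Q"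
    show "T' \<subseteq> contraction Q"
    proof
      fix a assume "a \<in> T'"
      then obtain t s where "a \<in> carrier A" "t \<in> T" "s \<in> S" "t \<otimes>\<^bsub>R\<^esub> h s = h a"
        unfolding T'_def by blast
      then show "a \<in> contraction Q" using mem_prime_iff[OF Q, of t a s] T(1) \<open>T \<subseteq> Q\<close> by blast
    qed
  next
    assume sub: "T' \<subseteq> contraction Q"
    show "T \<subseteq> Q"
    proof
      fix t assume t: "t \<in> T"
      then obtain a s where "a \<in> carrier A" "s \<in> S" "t \<otimes>\<^bsub>R\<^esub> h s = h a"
        using fraction T(1) by blast
      moreover from this t have "a \<in> T'" unfolding T'_def by blast
      ultimately show "t \<in> Q" using mem_prime_iff[OF Q, of t a s] T(1) sub t by blast
    qed
  qed
  have "contraction ` W = {P. primeideal P A \<and> P \<inter> S = {}} \<inter> {P. primeideal P A \<and> \<not> T' \<subseteq> P}"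
  proof (intro equalityI subsetI)
    fix P assume "P \<in> contraction ` W"
    then obtain Q where "primeideal Q R" "\<not> T \<subseteq> Q" "P = contraction Q" unfolding T(2) by blast
    then show "P \<in> {P. primeideal P A \<and> P \<inter> S = {}} \<inter> {P. primeideal P A \<and> \<not> T' \<subseteq> P}"
      using T'[of Q] prime_contraction[of Q] contraction_disjoint[of Q] by blast
  next
    fix P assume P: "P \<in> {P. primeideal P A \<and> P \<inter> S = {}} \<inter> {P. primeideal P A \<and> \<not> T' \<subseteq> P}"
    then obtain Q where "primeideal Q R" "P = contraction Q" using contraction_image by blast
    then show "P \<in> contraction ` W" using P T'[of Q] unfolding T(2) by blast
  qed
  moreover have "openin (zariski A) {P. primeideal P A \<and> \<not> T' \<subseteq> P}"
    unfolding A.openin_zariski'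
    by (rule exI[of _ T']) (simp add: T'_def)
  ultimately show ?thesis using U by auto
qed

lemma homeomorphic_map_contraction:
  assumes U: "openin (zariski A) {P. primeideal P A \<and> P \<inter> S = {}}"
  shows "homeomorphic_map (zariski R)
    (subtopology (zariski A) {P. primeideal P A \<and> P \<inter> S = {}}) contraction"
    (is "homeomorphic_map _ (subtopology _ ?U) _")
proof (rule bijective_open_imp_homeomorphic_map)
  have img: "contraction ` topspace (zariski R) = ?U"
    using contraction_image by (simp add: R.topspace_zariski)
  have top: "topspace (subtopology (zariski A) ?U) = ?U"
    by (auto simp: A.topspace_zariski)
  show "contraction ` topspace (zariski R) = topspace (subtopology (zariski A) ?U)"
    unfolding top img ..
  show "continuous_map (zariski R) (subtopology (zariski A) ?U) contraction"
    using img openin_preimage_contraction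
    by (auto simp: continuous_map_def top openin_open_subtopology[OF U] R.topspace_zariski
      A.topspace_zariski prime_contraction)
  show "open_map (zariski R) (subtopology (zariski A) ?U) contraction"
    unfolding open_map_def
  proof (intro allI impI)
    fix W assume W: "openin (zariski R) W"
    have "contraction ` W \<subseteq> ?U" using openin_subset[OF W] img by blast
    then show "openin (subtopology (zariski A) ?U) (contraction ` W)"
      using openin_image_contraction[OF U W] by (simp add: openin_open_subtopology[OF U])
  qed
  show "inj_on contraction (topspace (zariski R))"
    unfolding R.topspace_zariski by (intro inj_onI contraction_inj) simp_all
qed

section \<open>Comparison of the local rings\<close>

definition transfer :: "'b set \<Rightarrow> ('a \<times> 'a) set \<Rightarrow> ('b \<times> 'b) set" where
  "transfer Q X = (\<Union>(a, s)\<in>X. loc_frac R Q (h a) (h s))"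

lemma h_notin:
  "s \<in> carrier A - contraction Q \<Longrightarrow> h s \<in> carrier R - Q"
  by (simp add: contraction_def)

text \<open>Equal fractions have equal images under \<open>h\<close>, so the union in
  \<open>transfer\<close> ranges over copies of one class, and \<open>transfer\<close> is the
  induced map of local rings.\<close>

lemma transfer_frac:
  assumes Q: "primeideal Q R" and a: "a \<in> carrier A" "s \<in> carrier A - contraction Q"
  shows "transfer Q (loc_frac A (contraction Q) a s) = loc_frac R Q (h a) (h s)"
proof -
  note P = prime_contraction[OF Q]
  have "loc_frac R Q (h b) (h t) = loc_frac R Q (h a) (h s)"
    if bt: "(b, t) \<in> loc_frac A (contraction Q) a s" for b t
  proof -
    obtain v where b: "b \<in> carrier A" "t \<in> carrier A - contraction Q"
      and v: "v \<in> carrier A - contraction Q" "v \<otimes>\<^bsub>A\<^esub> (a \<otimes>\<^bsub>A\<^esub> t) = v \<otimes>\<^bsub>A\<^esub> (b \<otimes>\<^bsub>A\<^esub> s)"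
      using bt a A.mem_loc_frac_iff[of a s b t "contraction Q"] by auto
    have "h v \<otimes>\<^bsub>R\<^esub> (h a \<otimes>\<^bsub>R\<^esub> h t) = h (v \<otimes>\<^bsub>A\<^esub> (a \<otimes>\<^bsub>A\<^esub> t))"
      using a b v(1) by (simp add: h_mult)
    also have "\<dots> = h v \<otimes>\<^bsub>R\<^esub> (h b \<otimes>\<^bsub>R\<^esub> h s)"
      unfolding v(2) using a b v(1) by (simp add: h_mult)
    finally show ?thesis
      using a b h_notin v(1)
      by (subst R.loc_frac_eq_iff[OF Q]) (auto simp: contraction_def intro!: bexI[of _ "h v"])
  qed
  then have "transfer Q (loc_frac A (contraction Q) a s) =
      (\<Union>x\<in>loc_frac A (contraction Q) a s. loc_frac R Q (h a) (h s))"
    unfolding transfer_def by (intro SUP_cong refl) (auto split: prod.split)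
  then show ?thesis using A.self_mem_loc_frac[OF P a] by auto
qed

text \<open>The point is uniformity: one numerator and one denominator over \<open>A\<close> serve
  all primes avoiding \<open>g\<close>. This carries a local presentation of a section by a single
  fraction from \<open>R\<close> back to \<open>A\<close>.\<close>

lemma frac_from_A:
  assumes "c \<in> carrier R" "g \<in> carrier R"
  obtains a s where "a \<in> carrier A" "s \<in> carrier A"
    "\<And>Q. primeideal Q R \<Longrightarrow> g \<notin> Q \<Longrightarrow>
       s \<notin> contraction Q \<and> loc_frac R Q c g = loc_frac R Q (h a) (h s)"
proof -
  obtain a1 s1 a2 s2 where a1: "a1 \<in> carrier A" "s1 \<in> S" "s1 \<in> carrier A" "c \<otimes>\<^bsub>R\<^esub> h s1 = h a1"
    and a2: "a2 \<in> carrier A" "s2 \<in> S" "s2 \<in> carrier A" "g \<otimes>\<^bsub>R\<^esub> h s2 = h a2"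
    using fraction[OF assms(1)] fraction[OF assms(2)] S_closed by blast
  \<comment> \<open>With \<open>c = a1 / s1\<close> and \<open>g = a2 / s2\<close>, the quotient
    \<open>c / g\<close> is \<open>(a1 s2) / (a2 s1)\<close>.\<close>
  let ?a = "a1 \<otimes>\<^bsub>A\<^esub> s2" and ?s = "a2 \<otimes>\<^bsub>A\<^esub> s1"
  show ?thesis
  proof (rule that)
    fix Q assume Q: "primeideal Q R" and g: "g \<notin> Q"
    have "a2 \<in> carrier A - contraction Q"
      using mem_prime_iff[OF Q assms(2) a2(1,2,4)] g a2(1) by blast
    moreover have "s1 \<in> carrier A - contraction Q" using contraction_disjoint[OF Q] a1 by blast
    ultimately have s: "?s \<in> carrier A - contraction Q"
      using A.carrier_diff_prime_closed[OF prime_contraction[OF Q]] by blast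
    have "c \<otimes>\<^bsub>R\<^esub> h ?s = c \<otimes>\<^bsub>R\<^esub> (h a2 \<otimes>\<^bsub>R\<^esub> h s1)" using a1 a2 by (simp add: h_mult)
    also have "\<dots> = (c \<otimes>\<^bsub>R\<^esub> h s1) \<otimes>\<^bsub>R\<^esub> (g \<otimes>\<^bsub>R\<^esub> h s2)"
      unfolding a2(4)[symmetric] using assms a1(1-3) a2(1-3) by (simp add: R.m_ac)
    also have "\<dots> = (h a1 \<otimes>\<^bsub>R\<^esub> h s2) \<otimes>\<^bsub>R\<^esub> g"
      unfolding a1(4) using assms a1(1-3) a2(1-3) by (simp add: R.m_ac)
    also have "\<dots> = h ?a \<otimes>\<^bsub>R\<^esub> g" using a1 a2 by (simp add: h_mult)
    finally have "c \<otimes>\<^bsub>R\<^esub> h ?s = h ?a \<otimes>\<^bsub>R\<^esub> g" .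
    then have "loc_frac R Q c g = loc_frac R Q (h ?a) (h ?s)"
      using R.one_notin_prime[OF Q] assms g h_notin[OF s] a1 a2
      by (subst R.loc_frac_eq_iff[OF Q]) (auto intro!: bexI[of _ "\<one>\<^bsub>R\<^esub>"])
    then show "?s \<notin> contraction Q \<and> loc_frac R Q c g = loc_frac R Q (h ?a) (h ?s)"
      using s by blast
  qed (use a1 a2 in auto)
qed

lemma localization_carrierD:
  assumes "X \<in> carrier (localization B P)"
  shows "\<exists>a s. a \<in> carrier B \<and> s \<in> carrier B - P \<and> X = loc_frac B P a s"
  using assms unfolding localization_def by auto

lemma localization_carrierI:
  assumes "a \<in> carrier B" "s \<in> carrier B - P"
  shows "loc_frac B P a s \<in> carrier (localization B P)"
  using assms unfolding localization_def by auto

lemma transfer_bij: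
  assumes Q: "primeideal Q R"
  shows "bij_betw (transfer Q) (carrier (localization A (contraction Q))) (carrier (localization R Q))"
  unfolding bij_betw_def
proof
  note P = prime_contraction[OF Q]
  show "inj_on (transfer Q) (carrier (localization A (contraction Q)))"
  proof (rule inj_onI)
    fix X Y assume X': "X \<in> carrier (localization A (contraction Q))"
      and Y': "Y \<in> carrier (localization A (contraction Q))" and eq: "transfer Q X = transfer Q Y"
    then obtain a s b t where a: "a \<in> carrier A" "s \<in> carrier A - contraction Q"
      and X: "X = loc_frac A (contraction Q) a s"
      and b: "b \<in> carrier A" "t \<in> carrier A - contraction Q"
      and Y: "Y = loc_frac A (contraction Q) b t"
      using localization_carrierD[OF X'] localization_carrierD[OF Y'] by blast
    have "loc_frac R Q (h a) (h s) = loc_frac R Q (h b) (h t)"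
      using eq transfer_frac[OF Q a] transfer_frac[OF Q b] X Y by simp
    then obtain w where w: "w \<in> carrier R - Q" "w \<otimes>\<^bsub>R\<^esub> (h a \<otimes>\<^bsub>R\<^esub> h t) = w \<otimes>\<^bsub>R\<^esub> (h b \<otimes>\<^bsub>R\<^esub> h s)"
      using R.loc_frac_eq_iff[OF Q h_closed[OF a(1)] h_notin[OF a(2)] h_closed[OF b(1)] h_notin[OF b(2)]]
      by blast
    \<comment> \<open>The witness \<open>w\<close> lives in \<open>R\<close>; its numerator
      \<open>c\<close> lies outside the contraction and replaces it as a witness in
      \<open>A\<close>.\<close>
    obtain c r where c: "c \<in> carrier A" "r \<in> S" "r \<in> carrier A" "w \<otimes>\<^bsub>R\<^esub> h r = h c"
      using fraction[of w] w(1) S_closed by blast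
    have c': "c \<in> carrier A - contraction Q" using mem_prime_iff[OF Q _ c(1,2,4)] w(1) c(1) by blast
    have e: "h (c \<otimes>\<^bsub>A\<^esub> (x \<otimes>\<^bsub>A\<^esub> y)) = h r \<otimes>\<^bsub>R\<^esub> (w \<otimes>\<^bsub>R\<^esub> (h x \<otimes>\<^bsub>R\<^esub> h y))"
      if "x \<in> carrier A" "y \<in> carrier A" for x y
    proof -
      have "h (c \<otimes>\<^bsub>A\<^esub> (x \<otimes>\<^bsub>A\<^esub> y)) = (w \<otimes>\<^bsub>R\<^esub> h r) \<otimes>\<^bsub>R\<^esub> (h x \<otimes>\<^bsub>R\<^esub> h y)"
        unfolding c(4) using that c(1) by (simp add: h_mult)
      then show ?thesis using that w(1) c(3) by (simp add: R.m_ac)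
    qed
    have "c \<otimes>\<^bsub>A\<^esub> (a \<otimes>\<^bsub>A\<^esub> t) = c \<otimes>\<^bsub>A\<^esub> (b \<otimes>\<^bsub>A\<^esub> s)"
      using e[of a t] e[of b s] w(2) a b c(1) by (intro h_eqD) auto
    then show "X = Y" unfolding X Y using A.loc_frac_eq_iff[OF P a b] c' by blast
  qed
  show "transfer Q ` carrier (localization A (contraction Q)) = carrier (localization R Q)"
  proof (intro equalityI subsetI)
    fix Y assume "Y \<in> transfer Q ` carrier (localization A (contraction Q))"
    then obtain X where X': "X \<in> carrier (localization A (contraction Q))" "Y = transfer Q X" by blast
    obtain a s where a: "a \<in> carrier A" "s \<in> carrier A - contraction Q"
      and X: "X = loc_frac A (contraction Q) a s"
      using localization_carrierD[OF X'(1)] by blast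
    show "Y \<in> carrier (localization R Q)"
      unfolding X'(2) X transfer_frac[OF Q a]
      by (rule localization_carrierI[OF h_closed[OF a(1)] h_notin[OF a(2)]])
  next
    fix Y assume "Y \<in> carrier (localization R Q)"
    then obtain c g where cg: "c \<in> carrier R" "g \<in> carrier R" "g \<notin> Q" "Y = loc_frac R Q c g"
      using localization_carrierD by blast
    obtain a s where a: "a \<in> carrier A" "s \<in> carrier A"
      and *: "\<And>Q. primeideal Q R \<Longrightarrow> g \<notin> Q \<Longrightarrow>
        s \<notin> contraction Q \<and> loc_frac R Q c g = loc_frac R Q (h a) (h s)"
      using frac_from_A[OF cg(1,2)] by blast
    have s: "s \<in> carrier A - contraction Q" using *[OF Q cg(3)] a(2) by blast
    have "Y = transfer Q (loc_frac A (contraction Q) a s)"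
      unfolding transfer_frac[OF Q a(1) s] cg(4) using *[OF Q cg(3)] by blast
    then show "Y \<in> transfer Q ` carrier (localization A (contraction Q))"
      using localization_carrierI[OF a(1) s] by blast
  qed
qed

lemma transfer_mult:
  assumes Q: "primeideal Q R" and "X \<in> carrier (localization A (contraction Q))"
    "Y \<in> carrier (localization A (contraction Q))"
  shows "transfer Q (X \<otimes>\<^bsub>localization A (contraction Q)\<^esub> Y) =
    transfer Q X \<otimes>\<^bsub>localization R Q\<^esub> transfer Q Y"
proof -
  note P = prime_contraction[OF Q]
  obtain a s b t where a: "a \<in> carrier A" "s \<in> carrier A - contraction Q"
      and X: "X = loc_frac A (contraction Q) a s"
      and b: "b \<in> carrier A" "t \<in> carrier A - contraction Q"
      and Y: "Y = loc_frac A (contraction Q) b t"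
    using localization_carrierD[OF assms(2)] localization_carrierD[OF assms(3)] by blast
  note st = A.carrier_diff_prime_closed[OF P a(2) b(2)]
  show ?thesis
    unfolding X Y A.localization_mult[OF P a b] transfer_frac[OF Q a] transfer_frac[OF Q b]
      R.localization_mult[OF Q h_closed[OF a(1)] h_notin[OF a(2)] h_closed[OF b(1)] h_notin[OF b(2)]]
    using transfer_frac[OF Q A.m_closed[OF a(1) b(1)] st] a b by (simp add: h_mult)
qed

lemma transfer_add:
  assumes Q: "primeideal Q R" and "X \<in> carrier (localization A (contraction Q))"
    "Y \<in> carrier (localization A (contraction Q))"
  shows "transfer Q (X \<oplus>\<^bsub>localization A (contraction Q)\<^esub> Y) =
    transfer Q X \<oplus>\<^bsub>localization R Q\<^esub> transfer Q Y"
proof -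
  note P = prime_contraction[OF Q]
  obtain a s b t where a: "a \<in> carrier A" "s \<in> carrier A - contraction Q"
      and X: "X = loc_frac A (contraction Q) a s"
      and b: "b \<in> carrier A" "t \<in> carrier A - contraction Q"
      and Y: "Y = loc_frac A (contraction Q) b t"
    using localization_carrierD[OF assms(2)] localization_carrierD[OF assms(3)] by blast
  note st = A.carrier_diff_prime_closed[OF P a(2) b(2)]
  show ?thesis
    unfolding X Y A.localization_add[OF P a b] transfer_frac[OF Q a] transfer_frac[OF Q b]
      R.localization_add[OF Q h_closed[OF a(1)] h_notin[OF a(2)] h_closed[OF b(1)] h_notin[OF b(2)]]
    using transfer_frac[OF Q _ st, of "a \<otimes>\<^bsub>A\<^esub> t \<oplus>\<^bsub>A\<^esub> b \<otimes>\<^bsub>A\<^esub> s"] a b by (simp add: h_mult h_add)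
qed

section \<open>Comparison of the sections of the structure sheaves\<close>

definition sheaf_map ::
    "'a set set \<Rightarrow> ('a set \<Rightarrow> ('a \<times> 'a) set) \<Rightarrow> 'b set \<Rightarrow> ('b \<times> 'b) set" where
  "sheaf_map V s = (\<lambda>Q\<in>{Q. primeideal Q R \<and> contraction Q \<in> V}. transfer Q (s (contraction Q)))"

lemma regular_sections_value:
  "s \<in> regular_sections A V \<Longrightarrow> P \<in> V \<Longrightarrow> s P \<in> carrier (localization A P)"
  unfolding regular_sections_def by (auto dest: PiE_mem)

lemma regular_sections_local:
  assumes "s \<in> regular_sections B V" "P \<in> V"
  shows "\<exists>V' a g. openin (zariski B) V' \<and> P \<in> V' \<and> V' \<subseteq> V \<and>
    a \<in> carrier B \<and> g \<in> carrier B \<and> (\<forall>Q\<in>V'. g \<notin> Q \<and> s Q = loc_frac B Q a g)"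
  using assms(2) conjunct2[OF assms(1)[unfolded regular_sections_def mem_Collect_eq]] by (rule bspec[rotated])

lemma contraction_surj:
  assumes "primeideal P A" "P \<inter> S = {}"
  obtains Q where "primeideal Q R" "P = contraction Q"
  using prime_extension[OF assms] contraction_extension[OF assms] by metis

lemma sheaf_map_regular:
  assumes s: "s \<in> regular_sections A V"
  shows "sheaf_map V s \<in> regular_sections R {Q. primeideal Q R \<and> contraction Q \<in> V}"
  unfolding regular_sections_def
proof (intro CollectI conjI ballI)
  let ?W = "{Q. primeideal Q R \<and> contraction Q \<in> V}"
  show "sheaf_map V s \<in> (\<Pi>\<^sub>E Q\<in>?W. carrier (localization R Q))"
    unfolding sheaf_map_def restrict_PiE_iff
    using bij_betwE[OF transfer_bij] regular_sections_value[OF s] by blast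
  fix Q assume Q: "Q \<in> ?W"
  then have "contraction Q \<in> V" by blast
  from regular_sections_local[OF s this] obtain V' a g where V': "openin (zariski A) V'" "contraction Q \<in> V'" "V' \<subseteq> V"
    and a: "a \<in> carrier A" "g \<in> carrier A"
    and s': "\<forall>P\<in>V'. g \<notin> P \<and> s P = loc_frac A P a g"
    by (elim exE conjE)
  have s: "g \<notin> P \<and> s P = loc_frac A P a g" if "P \<in> V'" for P
    using s' that by blast
  let ?W' = "{Q. primeideal Q R \<and> contraction Q \<in> V'}"
  have w: "h g \<notin> Q' \<and> sheaf_map V s Q' = loc_frac R Q' (h a) (h g)" if Q': "Q' \<in> ?W'" for Q'
  proof -
    have g: "g \<in> carrier A - contraction Q'" using s Q' a(2) by blast
    have "sheaf_map V s Q' = transfer Q' (loc_frac A (contraction Q') a g)"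
      using Q' V'(3) s unfolding sheaf_map_def by auto
    then show ?thesis using transfer_frac[OF _ a(1) g] h_notin[OF g] Q' by auto
  qed
  have mem: "Q \<in> ?W'" and sub: "?W' \<subseteq> ?W" using Q V' by auto
  show "\<exists>W a g. openin (zariski R) W \<and> Q \<in> W \<and> W \<subseteq> ?W \<and>
       a \<in> carrier R \<and> g \<in> carrier R \<and> (\<forall>Q\<in>W. g \<notin> Q \<and> sheaf_map V s Q = loc_frac R Q a g)"
    by (intro exI[of _ ?W'] exI[of _ "h a"] exI[of _ "h g"] conjI ballI mem sub h_closed a
        openin_preimage_contraction[OF V'(1)] conjunct1[OF w] conjunct2[OF w])
qed

lemma sheaf_map_inj:
  assumes V: "V \<subseteq> {P. primeideal P A \<and> P \<inter> S = {}}"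
  shows "inj_on (sheaf_map V) (regular_sections A V)"
proof (rule inj_onI)
  fix s t assume s: "s \<in> regular_sections A V" and t: "t \<in> regular_sections A V"
    and eq: "sheaf_map V s = sheaf_map V t"
  show "s = t"
  proof (rule PiE_ext)
    show "s \<in> (\<Pi>\<^sub>E P\<in>V. carrier (localization A P))" "t \<in> (\<Pi>\<^sub>E P\<in>V. carrier (localization A P))"
      using s t unfolding regular_sections_def by auto
    fix P assume P: "P \<in> V"
    then have "primeideal P A" "P \<inter> S = {}" using V by blast+
    then obtain Q where Q: "primeideal Q R" "P = contraction Q" by (rule contraction_surj)
    have "transfer Q (s P) = transfer Q (t P)"
      using fun_cong[OF eq, of Q] P Q unfolding sheaf_map_def by simp
    moreover have "inj_on (transfer Q) (carrier (localization A P))"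
      using transfer_bij[OF Q(1)] Q(2) bij_betw_imp_inj_on by blast
    ultimately show "s P = t P"
      using regular_sections_value[OF s P] regular_sections_value[OF t P] by (auto dest: inj_onD)
  qed
qed

lemma extension_contraction:
  assumes "primeideal Q R"
  shows "extension (contraction Q) = Q"
  using prime_extension[OF prime_contraction contraction_disjoint]
    contraction_extension[OF prime_contraction contraction_disjoint] assms
  by (intro contraction_inj)

text \<open>The section is inverted stalk by stalk. For regularity, \<open>frac_from_A\<close>
  supplies a common fraction over \<open>A\<close> near each prime, on a set that is open because
  contraction maps open sets to open sets.\<close>

lemma sheaf_map_surj:
  assumes U: "openin (zariski A) {P. primeideal P A \<and> P \<inter> S = {}}"
    and V: "V \<subseteq> {P. primeideal P A \<and> P \<inter> S = {}}"
    and t: "t \<in> regular_sections R {Q. primeideal Q R \<and> contraction Q \<in> V}"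
  obtains s where "s \<in> regular_sections A V" "t = sheaf_map V s"
proof -
  let ?W = "{Q. primeideal Q R \<and> contraction Q \<in> V}"
  have tval: "t Q \<in> carrier (localization R Q)" if "Q \<in> ?W" for Q
    using t that unfolding regular_sections_def by (auto dest: PiE_mem)
  define s where "s = (\<lambda>P\<in>V. inv_into (carrier (localization A P)) (transfer (extension P))
    (t (extension P)))"
  have s: "s (contraction Q) \<in> carrier (localization A (contraction Q)) \<and>
      transfer Q (s (contraction Q)) = t Q" if Q: "Q \<in> ?W" for Q
  proof -
    have "s (contraction Q) = inv_into (carrier (localization A (contraction Q))) (transfer Q) (t Q)"
      using Q extension_contraction unfolding s_def by simp
    moreover have "t Q \<in> transfer Q ` carrier (localization A (contraction Q))"
      using transfer_bij[of Q] tval[OF Q] Q by (simp add: bij_betw_def)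
    ultimately show ?thesis by (simp add: inv_into_into f_inv_into_f)
  qed
  have VW: "\<exists>Q \<in> ?W. P = contraction Q" if "P \<in> V" for P
  proof -
    have "primeideal P A" "P \<inter> S = {}" using V that by blast+
    then obtain Q where "primeideal Q R" "P = contraction Q" by (rule contraction_surj)
    then show ?thesis using that by blast
  qed
  have "s \<in> regular_sections A V"
    unfolding regular_sections_def
  proof (intro CollectI conjI ballI)
    show "s \<in> (\<Pi>\<^sub>E P\<in>V. carrier (localization A P))"
    proof (rule PiE_I)
      show "s P \<in> carrier (localization A P)" if "P \<in> V" for P
        using VW[OF that] s by blast
    qed (simp add: s_def)
    fix P assume "P \<in> V"
    then obtain Q where Q: "Q \<in> ?W" "P = contraction Q" using VW by blast
    from regular_sections_local[OF t Q(1)] obtain W' c g where W': "openin (zariski R) W'" "Q \<in> W'" "W' \<subseteq> ?W"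
      and c: "c \<in> carrier R" "g \<in> carrier R"
      and tf': "\<forall>Q\<in>W'. g \<notin> Q \<and> t Q = loc_frac R Q c g"
      by (elim exE conjE)
    have tf: "g \<notin> Q \<and> t Q = loc_frac R Q c g" if "Q \<in> W'" for Q
      using tf' that by blast
    obtain a r where a: "a \<in> carrier A" "r \<in> carrier A"
      and f: "\<And>Q. primeideal Q R \<Longrightarrow> g \<notin> Q \<Longrightarrow>
        r \<notin> contraction Q \<and> loc_frac R Q c g = loc_frac R Q (h a) (h r)"
      using frac_from_A[OF c] by blast
    have w: "r \<notin> P' \<and> s P' = loc_frac A P' a r" if P': "P' \<in> contraction ` W'" for P'
    proof -
      obtain Q' where Q': "Q' \<in> W'" "P' = contraction Q'" using P' by blast
      then have Q'W: "Q' \<in> ?W" using W'(3) by blast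
      then have pr: "primeideal Q' R" by blast
      have r: "r \<in> carrier A - contraction Q'" using f[OF pr] tf[OF Q'(1)] a(2) by blast
      have "transfer Q' (s P') = loc_frac R Q' (h a) (h r)"
        using s[OF Q'W] f[OF pr] tf[OF Q'(1)] Q'(2) by simp
      also have "\<dots> = transfer Q' (loc_frac A P' a r)"
        using transfer_frac[OF pr a(1) r] Q'(2) by simp
      finally have "s P' = loc_frac A P' a r"
        using bij_betw_imp_inj_on[OF transfer_bij[OF pr]] s[OF Q'W]
          localization_carrierI[OF a(1) r] Q'(2) by (auto dest: inj_onD)
      then show ?thesis using r Q'(2) by blast
    qed
    have mem: "P \<in> contraction ` W'" and sub: "contraction ` W' \<subseteq> V" using W' Q by auto
    show "\<exists>V' a g. openin (zariski A) V' \<and> P \<in> V' \<and> V' \<subseteq> V \<and>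
       a \<in> carrier A \<and> g \<in> carrier A \<and> (\<forall>P\<in>V'. g \<notin> P \<and> s P = loc_frac A P a g)"
      by (intro exI[of _ "contraction ` W'"] exI[of _ a] exI[of _ r] conjI ballI mem sub a
          openin_image_contraction[OF U W'(1)] conjunct1[OF w] conjunct2[OF w])
  qed
  moreover have "t = sheaf_map V s"
  proof
    fix Q show "t Q = sheaf_map V s Q"
    proof (cases "Q \<in> ?W")
      case False
      then show ?thesis using t unfolding regular_sections_def sheaf_map_def
        by (auto simp: PiE_def extensional_def restrict_def)
    qed (use s in \<open>simp add: sheaf_map_def\<close>)
  qed
  ultimately show ?thesis using that by blast
qed

lemma sheaf_map_ring_iso:
  assumes U: "openin (zariski A) {P. primeideal P A \<and> P \<inter> S = {}}"
    and V: "V \<subseteq> {P. primeideal P A \<and> P \<inter> S = {}}"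
  shows "sheaf_map V \<in> ring_iso (structure_sheaf A V)
    (structure_sheaf R {Q. primeideal Q R \<and> contraction Q \<in> V})"
proof -
  let ?W = "{Q. primeideal Q R \<and> contraction Q \<in> V}"
  have "sheaf_map V \<in> ring_hom (structure_sheaf A V) (structure_sheaf R ?W)"
  proof (rule ring_hom_memI)
    fix s assume s: "s \<in> carrier (structure_sheaf A V)"
    then show "sheaf_map V s \<in> carrier (structure_sheaf R ?W)"
      using sheaf_map_regular by (simp add: structure_sheaf_def)
    fix t assume t: "t \<in> carrier (structure_sheaf A V)"
    have st: "s (contraction Q) \<in> carrier (localization A (contraction Q))"
        "t (contraction Q) \<in> carrier (localization A (contraction Q))" if "Q \<in> ?W" for Q
      using s t that regular_sections_value by (auto simp: structure_sheaf_def)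
    show "sheaf_map V (s \<otimes>\<^bsub>structure_sheaf A V\<^esub> t) =
        sheaf_map V s \<otimes>\<^bsub>structure_sheaf R ?W\<^esub> sheaf_map V t"
      using transfer_mult st unfolding sheaf_map_def
      by (auto simp: structure_sheaf_def intro!: restrict_ext)
    show "sheaf_map V (s \<oplus>\<^bsub>structure_sheaf A V\<^esub> t) =
        sheaf_map V s \<oplus>\<^bsub>structure_sheaf R ?W\<^esub> sheaf_map V t"
      using transfer_add st unfolding sheaf_map_def
      by (auto simp: structure_sheaf_def intro!: restrict_ext)
  next
    have "transfer Q (\<one>\<^bsub>localization A (contraction Q)\<^esub>) = \<one>\<^bsub>localization R Q\<^esub>"
      if "primeideal Q R" for Q
      using transfer_frac[OF that A.one_closed A.one_notin_prime[OF prime_contraction[OF that]]]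
      by (simp add: localization_def h_one)
    then show "sheaf_map V \<one>\<^bsub>structure_sheaf A V\<^esub> = \<one>\<^bsub>structure_sheaf R ?W\<^esub>"
      unfolding sheaf_map_def by (auto simp: structure_sheaf_def intro!: restrict_ext)
  qed
  moreover have "bij_betw (sheaf_map V) (carrier (structure_sheaf A V)) (carrier (structure_sheaf R ?W))"
  proof (rule bij_betw_imageI)
    show "inj_on (sheaf_map V) (carrier (structure_sheaf A V))"
      using sheaf_map_inj[OF V] by (simp add: structure_sheaf_def)
    show "sheaf_map V ` carrier (structure_sheaf A V) = carrier (structure_sheaf R ?W)"
    proof (intro equalityI subsetI)
      fix t assume "t \<in> carrier (structure_sheaf R ?W)"
      then show "t \<in> sheaf_map V ` carrier (structure_sheaf A V)"
        by (auto simp: structure_sheaf_def elim: sheaf_map_surj[OF U V])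
    qed (auto simp: structure_sheaf_def sheaf_map_regular)
  qed
  ultimately show ?thesis by (simp add: ring_iso_def)
qed

text \<open>For a general multiplicative set the primes avoiding it need not form an open set (take
  the nonzero integers), so openness is a hypothesis. For the Shi arrangement it follows from
  finiteness.\<close>

theorem Spec_isomorphic:
  assumes U: "openin (zariski A) {P. primeideal P A \<and> P \<inter> S = {}}"
    and \<iota>: "\<And>c. \<iota> c \<in> carrier A" "\<And>c. \<kappa> c = h (\<iota> c)"
  shows "isomorphic_over_C (Spec R \<kappa>)
    (open_subspace (Spec A \<iota>) {P. primeideal P A \<and> P \<inter> S = {}})"
proof -
  let ?U = "{P. primeideal P A \<and> P \<inter> S = {}}"
  let ?X = "Spec R \<kappa>" and ?Y = "open_subspace (Spec A \<iota>) ?U"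
  have pre: "preim ?X contraction V = {Q. primeideal Q R \<and> contraction Q \<in> V}" for V
    by (simp add: preim_def Spec_def R.topspace_zariski)
  have op: "openin (points ?Y) V \<longleftrightarrow> openin (zariski A) V \<and> V \<subseteq> ?U" for V
    by (simp add: open_subspace_def Spec_def openin_open_subtopology[OF U])
  show ?thesis
    unfolding isomorphic_over_C_def
  proof (intro exI[of _ contraction] exI[of _ sheaf_map] conjI allI impI ballI)
    show "homeomorphic_map (points ?X) (points ?Y) contraction"
      using homeomorphic_map_contraction[OF U] by (simp add: open_subspace_def Spec_def)
  next
    fix V assume "openin (points ?Y) V"
    then have V: "V \<subseteq> ?U" unfolding op by blast
    show "sheaf_map V \<in> ring_iso (sections ?Y V) (sections ?X (preim ?X contraction V))"
      using sheaf_map_ring_iso[OF U V] unfolding pre by (simp add: open_subspace_def Spec_def)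
    have "transfer Q (loc_frac A (contraction Q) (\<iota> c) \<one>\<^bsub>A\<^esub>) = loc_frac R Q (\<kappa> c) \<one>\<^bsub>R\<^esub>"
      if "primeideal Q R" for Q c
      using transfer_frac[OF that \<iota>(1) A.one_notin_prime[OF prime_contraction[OF that]]]
      by (simp add: h_one \<iota>(2))
    then show "sheaf_map V (scalar ?Y V c) = scalar ?X (preim ?X contraction V) c" for c
      unfolding pre sheaf_map_def
      by (auto simp: open_subspace_def Spec_def intro!: restrict_ext)
  next
    fix V W s assume "openin (points ?Y) V \<and> openin (points ?Y) W \<and> W \<subseteq> V"
    then show "sheaf_map W (restr ?Y V W s) =
        restr ?X (preim ?X contraction V) (preim ?X contraction W) (sheaf_map V s)"
      unfolding pre sheaf_map_def
      by (auto simp: open_subspace_def Spec_def fun_eq_iff restrict_def)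
  qed
qed

end

section \<open>Evaluation of polynomials and Laurent polynomials\<close>

lemma poly_mapping_single_induct [case_names zero add]:
  fixes p :: "'a \<Rightarrow>\<^sub>0 'b::comm_monoid_add"
  assumes "P 0" and "\<And>p a b. P p \<Longrightarrow> P (p + Poly_Mapping.single a b)"
  shows "P p"
proof (induction p rule: update_induct)
  case const
  have "Poly_Mapping.Abs_poly_mapping (\<lambda>_. 0) = (0 :: 'a \<Rightarrow>\<^sub>0 'b)" by simp
  then show ?case using assms(1) by simp
next
  case (update f a b)
  have "Poly_Mapping.update a b f = f + Poly_Mapping.single a b"
    using update(1)
    by (intro poly_mapping_eqI) (auto simp: lookup_update lookup_add lookup_single in_keys_iff when_def)
  then show ?case using assms(2)[OF update(3)] by simp
qed

text \<open>A common scheme for evaluating a polynomial at a point, evaluating a Laurent polynomial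
  at a point and substituting polynomials: coefficients pass through \<kappa> and exponents through
  a character \<chi> of the exponent monoid.\<close>

definition monoid_eval :: "('k::zero \<Rightarrow> 'r) \<Rightarrow> ('a \<Rightarrow> 'r) \<Rightarrow> ('a \<Rightarrow>\<^sub>0 'k) \<Rightarrow> 'r::comm_semiring_1" where
  "monoid_eval \<kappa> \<chi> p = (\<Sum>m\<in>Poly_Mapping.keys p. \<kappa> (Poly_Mapping.lookup p m) * \<chi> m)"

locale monoid_eval_hom =
  fixes \<kappa> :: "'k::comm_semiring_1 \<Rightarrow> 'r::comm_semiring_1" and \<chi> :: "'a::comm_monoid_add \<Rightarrow> 'r"
  assumes \<kappa>_zero: "\<kappa> 0 = 0" and \<kappa>_one: "\<kappa> 1 = 1"
    and \<kappa>_add: "\<kappa> (a + b) = \<kappa> a + \<kappa> b" and \<kappa>_mult: "\<kappa> (a * b) = \<kappa> a * \<kappa> b"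
    and \<chi>_zero: "\<chi> 0 = 1" and \<chi>_add: "\<chi> (m + k) = \<chi> m * \<chi> k"
begin

abbreviation "ev \<equiv> monoid_eval \<kappa> \<chi>"

lemma ev_superset:
  assumes "finite X" "Poly_Mapping.keys p \<subseteq> X"
  shows "ev p = (\<Sum>m\<in>X. \<kappa> (Poly_Mapping.lookup p m) * \<chi> m)"
  unfolding monoid_eval_def using assms
  by (intro sum.mono_neutral_left) (auto simp: in_keys_iff \<kappa>_zero)

lemma ev_add: "ev (p + q) = ev p + ev q"
proof -
  let ?X = "Poly_Mapping.keys p \<union> Poly_Mapping.keys q"
  have "Poly_Mapping.keys (p + q) \<subseteq> ?X" by (rule Poly_Mapping.keys_add)
  then show ?thesis
    using ev_superset[of ?X p] ev_superset[of ?X q] ev_superset[of ?X "p + q"]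
    by (simp add: lookup_add \<kappa>_add distrib_right sum.distrib)
qed

lemma ev_zero: "ev 0 = 0"
  by (simp add: monoid_eval_def)

lemma ev_single: "ev (Poly_Mapping.single m c) = \<kappa> c * \<chi> m"
  by (cases "c = 0") (simp_all add: monoid_eval_def \<kappa>_zero)

lemma ev_one: "ev 1 = 1"
  using ev_single[of 0 1] by (simp add: \<kappa>_one \<chi>_zero)

lemma ev_mult: "ev (p * q) = ev p * ev q"
proof (induction p rule: poly_mapping_single_induct)
  case (add p a b)
  have "ev (Poly_Mapping.single a b * q) = ev (Poly_Mapping.single a b) * ev q"
  proof (induction q rule: poly_mapping_single_induct)
    case (add q c d)
    then show ?case
      by (simp add: distrib_left ev_add mult_single ev_single \<kappa>_mult \<chi>_add mult_ac)
  qed (simp add: ev_zero)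
  with add show ?case by (simp add: distrib_right ev_add)
qed (simp add: ev_zero)

lemma ev_sum: "ev (\<Sum>x\<in>X. f x) = (\<Sum>x\<in>X. ev (f x))"
  by (induction X rule: infinite_finite_induct) (simp_all add: ev_zero ev_add)

lemma ev_prod: "ev (\<Prod>x\<in>X. f x) = (\<Prod>x\<in>X. ev (f x))"
  by (induction X rule: infinite_finite_induct) (simp_all add: ev_one ev_mult)

lemma ev_power: "ev (p ^ k) = ev p ^ k"
  by (induction k) (simp_all add: ev_one ev_mult)

end

definition power_monomial :: "('v \<Rightarrow> 'r::comm_monoid_mult) \<Rightarrow> ('v \<Rightarrow>\<^sub>0 nat) \<Rightarrow> 'r" where
  "power_monomial z m = (\<Prod>v\<in>Poly_Mapping.keys m. z v ^ Poly_Mapping.lookup m v)"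

lemma power_monomial_superset:
  assumes "finite X" "Poly_Mapping.keys m \<subseteq> X"
  shows "power_monomial z m = (\<Prod>v\<in>X. z v ^ Poly_Mapping.lookup m v)"
  unfolding power_monomial_def using assms
  by (intro prod.mono_neutral_left) (auto simp: in_keys_iff)

lemma power_monomial_add: "power_monomial z (m + k) = power_monomial z m * power_monomial z k"
proof -
  let ?X = "Poly_Mapping.keys m \<union> Poly_Mapping.keys k"
  have "Poly_Mapping.keys (m + k) \<subseteq> ?X" by (rule Poly_Mapping.keys_add)
  then show ?thesis
    using power_monomial_superset[of ?X m z] power_monomial_superset[of ?X k z]
      power_monomial_superset[of ?X "m + k" z]
    by (simp add: lookup_add power_add prod.distrib)
qed

lemma power_monomial_single: "power_monomial z (Poly_Mapping.single v 1) = z v"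
  by (simp add: power_monomial_def)

definition laurent_monomial :: "('v \<Rightarrow> 'r::field) \<Rightarrow> ('v \<Rightarrow>\<^sub>0 int) \<Rightarrow> 'r" where
  "laurent_monomial z m = (\<Prod>v\<in>Poly_Mapping.keys m. z v powi Poly_Mapping.lookup m v)"

lemma laurent_monomial_superset:
  assumes "finite X" "Poly_Mapping.keys m \<subseteq> X"
  shows "laurent_monomial z m = (\<Prod>v\<in>X. z v powi Poly_Mapping.lookup m v)"
  unfolding laurent_monomial_def using assms
  by (intro prod.mono_neutral_left) (auto simp: in_keys_iff)

lemma laurent_monomial_add:
  assumes "\<And>v. z v \<noteq> 0"
  shows "laurent_monomial z (m + k) = laurent_monomial z m * laurent_monomial z k"
proof -
  let ?X = "Poly_Mapping.keys m \<union> Poly_Mapping.keys k"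
  have "Poly_Mapping.keys (m + k) \<subseteq> ?X" by (rule Poly_Mapping.keys_add)
  then show ?thesis
    using laurent_monomial_superset[of ?X m z] laurent_monomial_superset[of ?X k z]
      laurent_monomial_superset[of ?X "m + k" z]
    by (simp add: lookup_add power_int_add assms prod.distrib)
qed

definition laurent_eval :: "('v \<Rightarrow> complex) \<Rightarrow> (('v \<Rightarrow>\<^sub>0 int) \<Rightarrow>\<^sub>0 complex) \<Rightarrow> complex" where
  "laurent_eval z = monoid_eval (\<lambda>c. c) (laurent_monomial z)"

definition substitute ::
    "('v \<Rightarrow> (('w \<Rightarrow>\<^sub>0 'e) \<Rightarrow>\<^sub>0 complex)) \<Rightarrow> (('v \<Rightarrow>\<^sub>0 nat) \<Rightarrow>\<^sub>0 complex) \<Rightarrow>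
      (('w \<Rightarrow>\<^sub>0 'e::comm_semiring_1) \<Rightarrow>\<^sub>0 complex)" where
  "substitute Z = monoid_eval const (power_monomial Z)"

lemma mpoly_eval_eq: "mpoly_eval z = monoid_eval (\<lambda>c. c) (power_monomial z)"
  by (simp add: fun_eq_iff mpoly_eval_def monoid_eval_def power_monomial_def)

lemma const_add: "const (a + b) = const a + const b"
  by (simp add: const_def single_add)

lemma const_mult: "const (a * b) = const a * const b"
  by (simp add: const_def mult_single)

lemma const_0 [simp]: "const 0 = 0" and const_1 [simp]: "const 1 = 1"
  by (simp_all add: const_def)

interpretation mpoly_eval: monoid_eval_hom "\<lambda>c. c" "power_monomial z"
  rewrites "monoid_eval (\<lambda>c. c) (power_monomial z) \<equiv> mpoly_eval z"
  for z :: "'v \<Rightarrow> complex"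
  by unfold_locales (simp_all add: power_monomial_add mpoly_eval_eq, simp add: power_monomial_def)

interpretation substitute: monoid_eval_hom const "power_monomial Z"
  rewrites "monoid_eval const (power_monomial Z) \<equiv> substitute Z"
  for Z :: "'v \<Rightarrow> (('w \<Rightarrow>\<^sub>0 'e::comm_semiring_1) \<Rightarrow>\<^sub>0 complex)"
  by unfold_locales
    (simp_all add: power_monomial_add substitute_def const_add const_mult, simp add: power_monomial_def)

lemma laurent_eval_hom:
  fixes z :: "'v \<Rightarrow> complex"
  assumes "\<And>v. z v \<noteq> (0::complex)"
  shows "monoid_eval_hom (\<lambda>c. c) (laurent_monomial z)"
  by unfold_locales (simp_all add: laurent_monomial_add assms, simp add: laurent_monomial_def)

lemma laurent_eval_const:
  fixes z :: "'v \<Rightarrow> complex"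
  assumes "\<And>v. z v \<noteq> 0"
  shows "laurent_eval z (const c) = c"
  using monoid_eval_hom.ev_single[OF laurent_eval_hom[OF assms], where m = 0 and c = c]
  by (simp add: laurent_eval_def const_def laurent_monomial_def)

lemma laurent_eval_var:
  fixes z :: "'v \<Rightarrow> complex"
  assumes "\<And>v. z v \<noteq> 0"
  shows "laurent_eval z (var v) = z v"
  using monoid_eval_hom.ev_single[OF laurent_eval_hom[OF assms], where m = "Poly_Mapping.single v 1" and c = 1]
  by (simp add: laurent_eval_def var_def laurent_monomial_def)

lemma laurent_eval_substitute:
  fixes z :: "'v \<Rightarrow> complex"
  assumes "\<And>v. z v \<noteq> 0"
  shows "laurent_eval z (substitute Z p) = mpoly_eval (\<lambda>v. laurent_eval z (Z v)) p"
proof -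
  interpret L: monoid_eval_hom "\<lambda>c. c" "laurent_monomial z"
    rewrites "monoid_eval (\<lambda>c. c) (laurent_monomial z) \<equiv> laurent_eval z"
    using laurent_eval_hom[OF assms] by (simp_all add: laurent_eval_def)
  show ?thesis
    unfolding substitute_def monoid_eval_def mpoly_eval_def power_monomial_def
    by (simp add: L.ev_sum L.ev_mult L.ev_prod L.ev_power laurent_eval_const[OF assms])
qed

section \<open>Polynomials are determined by their values at generic points\<close>

lemma mpoly_eval_cong:
  assumes "p \<in> carrier (mpoly_ring V)" "\<And>v. v \<in> V \<Longrightarrow> z v = w v"
  shows "mpoly_eval z p = mpoly_eval w p"
  unfolding mpoly_eval_def
  using assms by (intro sum.cong refl arg_cong2[of _ _ _ _ "(*)"] prod.cong) (auto simp: mpoly_ring_def subset_eq)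

text \<open>Base \<open>K\<close> digits are unique: \<open>mod\<close> reads off the lowest one and
  \<open>div\<close> the rest. This separates the exponents of different monomials after the
  Kronecker substitution below.\<close>

lemma digits_inj:
  fixes f g :: "nat \<Rightarrow> nat"
  assumes "(\<Sum>i<k. f i * K ^ i) = (\<Sum>i<k. g i * K ^ i)"
    and "\<And>i. i < k \<Longrightarrow> f i < K" "\<And>i. i < k \<Longrightarrow> g i < K" and "i < k"
  shows "f i = g i"
  using assms
proof (induction k arbitrary: f g i)
  case (Suc k)
  have split: "(\<Sum>i<Suc k. e i * K ^ i) = e 0 + K * (\<Sum>i<k. e (Suc i) * K ^ i)" for e :: "nat \<Rightarrow> nat"
    by (simp add: sum.lessThan_Suc_shift sum_distrib_left mult_ac del: sum.lessThan_Suc)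
  have *: "(\<Sum>i<Suc k. e i * K ^ i) mod K = e 0 \<and>
      (\<Sum>i<Suc k. e i * K ^ i) div K = (\<Sum>i<k. e (Suc i) * K ^ i)" if "e 0 < K" for e :: "nat \<Rightarrow> nat"
    unfolding split using that by auto
  have fg: "f 0 < K" "g 0 < K" using Suc.prems by auto
  have "f 0 = g 0" using *[of f, OF fg(1)] *[of g, OF fg(2)] Suc.prems(1) by metis
  moreover have "(\<Sum>i<k. f (Suc i) * K ^ i) = (\<Sum>i<k. g (Suc i) * K ^ i)"
    using *[of f, OF fg(1)] *[of g, OF fg(2)] Suc.prems(1) by metis
  then have "f (Suc i) = g (Suc i)" if "i < k" for i
    using Suc.IH[of "\<lambda>i. f (Suc i)" "\<lambda>i. g (Suc i)" i] Suc.prems(2,3) that by simp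
  ultimately show ?case using Suc.prems(4) by (cases i) auto
qed simp

text \<open>Kronecker substitution \<open>z\<^sub>i = t ^ (K ^ i)\<close> with \<open>K\<close> larger than all exponents.\<close>

lemma mpoly_eval_zeroD:
  fixes p :: "(nat \<Rightarrow>\<^sub>0 nat) \<Rightarrow>\<^sub>0 complex"
  assumes "\<And>z. mpoly_eval z p = 0"
  shows "p = 0"
proof (rule ccontr)
  assume "p \<noteq> 0"
  let ?X = "\<Union>m\<in>Poly_Mapping.keys p. Poly_Mapping.keys m"
  obtain k where k: "?X \<subseteq> {..<k}"
    using finite_nat_iff_bounded[of ?X] by auto
  obtain K where K: "(\<Union>m\<in>Poly_Mapping.keys p. Poly_Mapping.lookup m ` {..<k}) \<subseteq> {..<K}"
    using finite_nat_iff_bounded[of "\<Union>m\<in>Poly_Mapping.keys p. Poly_Mapping.lookup m ` {..<k}"] by auto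
  define wt :: "(nat \<Rightarrow>\<^sub>0 nat) \<Rightarrow> nat" where "wt m = (\<Sum>i<k. Poly_Mapping.lookup m i * K ^ i)" for m
  have inj: "inj_on wt (Poly_Mapping.keys p)"
  proof (rule inj_onI)
    fix m m' assume m: "m \<in> Poly_Mapping.keys p" "m' \<in> Poly_Mapping.keys p" and eq: "wt m = wt m'"
    have "Poly_Mapping.lookup m i = Poly_Mapping.lookup m' i" for i
    proof (cases "i < k")
      case True
      show ?thesis
        by (rule digits_inj[OF eq[unfolded wt_def] _ _ True]) (use m K in auto)
    next
      case False
      then have "i \<notin> Poly_Mapping.keys m" "i \<notin> Poly_Mapping.keys m'" using k m by auto
      then show ?thesis by (simp add: in_keys_iff)
    qed
    then show "m = m'" by (rule poly_mapping_eqI)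
  qed
  define P where "P = (\<Sum>m\<in>Poly_Mapping.keys p. Polynomial.monom (Poly_Mapping.lookup p m) (wt m))"
  have "poly P t = 0" for t
  proof -
    have "power_monomial (\<lambda>i. t ^ (K ^ i)) m = t ^ wt m" if "m \<in> Poly_Mapping.keys p" for m
      using k that by (subst power_monomial_superset[of "{..<k}"])
        (auto simp: wt_def power_sum power_mult[symmetric] mult.commute)
    then have "mpoly_eval (\<lambda>i. t ^ (K ^ i)) p = poly P t"
      by (simp add: mpoly_eval_eq monoid_eval_def P_def poly_sum poly_monom)
    then show ?thesis using assms by simp
  qed
  then have "P = 0" using poly_all_0_iff_0 by blast
  obtain m where m: "m \<in> Poly_Mapping.keys p" using \<open>p \<noteq> 0\<close> by (metis in_keys_iff lookup_zero poly_mapping_eqI)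
  have "Polynomial.coeff P (wt m) = (\<Sum>k\<in>Poly_Mapping.keys p. if k = m then Poly_Mapping.lookup p k else 0)"
    unfolding P_def Polynomial.coeff_sum using inj m by (intro sum.cong) (auto simp: inj_on_def)
  also have "\<dots> = Poly_Mapping.lookup p m" using m by simp
  finally show False using m \<open>P = 0\<close> by (simp add: in_keys_iff)
qed

lemma continuous_mpoly_eval:
  fixes z w :: "'v \<Rightarrow> complex"
  shows "isCont (\<lambda>t. mpoly_eval (\<lambda>v. z v + t * w v) p) x"
  unfolding mpoly_eval_def by (intro continuous_intros)

text \<open>On the line through \<open>z\<close> with direction \<open>of_nat\<close>, the
  difference of two distinct coordinates moves with nonzero speed. Each of the finitely many
  hyperplanes excludes at most one \<open>t\<close>, so \<open>z\<close> is a limit of generic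
  points and continuity gives the value there.\<close>

lemma mpoly_eval_generic_zeroD:
  fixes p :: "(nat \<Rightarrow>\<^sub>0 nat) \<Rightarrow>\<^sub>0 complex"
  assumes zero: "\<And>z. (\<And>a b c. 1 \<le> a \<Longrightarrow> a < b \<Longrightarrow> b \<le> N \<Longrightarrow> c \<in> {0, 1} \<Longrightarrow> z b - z a \<noteq> c) \<Longrightarrow>
      mpoly_eval z p = 0"
  shows "p = 0"
proof (rule mpoly_eval_zeroD)
  fix z :: "nat \<Rightarrow> complex"
  let ?y = "\<lambda>t v. z v + t * of_nat v"
  have ev: "\<forall>\<^sub>F t in at 0. ?y t b - ?y t a \<noteq> c" if "a < b" for a b and c :: complex
  proof -
    have ba: "of_nat b - of_nat a \<noteq> (0::complex)" using that by simp
    have "t = (c - z b + z a) / (of_nat b - of_nat a)" if "?y t b - ?y t a = c" for t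
      using that ba by (simp add: field_simps)
    moreover have "\<forall>\<^sub>F t in at 0. t \<noteq> (c - z b + z a) / (of_nat b - of_nat a)"
      by (rule eventually_neq_at_within)
    ultimately show ?thesis by (auto elim: eventually_mono)
  qed
  have "\<forall>\<^sub>F t in at 0. \<forall>a\<in>{1..N}. \<forall>b\<in>{a<..N}. \<forall>c\<in>{0, 1}. ?y t b - ?y t a \<noteq> c"
    using ev by (intro eventually_ball_finite ballI) auto
  then have "\<forall>\<^sub>F t in at 0. mpoly_eval (?y t) p = 0"
    by (rule eventually_mono) (auto intro!: zero)
  then have "((\<lambda>t. mpoly_eval (?y t) p) \<longlongrightarrow> 0) (at 0)"
    by (simp add: tendsto_eventually)
  moreover have "((\<lambda>t. mpoly_eval (?y t) p) \<longlongrightarrow> mpoly_eval (?y 0) p) (at 0)"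
    using continuous_mpoly_eval[where z = z and w = of_nat and p = p and x = 0] by (simp add: isCont_def)
  ultimately have "mpoly_eval (?y 0) p = 0" by (rule LIM_unique[rotated])
  then show "mpoly_eval z p = 0" by simp
qed

section \<open>Crossing numbers and bracket monomials\<close>

definition arcs :: "nat \<Rightarrow> (nat \<times> nat) set" where
  "arcs n = {(a, b). 1 \<le> a \<and> a \<le> n + 1 \<and> a + 2 \<le> b \<and> b \<le> a + n + 1}"

definition diagonals :: "nat \<Rightarrow> nat \<times> nat \<Rightarrow> nat set set" where
  "diagonals n x = {{fst x, snd x}, opposite n ` {fst x, snd x}}"

text \<open>The terms count the translates \<open>(a + k * m, b + k * m)\<close> of
  \<open>x = (a, b)\<close>, for \<open>k = -1, 0, 1\<close>, with \<open>a + k * m \<le> p\<close>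
  and \<open>q < b + k * m\<close>; for \<open>k = -1\<close> the first inequality is automatic
  because \<open>a \<le> m\<close>. No other translate contributes for the indices in use. The count
  is the exponent of the variable of \<open>x\<close> in \<open>[p, q]\<close>.\<close>

definition arc_weight :: "nat \<Rightarrow> nat \<Rightarrow> nat \<Rightarrow> nat \<times> nat \<Rightarrow> nat" where
  "arc_weight m p q x = of_bool (q + m < snd x) + of_bool (fst x \<le> p \<and> q < snd x) +
     of_bool (fst x + m \<le> p \<and> q < snd x + m)"

definition alternate :: "nat \<Rightarrow> nat \<Rightarrow> nat \<Rightarrow> nat \<Rightarrow> bool" where
  "alternate a b i j \<longleftrightarrow> a < i \<and> i < b \<and> b < j \<or> i < a \<and> a < j \<and> j < b"

lemma crosses_iff:
  assumes "a < b" "i < j"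
  shows "crosses {a, b} {i, j} \<longleftrightarrow> alternate a b i j"
proof
  assume "crosses {a, b} {i, j}"
  then obtain p q r s where ord: "p < q" "q < r" "r < s"
    and "{a, b} = {p, r} \<and> {i, j} = {q, s} \<or> {a, b} = {q, s} \<and> {i, j} = {p, r}"
    unfolding crosses_def by blast
  then have "a = p \<and> b = r \<and> i = q \<and> j = s \<or> a = q \<and> b = s \<and> i = p \<and> j = r"
    using assms by (auto simp: doubleton_eq_iff)
  then show "alternate a b i j" using ord by (auto simp: alternate_def)
qed (auto simp: alternate_def intro: crossesI)

text \<open>The partner of the arc is written with increasing end points, as
  \<open>crosses_iff\<close> requires.\<close>

lemma opposite_arc:
  assumes "(i, j) \<in> arcs n"
  shows "opposite n ` {i, j} =
    (if j = i + (n + 1) then {i, j} else if j \<le> n + 1 then {i + (n + 1), j + (n + 1)}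
     else {j - (n + 1), i + (n + 1)})"
proof -
  have ij: "1 \<le> i" "i \<le> n + 1" "i + 2 \<le> j" "j \<le> i + (n + 1)"
    using assms by (auto simp: arcs_def)
  have i: "opposite n i = i + (n + 1)" using ij by (simp add: opposite_def)
  consider "j = i + (n + 1)" | "j \<noteq> i + (n + 1)" "j \<le> n + 1" | "j \<noteq> i + (n + 1)" "\<not> j \<le> n + 1"
    by blast
  then show ?thesis
  proof cases
    case 1
    then have j: "opposite n j = i" using ij by (simp add: opposite_def)
    show ?thesis
      unfolding image_insert image_empty i j if_P[OF 1] unfolding 1 by (rule insert_commute)
  next
    case 2
    then have j: "opposite n j = j + (n + 1)" by (simp add: opposite_def)
    show ?thesis unfolding image_insert image_empty i j if_not_P[OF 2(1)] if_P[OF 2(2)] ..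
  next
    case 3
    then have j: "opposite n j = j - (n + 1)" by (simp add: opposite_def)
    show ?thesis
      unfolding image_insert image_empty i j if_not_P[OF 3(1)] if_not_P[OF 3(2)] by (rule insert_commute)
  qed
qed

lemma diagonals_in_B_index:
  assumes "x \<in> arcs n"
  shows "diagonals n x \<in> B_index n"
proof -
  obtain i j where x: "x = (i, j)" by (cases x)
  with assms have ij: "1 \<le> i" "i \<le> n + 1" "i + 2 \<le> j" "j \<le> i + (n + 1)" by (auto simp: arcs_def)
  have d: "diagonals n x = {{i, j}, opposite n ` {i, j}}" by (simp add: diagonals_def x)
  note opp = opposite_arc[OF assms[unfolded x]]
  consider "j = i + (n + 1)" | "j \<le> n + 1" | "n + 1 < j" "j < i + (n + 1)" using ij by linarith
  then show ?thesis
  proof cases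
    case 1
    then have "diagonals n x = {{i, bar n i}}" unfolding d opp by (simp add: bar_def add.commute)
    then show ?thesis using ij unfolding B_index_def by blast
  next
    case 2
    then have "diagonals n x = {{i, j}, {bar n i, bar n j}}"
      using ij unfolding d opp by (simp add: bar_def add.commute)
    moreover have "1 \<le> i \<and> i < j - 1 \<and> j - 1 < n + 1" using ij 2 by linarith
    ultimately show ?thesis unfolding B_index_def by blast
  next
    case 3
    have "opposite n ` {i, j} = {j - (n + 1), bar n i}" using 3 unfolding opp by (simp add: bar_def add.commute)
    moreover have "{i, j} = {i, bar n (j - (n + 1))}" using 3 by (simp add: bar_def)
    ultimately have "diagonals n x = {{j - (n + 1), bar n i}, {i, bar n (j - (n + 1))}}"
      unfolding d by (simp only: insert_commute)
    moreover have "1 \<le> j - (n + 1) \<and> j - (n + 1) < i \<and> i \<le> n + 1 \<and> (j - (n + 1), i) \<noteq> (1, n + 1)"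
      using ij 3 by auto
    ultimately show ?thesis unfolding B_index_def by blast
  qed
qed

lemma B_index_arc:
  assumes "\<gamma> \<in> B_index n" "n \<ge> 1"
  shows "\<gamma> \<in> diagonals n ` arcs n"
proof -
  have *: "\<gamma> \<in> diagonals n ` arcs n" if "(a, b) \<in> arcs n" "{a, b} \<in> \<gamma>" for a b
    using B_index_opposite[OF assms(1) that(2)] that(1) by (auto simp: diagonals_def intro!: image_eqI[of _ _ "(a, b)"])
  have "\<exists>a b. (a, b) \<in> arcs n \<and> {a, b} \<in> \<gamma>"
    using assms(1) unfolding B_index_def
  proof (elim UnE CollectE exE conjE)
    fix i assume "\<gamma> = {{i, bar n i}}" "1 \<le> i" "i \<le> n + 1"
    then show ?thesis
      \<comment> \<open>\<open>n \<ge> 1\<close> ensures that a long diagonal satisfies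
        \<open>i + 2 \<le> j\<close>.\<close>
      using assms(2) by (intro exI[of _ i] exI[of _ "bar n i"]) (simp add: arcs_def bar_def)
  next
    fix i j assume "\<gamma> = {{i, j}, {bar n i, bar n j}}" "1 \<le> i" "i < j - 1" "j - 1 < n + 1"
    then show ?thesis by (intro exI[of _ i] exI[of _ j]) (auto simp: arcs_def)
  next
    fix i j assume g: "\<gamma> = {{i, bar n j}, {j, bar n i}}" and "1 \<le> i" "i < j" "j \<le> n + 1"
       "(i, j) \<noteq> (1, n + 1)"
    \<comment> \<open>The representative starting at \<open>j\<close> is chosen, since the one
      starting at \<open>i\<close> spans more than \<open>n + 1\<close>. The excluded pair
      \<open>(1, n + 1)\<close> would give a side.\<close>
    then have "(j, bar n i) \<in> arcs n" by (auto simp: arcs_def bar_def)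
    then show ?thesis using g by blast
  qed
  then show ?thesis using * by blast
qed

text \<open>The partner of an arc that is not long either starts beyond \<open>n + 1\<close> or
  spans more than \<open>n + 1\<close>, so it is not an arc.\<close>

lemma inj_on_diagonals: "inj_on (diagonals n) (arcs n)"
proof (rule inj_onI, clarify)
  fix a b i j assume ab: "(a, b) \<in> arcs n" and ij: "(i, j) \<in> arcs n"
    and eq: "diagonals n (a, b) = diagonals n (i, j)"
  have "{a, b} \<in> diagonals n (a, b)" by (simp add: diagonals_def)
  then have "{a, b} \<in> {{i, j}, opposite n ` {i, j}}" unfolding eq by (simp add: diagonals_def)
  then have "{a, b} = {i, j} \<or> {a, b} = opposite n ` {i, j}" by blast
  then show "a = i \<and> b = j"
    using ab ij unfolding opposite_arc[OF ij]
    by (auto simp: arcs_def doubleton_eq_iff split: if_splits)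
qed

text \<open>A long diagonal is its own partner and counts once. Otherwise the two representatives
  are distinct and their crossings add up.\<close>

lemma compat_degree_diagonals:
  assumes "(a, b) \<in> arcs n" "(i, j) \<in> arcs n"
  shows "compat_degree (diagonals n (a, b)) (diagonals n (i, j)) =
    (if j = i + (n + 1) then of_bool (alternate a b i j)
     else if j \<le> n + 1 then of_bool (alternate a b i j) + of_bool (alternate a b (i + (n + 1)) (j + (n + 1)))
     else of_bool (alternate a b i j) + of_bool (alternate a b (j - (n + 1)) (i + (n + 1))))"
proof -
  have lt: "a < b" "i < j" using assms by (auto simp: arcs_def)
  have card: "card {e \<in> {d, d'}. crosses c e} = of_bool (crosses c d) + of_bool (crosses c d')"
    if "d \<noteq> d'" for c d d' :: "nat set"
  proof -
    have "{e \<in> {d, d'}. crosses c e} =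
      (if crosses c d then {d} else {}) \<union> (if crosses c d' then {d'} else {})" by auto
    then show ?thesis using that by simp
  qed
  have "compat_degree (diagonals n (a, b)) (diagonals n (i, j)) =
      card {e \<in> diagonals n (i, j). crosses {a, b} e}"
    by (rule compat_degree_eq[OF diagonals_in_B_index[OF assms(1)] diagonals_in_B_index[OF assms(2)]])
       (simp add: diagonals_def)
  also have "\<dots> = card {e \<in> {{i, j}, opposite n ` {i, j}}. crosses {a, b} e}"
    by (simp add: diagonals_def)
  also consider "j = i + (n + 1)" | "j \<noteq> i + (n + 1)" "j \<le> n + 1" | "j \<noteq> i + (n + 1)" "n + 1 < j" by linarith
  then have "card {e \<in> {{i, j}, opposite n ` {i, j}}. crosses {a, b} e} =
    (if j = i + (n + 1) then of_bool (alternate a b i j)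
     else if j \<le> n + 1 then of_bool (alternate a b i j) + of_bool (alternate a b (i + (n + 1)) (j + (n + 1)))
     else of_bool (alternate a b i j) + of_bool (alternate a b (j - (n + 1)) (i + (n + 1))))"
  proof cases
    case 1
    then have "{e \<in> {{i, j}, opposite n ` {i, j}}. crosses {a, b} e} =
        (if crosses {a, b} {i, j} then {{i, j}} else {})"
      unfolding opposite_arc[OF assms(2)] by auto
    then show ?thesis using 1 crosses_iff[OF lt] by simp
  next
    case 2
    have "{i, j} \<noteq> {i + (n + 1), j + (n + 1)}" using lt by (auto simp: doubleton_eq_iff)
    from card[OF this] show ?thesis
      using 2 lt unfolding opposite_arc[OF assms(2)] by (simp add: crosses_iff)
  next
    case 3
    then have "i \<noteq> j - (n + 1)" "i \<noteq> i + (n + 1)" by simp_all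
    then have ne: "{i, j} \<noteq> {j - (n + 1), i + (n + 1)}" by (simp only: doubleton_eq_iff simp_thms)
    have l: "j - (n + 1) < i + (n + 1)" using 3 assms(2) unfolding arcs_def mem_Collect_eq prod.case by linarith
    show ?thesis
      unfolding opposite_arc[OF assms(2)] if_not_P[OF 3(1)] if_not_P[OF 3(2)[unfolded not_le[symmetric]]]
        card[OF ne] crosses_iff[OF lt] crosses_iff[OF lt(1) l] ..
  qed
  finally show ?thesis .
qed


text \<open>Up to translation by \<open>m\<close>, an arc crosses the long diagonal at
  \<open>i\<close> exactly when it strictly encloses \<open>i\<close>. Since
  \<open>b - a \<le> m\<close>, at most one translate does so, and the weight at
  \<open>(i - 1, i)\<close> counts it.\<close>

lemma alternate_long:
  assumes "1 \<le> a" "a \<le> m" "a + 2 \<le> b" "b \<le> a + m"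
    "1 \<le> i" "i \<le> m"
  shows "of_bool (alternate a b i (i + m)) = arc_weight m (i - 1) i (a, b)"
  using assms unfolding arc_weight_def alternate_def of_bool_def fst_conv snd_conv prod.inject by auto

text \<open>The right side counts translates of \<open>(a, b)\<close> strictly enclosing
  \<open>j\<close> and those strictly enclosing \<open>i\<close>. A translate enclosing exactly one
  of the two crosses \<open>(i, j)\<close>, unless the other vertex is one of its ends. The two
  weights on the left record these exceptions once and the translates enclosing both vertices
  twice.\<close>

lemma alternate_pair_low:
  assumes "1 \<le> a" "a \<le> m" "a + 2 \<le> b" "b \<le> a + m"
    "1 \<le> i" "i \<le> m" "i + 2 \<le> j" "j < i + m" "j \<le> m"
  shows "of_bool (alternate a b i j) + of_bool (alternate a b (i + m) (j + m)) +
    arc_weight m i j (a, b) + arc_weight m (i - 1) (j - 1) (a, b) = arc_weight m (j - 1) j (a, b) + arc_weight m (i - 1) i (a, b)"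
  using assms unfolding arc_weight_def alternate_def of_bool_def fst_conv snd_conv prod.inject by auto

text \<open>The same count as for \<open>j \<le> m\<close>; the partner diagonal now wraps around to
  \<open>(j - m, i + m)\<close>.\<close>

lemma alternate_pair_high:
  assumes "1 \<le> a" "a \<le> m" "a + 2 \<le> b" "b \<le> a + m"
    "1 \<le> i" "i \<le> m" "i + 2 \<le> j" "j < i + m" "m < j"
  shows "of_bool (alternate a b i j) + of_bool (alternate a b (j - m) (i + m)) +
    arc_weight m i j (a, b) + arc_weight m (i - 1) (j - 1) (a, b) = arc_weight m (j - 1) j (a, b) + arc_weight m (i - 1) i (a, b)"
proof -
  \<comment> \<open>Writing the indices as successors removes the truncated subtractions before the
    case analysis.\<close>
  obtain p where i: "i = Suc p" using assms(5) by (cases i) auto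
  obtain k where j: "j = m + Suc k" using assms(9) less_imp_Suc_add by auto
  have "j - m = Suc k" "i - 1 = p" "j - 1 = m + k" by (simp_all add: i j)
  then show ?thesis
    using assms unfolding arc_weight_def alternate_def fst_conv snd_conv i j
    by (auto simp: of_bool_def)
qed

text \<open>Lowering \<open>q\<close> from \<open>j\<close> to \<open>j - 1\<close> adds the
  translates ending at \<open>j\<close>, and raising \<open>p\<close> from \<open>i - 1\<close> to
  \<open>i\<close> adds those starting at \<open>i\<close>. The mixed difference leaves only the arc
  \<open>(i, j)\<close>.\<close>

lemma arc_weight_cross:
  assumes "1 \<le> a" "a \<le> m" "a + 2 \<le> b" "b \<le> a + m"
    "1 \<le> i" "i \<le> m" "i + 2 \<le> j" "j < i + m"
  shows "of_bool ((a, b) = (i, j)) + arc_weight m i j (a, b) + arc_weight m (i - 1) (j - 1) (a, b) =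
    arc_weight m (i - 1) j (a, b) + arc_weight m i (j - 1) (a, b)"
  using assms unfolding arc_weight_def alternate_def of_bool_def fst_conv snd_conv prod.inject by auto

text \<open>A counted translate would have length greater than \<open>m\<close>.\<close>

lemma arc_weight_full:
  assumes "1 \<le> a" "a \<le> m" "a + 2 \<le> b" "b \<le> a + m"
    "p \<le> m"
  shows "arc_weight m p (p + m) (a, b) = 0"
  using assms unfolding arc_weight_def alternate_def of_bool_def fst_conv snd_conv prod.inject by auto

text \<open>A counted translate has length at least \<open>m\<close>, so it must be the longest arc
  starting at \<open>i\<close>.\<close>

lemma arc_weight_almost_full:
  assumes "1 \<le> a" "a \<le> m" "a + 2 \<le> b" "b \<le> a + m"
    "1 \<le> i" "i \<le> m"
  shows "arc_weight m i (i + m - 1) (a, b) = of_bool ((a, b) = (i, i + m))"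
  using assms unfolding arc_weight_def alternate_def of_bool_def fst_conv snd_conv prod.inject by auto

text \<open>Only three translates enter the weight. For \<open>p < m\<close>, the one lost and the
  one gained by the shift both contribute nothing.\<close>

lemma arc_weight_periodic:
  assumes "1 \<le> a" "a \<le> m" "a + 2 \<le> b" "b \<le> a + m"
    "p < m"
  shows "arc_weight m (p + m) (q + m) (a, b) = arc_weight m p q (a, b)"
  using assms unfolding arc_weight_def alternate_def of_bool_def fst_conv snd_conv prod.inject by auto

section \<open>Brackets as monomials, and the products in the cluster relations\<close>

definition arc_monomial :: "nat \<Rightarrow> (nat \<times> nat \<Rightarrow> 'r) \<Rightarrow> nat \<Rightarrow> nat \<Rightarrow> 'r::comm_monoid_mult" where
  "arc_monomial n u p q = (\<Prod>x\<in>arcs n. u x ^ arc_weight (n + 1) p q x)"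

lemma arcsE:
  assumes "x \<in> arcs n"
  obtains a b where "x = (a, b)" "1 \<le> a" "a \<le> n + 1" "a + 2 \<le> b" "b \<le> a + (n + 1)"
  using assms by (auto simp: arcs_def)

lemma finite_arcs [simp]: "finite (arcs n)"
  by (rule finite_subset[of _ "{..n + 1} \<times> {..2 * n + 2}"]) (auto simp: arcs_def)

lemma prod_power_delta:
  fixes u :: "nat \<times> nat \<Rightarrow> 'r::comm_monoid_mult"
  assumes "y \<in> arcs n"
  shows "(\<Prod>x\<in>arcs n. u x ^ of_bool (x = y)) = u y"
proof -
  have "(\<Prod>x\<in>arcs n. u x ^ of_bool (x = y)) = (\<Prod>x\<in>arcs n. if x = y then u x else 1)"
    by (intro prod.cong) auto
  then show ?thesis using assms by (simp add: prod.delta)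
qed

definition crossing_product :: "nat \<Rightarrow> (nat \<times> nat \<Rightarrow> 'r) \<Rightarrow> nat \<times> nat \<Rightarrow> 'r::comm_monoid_mult" where
  "crossing_product n u y = (\<Prod>x\<in>arcs n. u x ^ compat_degree (diagonals n x) (diagonals n y))"

lemma crossing_product_long:
  assumes "(i, i + (n + 1)) \<in> arcs n"
  shows "crossing_product n u (i, i + (n + 1)) = arc_monomial n u (i - 1) i"
  unfolding crossing_product_def arc_monomial_def
proof (rule prod.cong[OF refl])
  fix x assume x: "x \<in> arcs n"
  then obtain a b where ab: "x = (a, b)" "1 \<le> a" "a \<le> n + 1" "a + 2 \<le> b" "b \<le> a + (n + 1)"
    by (rule arcsE)
  have i: "1 \<le> i" "i \<le> n + 1" using assms by (auto simp: arcs_def)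
  show "u x ^ compat_degree (diagonals n x) (diagonals n (i, i + (n + 1))) =
      u x ^ arc_weight (n + 1) (i - 1) i x"
    using alternate_long[OF ab(2-) i] compat_degree_diagonals[OF x[unfolded ab(1)] assms]
    by (simp add: ab(1))
qed

lemma crossing_product_pair:
  assumes "(i, j) \<in> arcs n" "j < i + (n + 1)"
  shows "crossing_product n u (i, j) * arc_monomial n u i j * arc_monomial n u (i - 1) (j - 1) =
    arc_monomial n u (j - 1) j * arc_monomial n u (i - 1) i"
  unfolding crossing_product_def arc_monomial_def prod.distrib[symmetric] power_add[symmetric]
proof (rule prod.cong[OF refl])
  fix x assume x: "x \<in> arcs n"
  then obtain a b where ab: "x = (a, b)" "1 \<le> a" "a \<le> n + 1" "a + 2 \<le> b" "b \<le> a + (n + 1)"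
    by (rule arcsE)
  have ij: "1 \<le> i" "i \<le> n + 1" "i + 2 \<le> j" "j < i + (n + 1)"
    using assms by (auto simp: arcs_def)
  have "compat_degree (diagonals n x) (diagonals n (i, j)) + arc_weight (n + 1) i j x +
        arc_weight (n + 1) (i - 1) (j - 1) x = arc_weight (n + 1) (j - 1) j x + arc_weight (n + 1) (i - 1) i x"
    unfolding ab(1) compat_degree_diagonals[OF x[unfolded ab(1)] assms(1)]
    using alternate_pair_low[OF ab(2-) ij] alternate_pair_high[OF ab(2-) ij] ij
    by (cases "j \<le> n + 1") simp_all
  then show "u x ^ (compat_degree (diagonals n x) (diagonals n (i, j)) + arc_weight (n + 1) i j x +
        arc_weight (n + 1) (i - 1) (j - 1) x) =
      u x ^ (arc_weight (n + 1) (j - 1) j x + arc_weight (n + 1) (i - 1) i x)"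
    by (rule arg_cong)
qed

lemma arc_monomial_cross:
  assumes "(i, j) \<in> arcs n" "j < i + (n + 1)"
  shows "u (i, j) * arc_monomial n u i j * arc_monomial n u (i - 1) (j - 1) =
    arc_monomial n u (i - 1) j * arc_monomial n u i (j - 1)"
  unfolding prod_power_delta[OF assms(1), of u, symmetric]
    arc_monomial_def prod.distrib[symmetric] power_add[symmetric]
proof (rule prod.cong[OF refl])
  fix x assume "x \<in> arcs n"
  then obtain a b where ab: "x = (a, b)" "1 \<le> a" "a \<le> n + 1" "a + 2 \<le> b" "b \<le> a + (n + 1)"
    by (rule arcsE)
  have ij: "1 \<le> i" "i \<le> n + 1" "i + 2 \<le> j" "j < i + (n + 1)"
    using assms by (auto simp: arcs_def)
  show "u x ^ (of_bool (x = (i, j)) + arc_weight (n + 1) i j x + arc_weight (n + 1) (i - 1) (j - 1) x) =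
      u x ^ (arc_weight (n + 1) (i - 1) j x + arc_weight (n + 1) i (j - 1) x)"
    unfolding ab(1) using arc_weight_cross[OF ab(2-) ij] by (rule arg_cong)
qed

lemma arc_monomial_full:
  assumes "p \<le> n + 1"
  shows "arc_monomial n u p (p + (n + 1)) = 1"
  unfolding arc_monomial_def
proof (rule prod.neutral, rule ballI)
  fix x assume "x \<in> arcs n"
  then obtain a b where ab: "x = (a, b)" "1 \<le> a" "a \<le> n + 1" "a + 2 \<le> b" "b \<le> a + (n + 1)"
    by (rule arcsE)
  show "u x ^ arc_weight (n + 1) p (p + (n + 1)) x = 1"
    unfolding ab(1) arc_weight_full[OF ab(2-) assms] by simp
qed

lemma arc_monomial_almost_full:
  assumes "(i, i + (n + 1)) \<in> arcs n"
  shows "arc_monomial n u i (i + n) = u (i, i + (n + 1))"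
  unfolding prod_power_delta[OF assms, of u, symmetric] arc_monomial_def
proof (rule prod.cong[OF refl])
  fix x assume "x \<in> arcs n"
  then obtain a b where ab: "x = (a, b)" "1 \<le> a" "a \<le> n + 1" "a + 2 \<le> b" "b \<le> a + (n + 1)"
    by (rule arcsE)
  have i: "1 \<le> i" "i \<le> n + 1" using assms by (auto simp: arcs_def)
  show "u x ^ arc_weight (n + 1) i (i + n) x = u x ^ of_bool (x = (i, i + (n + 1)))"
    using arc_weight_almost_full[OF ab(2-) i] by (simp add: ab(1))
qed

lemma arc_monomial_periodic:
  assumes "p < n + 1"
  shows "arc_monomial n u (p + (n + 1)) (q + (n + 1)) = arc_monomial n u p q"
  unfolding arc_monomial_def
proof (rule prod.cong[OF refl])
  fix x assume "x \<in> arcs n"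
  then obtain a b where ab: "x = (a, b)" "1 \<le> a" "a \<le> n + 1" "a + 2 \<le> b" "b \<le> a + (n + 1)"
    by (rule arcsE)
  show "u x ^ arc_weight (n + 1) (p + (n + 1)) (q + (n + 1)) x = u x ^ arc_weight (n + 1) p q x"
    unfolding ab(1) arc_weight_periodic[OF ab(2-) assms] ..
qed

lemma prod_B_index:
  fixes f :: "nat set set \<Rightarrow> 'r::comm_monoid_mult"
  assumes "n \<ge> 1"
  shows "(\<Prod>\<omega>\<in>B_index n. f \<omega>) = (\<Prod>x\<in>arcs n. f (diagonals n x))"
proof -
  have "B_index n = diagonals n ` arcs n"
    using B_index_arc[OF _ assms] diagonals_in_B_index by blast
  then show ?thesis using inj_on_diagonals by (simp add: prod.reindex)
qed

section \<open>The values of the cluster variables at a point\<close>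

text \<open>The coordinates extended to all indices by \<open>z\<^sub>k\<^sub>+\<^sub>n\<^sub>+\<^sub>1 = z\<^sub>k + 1\<close>; only indices up to \<open>2n+2\<close> matter.\<close>

definition cyclic_extension :: "nat \<Rightarrow> (nat \<Rightarrow> complex) \<Rightarrow> nat \<Rightarrow> complex" where
  "cyclic_extension n z k = (if k = 0 then z (n + 1) - 1 else if k \<le> n + 1 then z k
     else z (k - (n + 1)) + 1)"

definition shi_arc_value :: "nat \<Rightarrow> (nat \<Rightarrow> complex) \<Rightarrow> nat \<times> nat \<Rightarrow> complex" where
  "shi_arc_value n z x = (let (i, j) = x; y = cyclic_extension n z in
     if j = i + (n + 1) then y (i + n) - y i
     else (y j - y (i - 1)) * (y (j - 1) - y i) / ((y j - y i) * (y (j - 1) - y (i - 1))))"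

definition shi_generic :: "nat \<Rightarrow> (nat \<Rightarrow> complex) \<Rightarrow> bool" where
  "shi_generic n z \<longleftrightarrow> (\<forall>a b c. 1 \<le> a \<and> a < b \<and> b \<le> n + 1 \<and> c \<in> {0, 1} \<longrightarrow> z b - z a \<noteq> c)"

lemma cyclic_extension_periodic:
  "k \<le> n + 1 \<Longrightarrow> cyclic_extension n z (k + (n + 1)) = cyclic_extension n z k + 1"
  by (auto simp: cyclic_extension_def)

text \<open>Over less than a period such a difference is, up to sign, a Shi form, where wrapping
  around contributes the constant 1. Over a full period it equals 1.\<close>

lemma cyclic_extension_diff_nonzero:
  assumes "shi_generic n z" "p \<le> n + 1" "p < q" "q \<le> p + (n + 1)"
  shows "cyclic_extension n z q - cyclic_extension n z p \<noteq> 0"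
proof -
  have g0: "z b \<noteq> z a" and g1: "z b \<noteq> z a + 1" if "1 \<le> a" "a < b" "b \<le> n + 1" for a b
  proof -
    have "z b - z a \<noteq> c" if "c \<in> {0, 1}" for c
      using assms(1) that \<open>1 \<le> a\<close> \<open>a < b\<close> \<open>b \<le> n + 1\<close> unfolding shi_generic_def by blast
    from this[of 0] this[of 1] show "z b \<noteq> z a" "z b \<noteq> z a + 1" by auto
  qed
  consider "p = 0" "q = n + 1" | "p = 0" "q < n + 1" | "1 \<le> p" "q \<le> n + 1"
    | "1 \<le> p" "n + 1 < q" "q - (n + 1) = p" | "1 \<le> p" "n + 1 < q" "q - (n + 1) < p"
    using assms by linarith
  then show ?thesis
  proof cases
    case 2
    then show ?thesis using g1[of q "n + 1"] assms by (auto simp: cyclic_extension_def)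
  next
    case 3
    then show ?thesis using g0[of p q] assms by (auto simp: cyclic_extension_def)
  next
    case 5
    then show ?thesis using g1[of "q - (n + 1)" p, THEN not_sym] assms by (auto simp: cyclic_extension_def)
  qed (use assms in \<open>auto simp: cyclic_extension_def\<close>)
qed

lemma shi_arc_value_nonzero:
  assumes "shi_generic n z" "x \<in> arcs n"
  shows "shi_arc_value n z x \<noteq> 0"
proof -
  obtain i j where x: "x = (i, j)" and ij: "1 \<le> i" "i \<le> n + 1" "i + 2 \<le> j" "j \<le> i + (n + 1)"
    using assms(2) by (rule arcsE)
  note nz = cyclic_extension_diff_nonzero[OF assms(1)]
  have "cyclic_extension n z (i + n) - cyclic_extension n z i \<noteq> 0" using ij by (intro nz) auto
  moreover have "cyclic_extension n z j - cyclic_extension n z (i - 1) \<noteq> 0"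
    "cyclic_extension n z (j - 1) - cyclic_extension n z i \<noteq> 0"
    "cyclic_extension n z j - cyclic_extension n z i \<noteq> 0"
    "cyclic_extension n z (j - 1) - cyclic_extension n z (i - 1) \<noteq> 0"
    if "j \<noteq> i + (n + 1)"
    using ij that by (intro nz; linarith)+
  ultimately show ?thesis by (simp add: shi_arc_value_def Let_def x)
qed

text \<open>In the cross relation of \<open>(p, q + 1)\<close> the other three brackets are longer
  than \<open>[p, q]\<close> and known by induction, so \<open>[p, q]\<close> can be solved for. The
  induction on the missing length \<open>d\<close> is strong because \<open>[p - 1, q + 1]\<close>
  is longer by two.\<close>

lemma arc_monomial_shi_value:
  assumes g: "shi_generic n z" and n: "n \<ge> 1"
    and pq: "p \<le> n + 1" "p < q" "q \<le> p + (n + 1)"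
  shows "arc_monomial n (shi_arc_value n z) p q = cyclic_extension n z q - cyclic_extension n z p"
proof -
  let ?y = "cyclic_extension n z" and ?u = "shi_arc_value n z"
  have "arc_monomial n ?u p q = ?y q - ?y p"
    if "p \<le> n + 1" "p < q" "q + d = p + (n + 1)" for d p q
    using that
  proof (induction d arbitrary: p q rule: less_induct)
    case (less d)
    have pos: "arc_monomial n ?u p q = ?y q - ?y p"
      if p: "1 \<le> p" "p \<le> n + 1" "p < q" "q + d = p + (n + 1)" for p q
    proof -
      consider "d = 0" | "d = 1" | "d \<ge> 2" by linarith
      then show ?thesis
      proof cases
        case 1
        then show ?thesis
          using p arc_monomial_full[of p n ?u] cyclic_extension_periodic[of p n z] by simp
      next
        case 2
        then have "q = p + n" "(p, p + (n + 1)) \<in> arcs n" using p n by (auto simp: arcs_def)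
        then show ?thesis using arc_monomial_almost_full[of p n ?u] by (simp add: shi_arc_value_def Let_def)
      next
        case 3
        let ?j = "q + 1"
        have arc: "(p, ?j) \<in> arcs n" "?j < p + (n + 1)" using 3 p by (auto simp: arcs_def)
        have m1: "arc_monomial n ?u p ?j = ?y ?j - ?y p"
          by (rule less.IH[of "d - 1"]) (use 3 p in auto)
        have m2: "arc_monomial n ?u (p - 1) (?j - 1) = ?y (?j - 1) - ?y (p - 1)"
          by (rule less.IH[of "d - 1"]) (use 3 p in auto)
        have m3: "arc_monomial n ?u (p - 1) ?j = ?y ?j - ?y (p - 1)"
          by (rule less.IH[of "d - 2"]) (use 3 p in auto)
        have nz: "?y ?j - ?y p \<noteq> 0" "?y (?j - 1) - ?y (p - 1) \<noteq> 0" "?y ?j - ?y (p - 1) \<noteq> 0"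
          using 3 p by (intro cyclic_extension_diff_nonzero[OF g]; linarith)+
        have "?u (p, ?j) * (?y ?j - ?y p) * (?y (?j - 1) - ?y (p - 1)) =
            (?y ?j - ?y (p - 1)) * arc_monomial n ?u p (?j - 1)"
          using arc_monomial_cross[OF arc, of ?u] unfolding m1 m2 m3 .
        moreover have "?u (p, ?j) * (?y ?j - ?y p) * (?y (?j - 1) - ?y (p - 1)) =
            (?y ?j - ?y (p - 1)) * (?y (?j - 1) - ?y p)"
          using nz(1,2) arc(2) by (simp add: shi_arc_value_def Let_def)
        ultimately show ?thesis using nz(3) by simp
      qed
    qed
    show ?case
    proof (cases "p = 0")
      case True
      \<comment> \<open>No arc starts at 0, so this case is moved up by one period.\<close>
      have "arc_monomial n ?u (0 + (n + 1)) (q + (n + 1)) = ?y (q + (n + 1)) - ?y (0 + (n + 1))"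
        by (rule pos) (use less.prems True in auto)
      moreover have "?y (q + (n + 1)) - ?y (0 + (n + 1)) = ?y q - ?y 0"
        using less.prems True by (subst (1 2) cyclic_extension_periodic) auto
      ultimately show ?thesis using arc_monomial_periodic[of 0 n ?u q] True by simp
    qed (use pos less.prems in auto)
  qed
  from this[of p q "p + (n + 1) - q"] show ?thesis using pq by simp
qed

text \<open>After clearing denominators this is the three-term identity between differences of four
  numbers. For a long arc it is the increment 1 over a period.\<close>

lemma shi_arc_value_relation:
  assumes g: "shi_generic n z" and n: "n \<ge> 1" and x: "x \<in> arcs n"
  shows "shi_arc_value n z x + crossing_product n (shi_arc_value n z) x = 1"
proof -
  let ?y = "cyclic_extension n z" and ?u = "shi_arc_value n z"
  obtain i j where xx: "x = (i, j)" and ij: "1 \<le> i" "i \<le> n + 1" "i + 2 \<le> j" "j \<le> i + (n + 1)"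
    using x by (rule arcsE)
  note M = arc_monomial_shi_value[OF g n]
  show ?thesis
  proof (cases "j = i + (n + 1)")
    case True
    then have "crossing_product n ?u x = arc_monomial n ?u (i - 1) i"
      using crossing_product_long[of i n ?u] x xx by simp
    also have "\<dots> = ?y i - ?y (i - 1)" by (rule M) (use ij in auto)
    finally have "crossing_product n ?u x = ?y i - ?y (i - 1)" .
    moreover have "?y (i - 1 + (n + 1)) = ?y (i - 1) + 1"
      using ij by (intro cyclic_extension_periodic) auto
    then have "?y (i + n) = ?y (i - 1) + 1" using ij by simp
    ultimately show ?thesis using True by (simp add: xx shi_arc_value_def Let_def)
  next
    case False
    have arc: "(i, j) \<in> arcs n" "j < i + (n + 1)" using False x xx ij by auto
    have m1: "arc_monomial n ?u i j = ?y j - ?y i" by (rule M) (use ij arc in auto)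
    have m2: "arc_monomial n ?u (i - 1) (j - 1) = ?y (j - 1) - ?y (i - 1)"
      by (rule M) (use ij arc in auto)
    have m4: "arc_monomial n ?u (i - 1) i = ?y i - ?y (i - 1)" by (rule M) (use ij arc in auto)
    have m5: "arc_monomial n ?u (j - 1) j = ?y j - ?y (j - 1)"
    proof (cases "j - 1 \<le> n + 1")
      case True
      show ?thesis by (rule M) (use True ij arc in auto)
    next
      case j: False
      \<comment> \<open>The formula for bracket values needs a start of at most
        \<open>n + 1\<close>, so this bracket is moved down by one period.\<close>
      define k where "k = j - 1 - (n + 1)"
      have k: "j - 1 = k + (n + 1)" "j = Suc k + (n + 1)" "k < n + 1" using j ij arc by (auto simp: k_def)
      have "arc_monomial n ?u (j - 1) j = arc_monomial n ?u k (Suc k)"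
        unfolding k(1) by (subst k(2), rule arc_monomial_periodic[OF k(3)])
      also have "\<dots> = ?y (Suc k) - ?y k" by (rule M) (use k in auto)
      also have "\<dots> = ?y j - ?y (j - 1)"
        unfolding k(1) using cyclic_extension_periodic[of "Suc k" n z]
          cyclic_extension_periodic[of k n z] k(3) by (subst k(2)) simp
      finally show ?thesis .
    qed
    have nz: "?y j - ?y i \<noteq> 0" "?y (j - 1) - ?y (i - 1) \<noteq> 0"
      using ij arc by (intro cyclic_extension_diff_nonzero[OF g]; linarith)+
    let ?D = "(?y j - ?y i) * (?y (j - 1) - ?y (i - 1))"
    have "crossing_product n ?u x * ?D = (?y j - ?y (j - 1)) * (?y i - ?y (i - 1))"
      using crossing_product_pair[OF arc, of ?u] unfolding m1 m2 m4 m5 xx by (simp add: mult.assoc)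
    moreover have "?u x * ?D = (?y j - ?y (i - 1)) * (?y (j - 1) - ?y i)"
      using nz False by (simp add: xx shi_arc_value_def Let_def)
    ultimately have "(?u x + crossing_product n ?u x) * ?D =
        (?y j - ?y (i - 1)) * (?y (j - 1) - ?y i) + (?y j - ?y (j - 1)) * (?y i - ?y (i - 1))"
      by (simp only: distrib_right)
    also have "\<dots> = 1 * ?D" by (simp add: algebra_simps)
    finally have "(?u x + crossing_product n ?u x) * ?D = 1 * ?D" .
    then show ?thesis using nz mult_right_cancel[of ?D] by simp
  qed
qed

text \<open>The long variable at \<open>k\<close> takes the value
  \<open>z (k - 1) + 1 - z k\<close>, so the sum telescopes.\<close>

lemma sum_shi_arc_value_long:
  assumes "1 \<le> a" "a \<le> n + 1"
  shows "(\<Sum>k=2..a. 1 - shi_arc_value n z (k, k + (n + 1))) = z a - z 1"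
  using assms
proof (induction a rule: dec_induct)
  case (step a)
  have "shi_arc_value n z (Suc a, Suc a + (n + 1)) = 1 + z a - z (Suc a)"
    using step by (simp add: shi_arc_value_def Let_def cyclic_extension_def)
  then show ?case using step by (simp add: sum.cl_ivl_Suc)
qed simp

section \<open>Additivity of the brackets\<close>

type_synonym laurent = "(nat set set \<Rightarrow>\<^sub>0 int) \<Rightarrow>\<^sub>0 complex"

abbreviation laurent_ring :: "nat \<Rightarrow> laurent ring" where
  "laurent_ring n \<equiv> mpoly_ring (B_index n)"

lemma mpoly_ring_simps [simp]:
  "monoid.mult (mpoly_ring V) = (*)" "one (mpoly_ring V) = 1" "zero (mpoly_ring V) = 0"
  "add (mpoly_ring V) = (+)"
  by (simp_all add: mpoly_ring_def)

lemma mpoly_ring_carrier_add: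
  "p \<in> carrier (mpoly_ring V) \<Longrightarrow> q \<in> carrier (mpoly_ring V) \<Longrightarrow> p + q \<in> carrier (mpoly_ring V)"
  using cring.cring_simprules(1)[OF cring_mpoly_ring, of p V q] by simp

lemma mpoly_ring_carrier_mult:
  "p \<in> carrier (mpoly_ring V) \<Longrightarrow> q \<in> carrier (mpoly_ring V) \<Longrightarrow> p * q \<in> carrier (mpoly_ring V)"
  using cring.cring_simprules(5)[OF cring_mpoly_ring, of p V q] by simp

lemma mpoly_ring_carrier_uminus:
  "p \<in> carrier (mpoly_ring V) \<Longrightarrow> - p \<in> carrier (mpoly_ring V)"
  by (simp add: mpoly_ring_def in_keys_iff)

lemma mpoly_ring_carrier_diff:
  "p \<in> carrier (mpoly_ring V) \<Longrightarrow> q \<in> carrier (mpoly_ring V) \<Longrightarrow> p - q \<in> carrier (mpoly_ring V)"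
  using mpoly_ring_carrier_add[OF _ mpoly_ring_carrier_uminus, of p V q] by simp

lemma mpoly_ring_carrier_const [simp]: "const c \<in> carrier (mpoly_ring V)"
  by (simp add: mpoly_ring_def const_def)

lemma mpoly_ring_carrier_0 [simp]: "0 \<in> carrier (mpoly_ring V)"
  by (simp add: mpoly_ring_def)

lemma mpoly_ring_carrier_1 [simp]: "1 \<in> carrier (mpoly_ring V)"
  by (simp add: mpoly_ring_def)

lemma mpoly_ring_carrier_var: "v \<in> V \<Longrightarrow> var v \<in> carrier (mpoly_ring V)"
  by (simp add: mpoly_ring_def var_def)

lemmas mpoly_ring_carrier = mpoly_ring_carrier_add mpoly_ring_carrier_mult mpoly_ring_carrier_uminus
  mpoly_ring_carrier_diff mpoly_ring_carrier_const mpoly_ring_carrier_0 mpoly_ring_carrier_1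
  mpoly_ring_carrier_var

lemma mpoly_ring_carrier_power:
  "p \<in> carrier (mpoly_ring V) \<Longrightarrow> p ^ k \<in> carrier (mpoly_ring V)"
  by (induction k) (simp_all add: mpoly_ring_carrier)

lemma mpoly_ring_carrier_sum:
  "(\<And>x. x \<in> X \<Longrightarrow> f x \<in> carrier (mpoly_ring V)) \<Longrightarrow> sum f X \<in> carrier (mpoly_ring V)"
  by (induction X rule: infinite_finite_induct) (simp_all add: mpoly_ring_carrier)

lemma mpoly_ring_carrier_prod:
  "(\<And>x. x \<in> X \<Longrightarrow> f x \<in> carrier (mpoly_ring V)) \<Longrightarrow> prod f X \<in> carrier (mpoly_ring V)"
  by (induction X rule: infinite_finite_induct) (simp_all add: mpoly_ring_carrier)

lemma mpoly_ring_a_minus: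
  assumes "p \<in> carrier (mpoly_ring V)" "q \<in> carrier (mpoly_ring V)"
  shows "p \<ominus>\<^bsub>mpoly_ring V\<^esub> q = p - q"
proof -
  interpret cring "mpoly_ring V :: (('a \<Rightarrow>\<^sub>0 'b) \<Rightarrow>\<^sub>0 complex) ring" by (rule cring_mpoly_ring)
  have "\<ominus>\<^bsub>mpoly_ring V\<^esub> q = - q"
    by (rule minus_equality) (use assms in \<open>simp_all add: mpoly_ring_carrier\<close>)
  then show ?thesis by (simp add: a_minus_def)
qed

section \<open>Brackets as units of the Laurent ring, and computation modulo the ideal\<close>

definition inverse_var :: "'v \<Rightarrow> (('v \<Rightarrow>\<^sub>0 int) \<Rightarrow>\<^sub>0 complex)" where
  "inverse_var v = Poly_Mapping.single (Poly_Mapping.single v (- 1)) 1"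

lemma var_inverse_var: "var v * inverse_var v = 1"
  by (simp add: var_def inverse_var_def mult_single single_add[symmetric])

lemma inverse_var_carrier: "v \<in> V \<Longrightarrow> inverse_var v \<in> carrier (mpoly_ring V)"
  by (simp add: mpoly_ring_def inverse_var_def)

definition arc_var :: "nat \<Rightarrow> nat \<times> nat \<Rightarrow> laurent" where
  "arc_var n x = var (diagonals n x)"

definition bracket :: "nat \<Rightarrow> nat \<Rightarrow> nat \<Rightarrow> laurent" where
  "bracket n = arc_monomial n (arc_var n)"

definition bracket_inverse :: "nat \<Rightarrow> nat \<Rightarrow> nat \<Rightarrow> laurent" where
  "bracket_inverse n = arc_monomial n (\<lambda>x. inverse_var (diagonals n x))"

lemma bracket_inverse: "bracket n p q * bracket_inverse n p q = 1"
  by (simp add: bracket_def bracket_inverse_def arc_monomial_def arc_var_def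
      prod.distrib[symmetric] power_mult_distrib[symmetric] var_inverse_var)

lemma arc_var_carrier: "x \<in> arcs n \<Longrightarrow> arc_var n x \<in> carrier (laurent_ring n)"
  by (simp add: arc_var_def mpoly_ring_carrier_var diagonals_in_B_index)

lemma bracket_carrier: "bracket n p q \<in> carrier (laurent_ring n)"
  by (simp add: bracket_def arc_monomial_def mpoly_ring_carrier_prod mpoly_ring_carrier_power arc_var_carrier)

lemma bracket_inverse_carrier: "bracket_inverse n p q \<in> carrier (laurent_ring n)"
  by (simp add: bracket_inverse_def arc_monomial_def mpoly_ring_carrier_prod mpoly_ring_carrier_power
      inverse_var_carrier diagonals_in_B_index)

lemma ideal_B_ideal: "ideal (B_ideal n) (laurent_ring n)"
proof -
  interpret cring "laurent_ring n" by (rule cring_mpoly_ring)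
  have "B_relation n \<gamma> \<in> carrier (laurent_ring n)" if "\<gamma> \<in> B_index n" for \<gamma>
    using that by (simp add: B_relation_def mpoly_ring_carrier mpoly_ring_carrier_prod mpoly_ring_carrier_power)
  then show ?thesis unfolding B_ideal_def by (intro genideal_ideal) auto
qed

lemma B_relation_in_ideal:
  assumes "\<gamma> \<in> B_index n"
  shows "B_relation n \<gamma> \<in> B_ideal n"
proof -
  interpret cring "laurent_ring n" by (rule cring_mpoly_ring)
  have "B_relation n \<gamma> \<in> carrier (laurent_ring n)" if "\<gamma> \<in> B_index n" for \<gamma>
    using that by (simp add: B_relation_def mpoly_ring_carrier mpoly_ring_carrier_prod mpoly_ring_carrier_power)
  then show ?thesis unfolding B_ideal_def using assms genideal_self by blast
qed

lemma B_ideal_add: "x \<in> B_ideal n \<Longrightarrow> y \<in> B_ideal n \<Longrightarrow> x + y \<in> B_ideal n"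
  using additive_subgroup.a_closed[OF ideal.axioms(1)[OF ideal_B_ideal]] by fastforce

lemma B_ideal_zero: "0 \<in> B_ideal n"
  using additive_subgroup.zero_closed[OF ideal.axioms(1)[OF ideal_B_ideal]] by simp

lemma B_ideal_mult: "x \<in> B_ideal n \<Longrightarrow> r \<in> carrier (laurent_ring n) \<Longrightarrow> r * x \<in> B_ideal n"
  using ideal.I_l_closed[OF ideal_B_ideal, of x n r] by simp

lemma B_ideal_uminus: "x \<in> B_ideal n \<Longrightarrow> - x \<in> B_ideal n"
  using B_ideal_mult[of x n "- 1"] by (simp add: mpoly_ring_carrier)

lemma B_ideal_diff: "x \<in> B_ideal n \<Longrightarrow> y \<in> B_ideal n \<Longrightarrow> x - y \<in> B_ideal n"
  using B_ideal_add[OF _ B_ideal_uminus, of x n y] by simp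

lemma B_ideal_carrier: "x \<in> B_ideal n \<Longrightarrow> x \<in> carrier (laurent_ring n)"
  using ideal.Icarr[OF ideal_B_ideal] .

text \<open>Brackets have inverse monomials; this replaces any appeal to primality of the
  ideal.\<close>

lemma B_ideal_cancel:
  assumes "bracket n p q * x \<in> B_ideal n"
  shows "x \<in> B_ideal n"
proof -
  have "bracket_inverse n p q * (bracket n p q * x) \<in> B_ideal n"
    using assms bracket_inverse_carrier by (rule B_ideal_mult)
  moreover have "bracket_inverse n p q * (bracket n p q * x) = (bracket n p q * bracket_inverse n p q) * x"
    by (simp add: mult_ac)
  ultimately show ?thesis by (simp add: bracket_inverse)
qed

lemma arc_relation:
  assumes "n \<ge> 1" "x \<in> arcs n"
  shows "arc_var n x + crossing_product n (arc_var n) x - 1 \<in> B_ideal n"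
  using B_relation_in_ideal[OF diagonals_in_B_index[OF assms(2)]] assms(1)
  by (simp add: B_relation_def prod_B_index crossing_product_def arc_var_def)

text \<open>This is the relation of the arc \<open>(i, j)\<close> multiplied by
  \<open>[i, j] [i - 1, j - 1]\<close>, the common denominator of the variable and of its crossing
  product.\<close>

lemma plucker:
  assumes "n \<ge> 1" "(i, j) \<in> arcs n" "j < i + (n + 1)"
  shows "bracket n i j * bracket n (i - 1) (j - 1) - bracket n (i - 1) j * bracket n i (j - 1) -
    bracket n (j - 1) j * bracket n (i - 1) i \<in> B_ideal n"
proof -
  let ?m = "bracket n i j * bracket n (i - 1) (j - 1)" and ?u = "arc_var n (i, j)"
    and ?c = "crossing_product n (arc_var n) (i, j)"
  have "?m * (?u + ?c - 1) \<in> B_ideal n"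
    using arc_relation[OF assms(1,2)] by (rule B_ideal_mult) (simp add: mpoly_ring_carrier bracket_carrier)
  moreover have "?u * ?m = bracket n (i - 1) j * bracket n i (j - 1)"
    using arc_monomial_cross[OF assms(2,3), of "arc_var n"] by (simp add: bracket_def mult.assoc)
  moreover have "?c * ?m = bracket n (j - 1) j * bracket n (i - 1) i"
    using crossing_product_pair[OF assms(2,3), of "arc_var n"] by (simp add: bracket_def mult.assoc)
  moreover have "?m * (?u + ?c - 1) = ?u * ?m + ?c * ?m - ?m" by (simp add: algebra_simps)
  ultimately have "bracket n (i - 1) j * bracket n i (j - 1) +
      bracket n (j - 1) j * bracket n (i - 1) i - ?m \<in> B_ideal n"
    by simp
  from B_ideal_uminus[OF this] show ?thesis by (simp add: algebra_simps)
qed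

lemma bracket_full: "p \<le> n + 1 \<Longrightarrow> bracket n p (p + (n + 1)) = 1"
  unfolding bracket_def by (rule arc_monomial_full)

lemma bracket_almost_full:
  "(i, i + (n + 1)) \<in> arcs n \<Longrightarrow> bracket n i (i + n) = arc_var n (i, i + (n + 1))"
  unfolding bracket_def by (rule arc_monomial_almost_full)

lemma bracket_periodic: "p < n + 1 \<Longrightarrow> bracket n (p + (n + 1)) (q + (n + 1)) = bracket n p q"
  unfolding bracket_def by (rule arc_monomial_periodic)

lemma bracket_step:
  assumes "n \<ge> 1" "1 \<le> i" "i \<le> n + 1"
  shows "bracket n (i - 1) i - (1 - arc_var n (i, i + (n + 1))) \<in> B_ideal n"
proof -
  have arc: "(i, i + (n + 1)) \<in> arcs n" using assms by (auto simp: arcs_def)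
  show ?thesis
    using arc_relation[OF assms(1) arc] crossing_product_long[OF arc, of "arc_var n"]
    by (simp add: bracket_def algebra_simps)
qed

text \<open>The failure of additivity when the last unit step is split off;
  \<open>left_defect\<close> splits off the first. Meaningful for \<open>q \<ge> p + 2\<close>: at
  \<open>q = p + 1\<close> the term \<open>[p, p]\<close> would occur, which is a monomial and not
  0.\<close>

definition right_defect :: "nat \<Rightarrow> nat \<Rightarrow> nat \<Rightarrow> laurent" where
  "right_defect n p q = bracket n p q - bracket n p (q - 1) - bracket n (q - 1) q"

definition left_defect :: "nat \<Rightarrow> nat \<Rightarrow> nat \<Rightarrow> laurent" where
  "left_defect n p q = bracket n p q - bracket n p (p + 1) - bracket n (p + 1) q"

lemma right_defect_periodic:
  assumes "1 \<le> q" "q \<le> n + 1"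
  shows "right_defect n (n + 1) (q + (n + 1)) = right_defect n 0 q"
proof -
  have e: "q + (n + 1) - 1 = q - 1 + (n + 1)" using assms by simp
  show ?thesis
    using bracket_periodic[of 0 n q] bracket_periodic[of 0 n "q - 1"] bracket_periodic[of "q - 1" n q]
      assms unfolding right_defect_def e by simp
qed

lemma left_defect_periodic:
  assumes "1 \<le> n"
  shows "left_defect n (n + 1) (q + (n + 1)) = left_defect n 0 q"
proof -
  have e: "n + 1 + 1 = 1 + (n + 1)" by simp
  show ?thesis
    using bracket_periodic[of 0 n q] bracket_periodic[of 0 n 1] bracket_periodic[of 1 n q]
      assms unfolding left_defect_def e by simp
qed

text \<open>The full bracket is 1 and the bracket one step shorter is the long variable, so both
  defects equal the negative of the relation of the long diagonal at \<open>i\<close>.\<close>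

lemma defects_full:
  assumes n: "n \<ge> 1" and i: "1 \<le> i" "i \<le> n + 1"
  shows "right_defect n i (i + (n + 1)) \<in> B_ideal n"
    and "left_defect n (i - 1) (i + n) \<in> B_ideal n"
proof -
  have arc: "(i, i + (n + 1)) \<in> arcs n" using n i by (auto simp: arcs_def)
  have step: "- (bracket n (i - 1) i - (1 - arc_var n (i, i + (n + 1)))) \<in> B_ideal n"
    using bracket_step[OF n i] by (rule B_ideal_uminus)
  have "bracket n (i + n) (i + (n + 1)) = bracket n (i - 1) i"
    using bracket_periodic[of "i - 1" n i] i by simp
  moreover have "bracket n i (i + (n + 1)) = 1" using i by (intro bracket_full)
  ultimately show "right_defect n i (i + (n + 1)) \<in> B_ideal n"
    using step bracket_almost_full[OF arc] by (simp add: right_defect_def algebra_simps)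
  have "bracket n (i - 1) (i + n) = 1" using i bracket_full[of "i - 1" n] by simp
  then show "left_defect n (i - 1) (i + n) \<in> B_ideal n"
    using step bracket_almost_full[OF arc] i by (simp add: left_defect_def algebra_simps)
qed

text \<open>If additivity holds for the longer bracket \<open>[i-1, j]\<close>, the Pluecker relation
  gives two linear relations between the defects of \<open>[i, j]\<close> and \<open>[i-1, j-1]\<close>, whose determinant
  \<open>[i-1, j] [i, j-1]\<close> is a unit.\<close>

lemma defects_step:
  assumes n: "n \<ge> 1" and arc: "(i, j) \<in> arcs n" "j < i + (n + 1)"
    and right: "right_defect n (i - 1) j \<in> B_ideal n" and left: "left_defect n (i - 1) j \<in> B_ideal n"
  shows "right_defect n i j \<in> B_ideal n" and "left_defect n (i - 1) (j - 1) \<in> B_ideal n"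
proof -
  have i: "i - 1 + 1 = i" using arc by (auto simp: arcs_def)
  define a b c d e f where "a = bracket n i j" and "b = bracket n (i - 1) (j - 1)"
    and "c = bracket n (i - 1) j" and "d = bracket n i (j - 1)" and "e = bracket n (j - 1) j"
    and "f = bracket n (i - 1) i"
  note defs = a_def b_def c_def d_def e_def f_def
  have cl: "x \<in> carrier (laurent_ring n)" if "x \<in> {a, b, c, d, e, f}" for x
    using that by (auto simp: defs bracket_carrier)
  define E D where "E = a - d - e" and "D = b - f - d"
  have E: "right_defect n i j = E" and D: "left_defect n (i - 1) (j - 1) = D"
    by (simp_all add: right_defect_def left_defect_def E_def D_def defs i del: One_nat_def)
  have T: "a * b - c * d - e * f \<in> B_ideal n" using plucker[OF n arc] by (simp add: defs)
  have R: "c - b - e \<in> B_ideal n" using right by (simp add: right_defect_def defs)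
  have L: "c - f - a \<in> B_ideal n" using left by (simp add: left_defect_def defs i del: One_nat_def)
  have "(a * b - c * d - e * f) + d * (c - b - e) \<in> B_ideal n"
    by (intro B_ideal_add B_ideal_mult T R cl) simp
  also have "(a * b - c * d - e * f) + d * (c - b - e) = b * E + e * D"
    by (simp add: E_def D_def algebra_simps)
  finally have 1: "b * E + e * D \<in> B_ideal n" .
  have "(a * b - c * d - e * f) + d * (c - f - a) \<in> B_ideal n"
    by (intro B_ideal_add B_ideal_mult T L cl) simp
  also have "(a * b - c * d - e * f) + d * (c - f - a) = a * D + f * E"
    by (simp add: E_def D_def algebra_simps)
  finally have 2: "a * D + f * E \<in> B_ideal n" .
  have Ecl: "E \<in> carrier (laurent_ring n)" unfolding E_def by (intro mpoly_ring_carrier cl) simp_all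
  have "a * (b * E + e * D) - e * (a * D + f * E) - E * (a * b - c * d - e * f) \<in> B_ideal n"
    by (intro B_ideal_diff B_ideal_mult 1 2 T cl Ecl) simp_all
  also have "a * (b * E + e * D) - e * (a * D + f * E) - E * (a * b - c * d - e * f) = c * (d * E)"
    by (simp add: algebra_simps)
  finally have EI: "E \<in> B_ideal n"
    unfolding c_def d_def by (rule B_ideal_cancel[OF B_ideal_cancel])
  then show "right_defect n i j \<in> B_ideal n" unfolding E .
  have "(a * D + f * E) - f * E \<in> B_ideal n"
    by (intro B_ideal_diff B_ideal_mult 2 EI cl) simp
  then have "a * D \<in> B_ideal n" by simp
  then show "left_defect n (i - 1) (j - 1) \<in> B_ideal n"
    unfolding D a_def by (rule B_ideal_cancel)
qed

text \<open>A right defect is reached from the bracket with \<open>p\<close> lowered, a left defect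
  from the one with \<open>q\<close> raised, and each time both defects of the longer bracket enter.
  At \<open>p = 0\<close> and at \<open>p = n + 1\<close>, where one of these moves leaves the
  range, periodicity exchanges the two ends.\<close>

lemma defects_in_ideal:
  assumes n: "n \<ge> 1" and p: "p \<le> n + 1" "p + 2 \<le> q" "q \<le> p + (n + 1)"
  shows "right_defect n p q \<in> B_ideal n \<and> left_defect n p q \<in> B_ideal n"
proof -
  have "right_defect n p q \<in> B_ideal n \<and> left_defect n p q \<in> B_ideal n"
    if "p \<le> n + 1" "p + 2 \<le> q" "q + d = p + (n + 1)" for d p q
    using that
  proof (induction d arbitrary: p q)
    case 0
    have r: "right_defect n p (p + (n + 1)) \<in> B_ideal n" if "1 \<le> p" "p \<le> n + 1" for p
      using defects_full(1)[OF n that] .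
    have l: "left_defect n p (p + (n + 1)) \<in> B_ideal n" if "p \<le> n" for p
      using defects_full(2)[OF n, of "p + 1"] that by simp
    have "right_defect n p (p + (n + 1)) \<in> B_ideal n"
      using r[of p] r[of "n + 1"] right_defect_periodic[of "n + 1" n] 0(1) by (cases "p = 0") auto
    moreover have "left_defect n p (p + (n + 1)) \<in> B_ideal n"
      using l[of p] l[of 0] left_defect_periodic[OF n, of "n + 1"] 0(1) by (cases "p = n + 1") auto
    ultimately show ?case using 0(3) by simp
  next
    case (Suc d)
    have r: "right_defect n p q \<in> B_ideal n"
      if "1 \<le> p" "p \<le> n + 1" "p + 2 \<le> q" "q + Suc d = p + (n + 1)" for p q
    proof (rule defects_step(1)[OF n])
      show "(p, q) \<in> arcs n" "q < p + (n + 1)" using that by (auto simp: arcs_def)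
      show "right_defect n (p - 1) q \<in> B_ideal n" "left_defect n (p - 1) q \<in> B_ideal n"
        using Suc.IH[of "p - 1" q] that by auto
    qed
    have l: "left_defect n p q \<in> B_ideal n"
      if "p \<le> n" "p + 2 \<le> q" "q + Suc d = p + (n + 1)" for p q
    proof -
      have "left_defect n (p + 1 - 1) (q + 1 - 1) \<in> B_ideal n"
      proof (rule defects_step(2)[OF n])
        show "(p + 1, q + 1) \<in> arcs n" "q + 1 < p + 1 + (n + 1)" using that by (auto simp: arcs_def)
        show "right_defect n (p + 1 - 1) (q + 1) \<in> B_ideal n"
            "left_defect n (p + 1 - 1) (q + 1) \<in> B_ideal n"
          using Suc.IH[of p "q + 1"] that by auto
      qed
      then show ?thesis by simp
    qed
    have "right_defect n p q \<in> B_ideal n"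
    proof (cases "p = 0")
      case True
      have "right_defect n (n + 1) (q + (n + 1)) \<in> B_ideal n" using Suc.prems True by (intro r) auto
      then show ?thesis using right_defect_periodic[of q n] Suc.prems True by simp
    qed (use r[of p q] Suc.prems in auto)
    moreover have "left_defect n p q \<in> B_ideal n"
    proof (cases "p = n + 1")
      case True
      have "left_defect n 0 (q - (n + 1)) \<in> B_ideal n" using Suc.prems True by (intro l) auto
      then show ?thesis using left_defect_periodic[OF n, of "q - (n + 1)"] Suc.prems True by simp
    qed (use l[of p q] Suc.prems in auto)
    ultimately show ?case ..
  qed
  from this[of p q "p + (n + 1) - q"] show ?thesis using p by simp
qed

lemma bracket_sum:
  assumes n: "n \<ge> 1" and p: "p \<le> n + 1" "p < q" "q \<le> p + (n + 1)"
  shows "bracket n p q - (\<Sum>k=p+1..q. bracket n (k - 1) k) \<in> B_ideal n"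
proof -
  have "Suc p \<le> q" using p by simp
  then show ?thesis using p(3)
  proof (induction q rule: dec_induct)
    case base
    show ?case by (simp add: B_ideal_zero)
  next
    case (step q)
    have "right_defect n p (Suc q) \<in> B_ideal n" using defects_in_ideal[OF n p(1)] step by simp
    then have "right_defect n p (Suc q) +
        (bracket n p q - (\<Sum>k=p+1..q. bracket n (k - 1) k)) \<in> B_ideal n"
      using step by (intro B_ideal_add) auto
    then show ?case using step by (simp add: right_defect_def algebra_simps sum.cl_ivl_Suc)
  qed
qed

text \<open>The full bracket \<open>[a, a + n + 1] = 1\<close> is split at \<open>p\<close>. This is
  what makes the forms \<open>z_p - z_a - 1\<close> invertible.\<close>

lemma bracket_additive:
  assumes n: "n \<ge> 1" and p: "1 \<le> a" "a < p" "p \<le> n + 1"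
  shows "bracket n a p + bracket n p (a + (n + 1)) - 1 \<in> B_ideal n"
proof -
  let ?s = "\<lambda>p q. \<Sum>k=p+1..q. bracket n (k - 1) k"
  have 1: "bracket n a p - ?s a p \<in> B_ideal n" by (rule bracket_sum[OF n]) (use p in auto)
  have 2: "bracket n p (a + (n + 1)) - ?s p (a + (n + 1)) \<in> B_ideal n"
    by (rule bracket_sum[OF n]) (use p in auto)
  have 3: "bracket n a (a + (n + 1)) - ?s a (a + (n + 1)) \<in> B_ideal n"
    by (rule bracket_sum[OF n]) (use p in auto)
  have "?s a (a + (n + 1)) = ?s a p + ?s p (a + (n + 1))"
    using p sum.ub_add_nat[of "a + 1" p "\<lambda>k. bracket n (k - 1) k" "a + (n + 1) - p"] by simp
  then have eq: "(bracket n a p - ?s a p) + (bracket n p (a + (n + 1)) - ?s p (a + (n + 1))) -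
      (bracket n a (a + (n + 1)) - ?s a (a + (n + 1))) = bracket n a p + bracket n p (a + (n + 1)) - 1"
    using bracket_full[of a n] p by simp
  show ?thesis using B_ideal_diff[OF B_ideal_add[OF 1 2] 3] unfolding eq .
qed

section \<open>Identification of the coordinate rings\<close>

lemma substitute_var [simp]: "substitute Z (var v) = Z v"
  using substitute.ev_single[of Z "Poly_Mapping.single v 1" 1] power_monomial_single[of Z v]
  by (simp add: var_def)

lemma substitute_const [simp]: "substitute Z (const c) = const c"
  using substitute.ev_single[of Z 0 c] by (simp add: const_def power_monomial_def)

lemma substitute_uminus: "substitute Z (- p) = - substitute Z p"
  using substitute.ev_add[of Z "- p" p] by (simp add: substitute.ev_zero eq_neg_iff_add_eq_0)

lemma substitute_diff: "substitute Z (p - q) = substitute Z p - substitute Z q"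
  using substitute.ev_add[of Z p "- q"] by (simp add: substitute_uminus)

lemma substitute_carrier:
  assumes "p \<in> carrier (mpoly_ring V)" "\<And>v. v \<in> V \<Longrightarrow> Z v \<in> carrier (mpoly_ring W)"
  shows "substitute Z p \<in> carrier (mpoly_ring W)"
proof -
  have "v \<in> V" if "m \<in> Poly_Mapping.keys p" "v \<in> Poly_Mapping.keys m" for m v
    using assms(1) that by (auto simp: mpoly_ring_def)
  then show ?thesis
    unfolding substitute_def monoid_eval_def power_monomial_def
    by (intro mpoly_ring_carrier_sum mpoly_ring_carrier_mult mpoly_ring_carrier_const
        mpoly_ring_carrier_prod mpoly_ring_carrier_power assms(2))
qed

lemma mpoly_eval_var [simp]: "mpoly_eval z (var v) = z v"
  using mpoly_eval.ev_single[of z "Poly_Mapping.single v 1" 1] power_monomial_single[of z v]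
  by (simp add: var_def)

lemma mpoly_eval_const [simp]: "mpoly_eval z (const c) = c"
  using mpoly_eval.ev_single[of z 0 c] by (simp add: const_def power_monomial_def)

lemma mpoly_eval_uminus: "mpoly_eval z (- p) = - mpoly_eval z p"
  using mpoly_eval.ev_add[of z "- p" p] by (simp add: mpoly_eval.ev_zero eq_neg_iff_add_eq_0)

lemma mpoly_eval_diff: "mpoly_eval z (p - q) = mpoly_eval z p - mpoly_eval z q"
  using mpoly_eval.ev_add[of z p "- q"] by (simp add: mpoly_eval_uminus)

lemma quotient_coordinate_ring_simps [simp]:
  "monoid.mult (quotient_coordinate_ring n) = (*)" "one (quotient_coordinate_ring n) = 1"
  "zero (quotient_coordinate_ring n) = 0" "add (quotient_coordinate_ring n) = (+)"
  by (simp_all add: quotient_coordinate_ring_def)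

lemma quotient_coordinate_ring_carrier:
  "carrier (quotient_coordinate_ring n) = {p \<in> carrier (mpoly_ring {1..n + 1}).
     \<forall>z t. mpoly_eval (\<lambda>i. z i + t) p = mpoly_eval z p}"
  by (simp add: quotient_coordinate_ring_def)

lemma quotient_coordinate_ring_closed:
  fixes n :: nat
  defines "A \<equiv> carrier (quotient_coordinate_ring n)"
  shows "const c \<in> A" "p \<in> A \<Longrightarrow> q \<in> A \<Longrightarrow> p + q \<in> A" "p \<in> A \<Longrightarrow> q \<in> A \<Longrightarrow> p * q \<in> A"
    "p \<in> A \<Longrightarrow> - p \<in> A"
    "a \<in> {1..n + 1} \<Longrightarrow> b \<in> {1..n + 1} \<Longrightarrow> var b - var a - const c \<in> A"
  unfolding A_def quotient_coordinate_ring_carrier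
  by (simp_all add: mpoly_ring_carrier mpoly_eval.ev_add mpoly_eval.ev_mult mpoly_eval_uminus mpoly_eval_diff)

lemma cring_quotient_coordinate_ring: "cring (quotient_coordinate_ring n)"
proof -
  let ?L = "mpoly_ring {1..n + 1} :: ((nat \<Rightarrow>\<^sub>0 nat) \<Rightarrow>\<^sub>0 complex) ring"
  let ?H = "carrier (quotient_coordinate_ring n)"
  interpret L: cring ?L by (rule cring_mpoly_ring)
  have sub: "?H \<subseteq> carrier ?L" unfolding quotient_coordinate_ring_carrier by blast
  have "subring ?H ?L"
  proof (rule L.subringI[OF sub])
    show "\<one>\<^bsub>?L\<^esub> \<in> ?H" using quotient_coordinate_ring_closed(1)[of 1 n] by simp
    show "\<ominus>\<^bsub>?L\<^esub> p \<in> ?H" if "p \<in> ?H" for p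
    proof -
      have "\<ominus>\<^bsub>?L\<^esub> p = - p"
        by (rule L.minus_equality) (use that sub in \<open>auto simp: mpoly_ring_carrier_uminus\<close>)
      then show ?thesis using quotient_coordinate_ring_closed(4)[OF that] by simp
    qed
  qed (simp_all add: quotient_coordinate_ring_closed)
  then have "subcring ?H ?L" by (rule L.subcringI')
  then have "cring (?L\<lparr>carrier := ?H\<rparr>)" using L.subcring_iff[OF sub] by blast
  moreover have "?L\<lparr>carrier := ?H\<rparr> = quotient_coordinate_ring n"
    by (simp add: quotient_coordinate_ring_def)
  ultimately show ?thesis by (simp only:)
qed

text \<open>The coordinates are normalised to vanish at index 1. Translation invariant polynomials
  do not see this choice of a point on each line.\<close>

definition coordinate :: "nat \<Rightarrow> nat \<Rightarrow> laurent" where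
  "coordinate n a = (\<Sum>k=2..a. 1 - arc_var n (k, k + (n + 1)))"

lemma coordinate_carrier:
  assumes "n \<ge> 1" "a \<le> n + 1"
  shows "coordinate n a \<in> carrier (laurent_ring n)"
  unfolding coordinate_def
proof (intro mpoly_ring_carrier_sum mpoly_ring_carrier_diff mpoly_ring_carrier_1 arc_var_carrier)
  show "(k, k + (n + 1)) \<in> arcs n" if "k \<in> {2..a}" for k
    using that assms by (auto simp: arcs_def)
qed

text \<open>Modulo the ideal both the difference and the bracket are the sum of the unit steps
  \<open>[k - 1, k] = 1 - u\<close>.\<close>

lemma coordinate_diff:
  assumes n: "n \<ge> 1" and ab: "1 \<le> a" "a < b" "b \<le> n + 1"
  shows "coordinate n b - coordinate n a - bracket n a b \<in> B_ideal n"
proof -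
  let ?u = "\<lambda>k. 1 - arc_var n (k, k + (n + 1))"
  have "coordinate n b = coordinate n a + (\<Sum>k=a+1..b. ?u k)"
    unfolding coordinate_def using ab sum.ub_add_nat[of 2 a ?u "b - a"] by simp
  then have eq: "coordinate n b - coordinate n a - bracket n a b =
      - (\<Sum>k=a+1..b. bracket n (k - 1) k - ?u k) - (bracket n a b - (\<Sum>k=a+1..b. bracket n (k - 1) k))"
    by (simp add: sum_subtractf)
  have "(\<Sum>k\<in>X. bracket n (k - 1) k - ?u k) \<in> B_ideal n" if "X \<subseteq> {1..n + 1}" for X
    using that bracket_step[OF n]
    by (induction X rule: infinite_finite_induct) (auto simp: B_ideal_zero intro!: B_ideal_add)
  then have sum: "(\<Sum>k=a+1..b. bracket n (k - 1) k - ?u k) \<in> B_ideal n" using ab by simp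
  show ?thesis
    unfolding eq by (rule B_ideal_diff[OF B_ideal_uminus[OF sum] bracket_sum[OF n]]) (use ab in auto)
qed

text \<open>The denominators. Closure under negation lets every bracket be lifted to the monoid,
  since \<open>[p, a + n + 1]\<close> corresponds to the negative of a Shi form.\<close>

inductive_set shi_monoid :: "nat \<Rightarrow> ((nat \<Rightarrow>\<^sub>0 nat) \<Rightarrow>\<^sub>0 complex) set" for n where
  one: "1 \<in> shi_monoid n"
| uminus: "f \<in> shi_monoid n \<Longrightarrow> - f \<in> shi_monoid n"
| mult: "f \<in> shi_monoid n \<Longrightarrow> g \<in> shi_monoid n \<Longrightarrow> f * g \<in> shi_monoid n"
| form: "1 \<le> a \<Longrightarrow> a < b \<Longrightarrow> b \<le> n + 1 \<Longrightarrow> c \<in> {0, 1} \<Longrightarrow> var b - var a - const c \<in> shi_monoid n"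

lemma shi_monoid_carrier: "f \<in> shi_monoid n \<Longrightarrow> f \<in> carrier (quotient_coordinate_ring n)"
proof (induction rule: shi_monoid.induct)
  case one
  show ?case using quotient_coordinate_ring_closed(1)[of 1 n] by simp
qed (simp_all add: quotient_coordinate_ring_closed)

lemma bracket_from_shi_monoid:
  assumes n: "n \<ge> 1" and pq: "p \<le> n + 1" "p < q" "q \<le> p + (n + 1)"
  shows "\<exists>f \<in> shi_monoid n. substitute (coordinate n) f - bracket n p q \<in> B_ideal n"
proof -
  have pos: "\<exists>f \<in> shi_monoid n. substitute (coordinate n) f - bracket n p q \<in> B_ideal n"
    if p: "1 \<le> p" "p \<le> n + 1" "p < q" "q \<le> p + (n + 1)" for p q
  proof -
    consider "q \<le> n + 1" | "q = p + (n + 1)" | "n + 1 < q" "q < p + (n + 1)" using p by linarith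
    then show ?thesis
    proof cases
      case 1
      have "var q - var p - const 0 \<in> shi_monoid n" by (rule shi_monoid.form) (use 1 p in auto)
      moreover have "substitute (coordinate n) (var q - var p - const 0) - bracket n p q \<in> B_ideal n"
        using coordinate_diff[OF n p(1) p(3) 1] by (simp add: substitute_diff)
      ultimately show ?thesis by blast
    next
      case 2
      then show ?thesis using bracket_full[OF p(2)] shi_monoid.one
        by (intro bexI[of _ 1]) (auto simp: substitute.ev_one B_ideal_zero)
    next
      case 3
      define a where "a = q - (n + 1)"
      have a: "1 \<le> a" "a < p" "q = a + (n + 1)" using 3 by (auto simp: a_def)
      have "- (var p - var a - const 1) \<in> shi_monoid n"
        by (intro shi_monoid.uminus shi_monoid.form) (use a p in auto)
      moreover have "substitute (coordinate n) (- (var p - var a - const 1)) - bracket n p q \<in> B_ideal n"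
      proof -
        \<comment> \<open>Modulo the ideal \<open>1 - (z_p - z_a)\<close> is
          \<open>1 - [a, p]\<close>, which is \<open>[p, a + n + 1]\<close> by splitting the full
          bracket.\<close>
        have "- (coordinate n p - coordinate n a - bracket n a p) -
            (bracket n a p + bracket n p (a + (n + 1)) - 1) \<in> B_ideal n"
          by (intro B_ideal_diff B_ideal_uminus coordinate_diff bracket_additive n a p)
        moreover have "- (coordinate n p - coordinate n a - bracket n a p) -
            (bracket n a p + bracket n p (a + (n + 1)) - 1) =
            substitute (coordinate n) (- (var p - var a - const 1)) - bracket n p q"
          unfolding a(3) by (simp add: substitute_diff substitute_uminus substitute.ev_one)
        ultimately show ?thesis by simp
      qed
      ultimately show ?thesis by blast
    qed
  qed
  show ?thesis
  proof (cases "p = 0")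
    case True
    then show ?thesis
      using pos[of "n + 1" "q + (n + 1)"] bracket_periodic[of 0 n q] pq by simp
  qed (use pos pq in auto)
qed

text \<open>Each form is congruent, up to sign, to a bracket, and brackets have explicit inverse
  monomials.\<close>

lemma shi_monoid_unit:
  assumes n: "n \<ge> 1" and "f \<in> shi_monoid n"
  shows "\<exists>g \<in> carrier (laurent_ring n). substitute (coordinate n) f * g - 1 \<in> B_ideal n"
  using assms(2)
proof (induction rule: shi_monoid.induct)
  case one
  show ?case by (intro bexI[of _ 1]) (simp_all add: substitute.ev_one B_ideal_zero)
next
  case (uminus f)
  then obtain g where "g \<in> carrier (laurent_ring n)" "substitute (coordinate n) f * g - 1 \<in> B_ideal n"
    by blast
  then show ?case by (intro bexI[of _ "- g"]) (simp_all add: substitute_uminus mpoly_ring_carrier)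
next
  case (mult f f')
  then obtain g g' where g: "g \<in> carrier (laurent_ring n)" "substitute (coordinate n) f * g - 1 \<in> B_ideal n"
    and g': "g' \<in> carrier (laurent_ring n)" "substitute (coordinate n) f' * g' - 1 \<in> B_ideal n"
    by blast
  let ?x = "substitute (coordinate n) f * g" and ?y = "substitute (coordinate n) f' * g'"
  have "?x \<in> carrier (laurent_ring n)"
    using B_ideal_carrier[OF g(2)] mpoly_ring_carrier_add[of "?x - 1" "B_index n" 1] by simp
  then have "?x * (?y - 1) + (?x - 1) \<in> B_ideal n" using g g' by (intro B_ideal_add B_ideal_mult)
  moreover have "?x * (?y - 1) + (?x - 1) = substitute (coordinate n) (f * f') * (g * g') - 1"
    by (simp add: substitute.ev_mult algebra_simps)
  ultimately show ?case using g g' by (intro bexI[of _ "g * g'"]) (simp_all add: mpoly_ring_carrier)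
next
  case (form a b c)
  have unit: "\<exists>g \<in> carrier (laurent_ring n). x * g - 1 \<in> B_ideal n"
    if "x - bracket n p q \<in> B_ideal n" for x p q
  proof -
    have "bracket_inverse n p q * (x - bracket n p q) \<in> B_ideal n"
      using that bracket_inverse_carrier by (rule B_ideal_mult)
    moreover have "bracket_inverse n p q * (x - bracket n p q) = x * bracket_inverse n p q - 1"
      using bracket_inverse[of n p q] by (simp add: algebra_simps)
    ultimately show ?thesis using bracket_inverse_carrier by metis
  qed
  have diff: "coordinate n b - coordinate n a - bracket n a b \<in> B_ideal n"
    by (rule coordinate_diff[OF n form(1-3)])
  consider "c = 0" | "c = 1" using form(4) by blast
  then show ?case
  proof cases
    case 1
    then show ?thesis using unit[OF diff] by (simp add: substitute_diff)
  next
    case 2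
    have "- (coordinate n b - coordinate n a - bracket n a b) -
        (bracket n a b + bracket n b (a + (n + 1)) - 1) \<in> B_ideal n"
      by (intro B_ideal_diff B_ideal_uminus diff bracket_additive n form)
    moreover have "- (coordinate n b - coordinate n a - bracket n a b) -
        (bracket n a b + bracket n b (a + (n + 1)) - 1) =
        - substitute (coordinate n) (var b - var a - const c) - bracket n b (a + (n + 1))"
      by (simp add: 2 substitute_diff substitute.ev_one)
    ultimately obtain g where g: "g \<in> carrier (laurent_ring n)"
        "- substitute (coordinate n) (var b - var a - const c) * g - 1 \<in> B_ideal n"
      using unit by metis
    then show ?thesis by (intro bexI[of _ "- g"]) (simp_all add: mpoly_ring_carrier)
  qed
qed

section \<open>Laurent polynomials as fractions with Shi forms as denominators\<close>

definition is_shi_fraction :: "nat \<Rightarrow> laurent \<Rightarrow> bool" where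
  "is_shi_fraction n x \<longleftrightarrow> (\<exists>a \<in> carrier (quotient_coordinate_ring n). \<exists>s \<in> shi_monoid n.
     x * substitute (coordinate n) s - substitute (coordinate n) a \<in> B_ideal n)"

lemma substitute_coordinate_carrier:
  assumes "n \<ge> 1" "p \<in> carrier (quotient_coordinate_ring n)"
  shows "substitute (coordinate n) p \<in> carrier (laurent_ring n)"
  using assms by (intro substitute_carrier[of _ "{1..n + 1}"] coordinate_carrier)
    (auto simp: quotient_coordinate_ring_carrier)

lemma is_shi_fraction_const: "is_shi_fraction n (const c)"
  unfolding is_shi_fraction_def
  by (intro bexI[of _ "const c"] bexI[of _ 1])
    (simp_all add: quotient_coordinate_ring_closed shi_monoid.one substitute.ev_one B_ideal_zero)

lemma is_shi_fraction_add:
  assumes n: "n \<ge> 1" and "is_shi_fraction n x" "is_shi_fraction n y"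
  shows "is_shi_fraction n (x + y)"
proof -
  let ?h = "substitute (coordinate n)" and ?A = "carrier (quotient_coordinate_ring n)"
  obtain a s b t where a: "a \<in> ?A" "s \<in> shi_monoid n" "x * ?h s - ?h a \<in> B_ideal n"
    and b: "b \<in> ?A" "t \<in> shi_monoid n" "y * ?h t - ?h b \<in> B_ideal n"
    using assms unfolding is_shi_fraction_def by blast
  have "?h t * (x * ?h s - ?h a) + ?h s * (y * ?h t - ?h b) \<in> B_ideal n"
    using a b by (intro B_ideal_add B_ideal_mult substitute_coordinate_carrier[OF n] shi_monoid_carrier)
  moreover have "?h t * (x * ?h s - ?h a) + ?h s * (y * ?h t - ?h b) =
      (x + y) * ?h (s * t) - ?h (a * t + b * s)"
    by (simp add: substitute.ev_mult substitute.ev_add algebra_simps)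
  moreover have "a * t + b * s \<in> ?A" "s * t \<in> shi_monoid n"
    using a b shi_monoid_carrier by (auto intro!: quotient_coordinate_ring_closed shi_monoid.mult)
  ultimately show ?thesis unfolding is_shi_fraction_def by metis
qed

lemma is_shi_fraction_mult:
  assumes n: "n \<ge> 1" and x: "x \<in> carrier (laurent_ring n)"
    and "is_shi_fraction n x" "is_shi_fraction n y"
  shows "is_shi_fraction n (x * y)"
proof -
  let ?h = "substitute (coordinate n)" and ?A = "carrier (quotient_coordinate_ring n)"
  obtain a s b t where a: "a \<in> ?A" "s \<in> shi_monoid n" "x * ?h s - ?h a \<in> B_ideal n"
    and b: "b \<in> ?A" "t \<in> shi_monoid n" "y * ?h t - ?h b \<in> B_ideal n"
    using assms unfolding is_shi_fraction_def by blast
  have "?h s \<in> carrier (laurent_ring n)" "?h b \<in> carrier (laurent_ring n)"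
    using a b shi_monoid_carrier substitute_coordinate_carrier[OF n] by auto
  then have "(x * ?h s) * (y * ?h t - ?h b) + ?h b * (x * ?h s - ?h a) \<in> B_ideal n"
    using a b x by (intro B_ideal_add B_ideal_mult mpoly_ring_carrier_mult)
  moreover have "(x * ?h s) * (y * ?h t - ?h b) + ?h b * (x * ?h s - ?h a) =
      (x * y) * ?h (s * t) - ?h (a * b)"
    by (simp add: substitute.ev_mult algebra_simps)
  moreover have "a * b \<in> ?A" "s * t \<in> shi_monoid n"
    using a b by (auto intro!: quotient_coordinate_ring_closed shi_monoid.mult)
  ultimately show ?thesis unfolding is_shi_fraction_def by metis
qed

lemma B_ideal_mult_cong:
  assumes "x - x' \<in> B_ideal n" "y - y' \<in> B_ideal n"
    and "x' \<in> carrier (laurent_ring n)" "y' \<in> carrier (laurent_ring n)"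
  shows "x * y - x' * y' \<in> B_ideal n"
proof -
  have "y \<in> carrier (laurent_ring n)"
    using mpoly_ring_carrier_add[OF B_ideal_carrier[OF assms(2)] assms(4)] by simp
  then have "y * (x - x') + x' * (y - y') \<in> B_ideal n"
    using assms by (intro B_ideal_add B_ideal_mult)
  then show ?thesis by (simp add: algebra_simps)
qed

text \<open>A long variable is a bracket; any other is a quotient of products of two brackets, each
  of which lifts to the monoid. With numerator and denominator both in the monoid, the inverse
  variable is a fraction too.\<close>

lemma arc_var_fraction:
  assumes n: "n \<ge> 1" and x: "x \<in> arcs n"
  obtains f g where "f \<in> shi_monoid n" "g \<in> shi_monoid n"
    "arc_var n x * substitute (coordinate n) f - substitute (coordinate n) g \<in> B_ideal n"
proof -
  let ?h = "substitute (coordinate n)"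
  obtain i j where xx: "x = (i, j)" and ij: "1 \<le> i" "i \<le> n + 1" "i + 2 \<le> j" "j \<le> i + (n + 1)"
    using x by (rule arcsE)
  show ?thesis
  proof (cases "j = i + (n + 1)")
    case True
    obtain g where g: "g \<in> shi_monoid n" "?h g - bracket n i (i + n) \<in> B_ideal n"
      using bracket_from_shi_monoid[OF n, of i "i + n"] ij n by auto
    have "- (?h g - bracket n i (i + n)) \<in> B_ideal n" using g(2) by (rule B_ideal_uminus)
    then have "arc_var n x * ?h 1 - ?h g \<in> B_ideal n"
      using bracket_almost_full[of i n] x True by (simp add: xx substitute.ev_one)
    then show ?thesis using that g(1) shi_monoid.one by blast
  next
    case False
    then have arc: "(i, j) \<in> arcs n" "j < i + (n + 1)" using x xx ij by auto
    have "\<exists>f \<in> shi_monoid n. ?h f - bracket n i j \<in> B_ideal n"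
      by (rule bracket_from_shi_monoid[OF n]) (use ij arc in auto)
    then obtain f1 where f1: "f1 \<in> shi_monoid n" "?h f1 - bracket n i j \<in> B_ideal n" by blast
    have "\<exists>f \<in> shi_monoid n. ?h f - bracket n (i - 1) (j - 1) \<in> B_ideal n"
      by (rule bracket_from_shi_monoid[OF n]) (use ij arc in auto)
    then obtain f2 where f2: "f2 \<in> shi_monoid n" "?h f2 - bracket n (i - 1) (j - 1) \<in> B_ideal n" by blast
    have "\<exists>f \<in> shi_monoid n. ?h f - bracket n (i - 1) j \<in> B_ideal n"
      by (rule bracket_from_shi_monoid[OF n]) (use ij arc in auto)
    then obtain g1 where g1: "g1 \<in> shi_monoid n" "?h g1 - bracket n (i - 1) j \<in> B_ideal n" by blast
    have "\<exists>f \<in> shi_monoid n. ?h f - bracket n i (j - 1) \<in> B_ideal n"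
      by (rule bracket_from_shi_monoid[OF n]) (use ij arc in auto)
    then obtain g2 where g2: "g2 \<in> shi_monoid n" "?h g2 - bracket n i (j - 1) \<in> B_ideal n" by blast
    have F: "?h f1 * ?h f2 - bracket n i j * bracket n (i - 1) (j - 1) \<in> B_ideal n"
      by (rule B_ideal_mult_cong[OF f1(2) f2(2) bracket_carrier bracket_carrier])
    have G: "?h g1 * ?h g2 - bracket n (i - 1) j * bracket n i (j - 1) \<in> B_ideal n"
      by (rule B_ideal_mult_cong[OF g1(2) g2(2) bracket_carrier bracket_carrier])
    have "arc_var n x * (?h f1 * ?h f2 - bracket n i j * bracket n (i - 1) (j - 1)) -
        (?h g1 * ?h g2 - bracket n (i - 1) j * bracket n i (j - 1)) \<in> B_ideal n"
      by (intro B_ideal_diff B_ideal_mult F G arc_var_carrier x)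
    moreover have "arc_var n x * bracket n i j * bracket n (i - 1) (j - 1) =
        bracket n (i - 1) j * bracket n i (j - 1)"
      unfolding bracket_def xx by (rule arc_monomial_cross[OF arc])
    then have "arc_var n x * (?h f1 * ?h f2 - bracket n i j * bracket n (i - 1) (j - 1)) -
        (?h g1 * ?h g2 - bracket n (i - 1) j * bracket n i (j - 1)) =
        arc_var n x * ?h (f1 * f2) - ?h (g1 * g2)"
      by (simp add: substitute.ev_mult algebra_simps)
    ultimately have "arc_var n x * ?h (f1 * f2) - ?h (g1 * g2) \<in> B_ideal n" by simp
    then show ?thesis using that f1 f2 g1 g2 shi_monoid.mult by blast
  qed
qed

lemma is_shi_fraction_var:
  assumes n: "n \<ge> 1" and \<gamma>: "\<gamma> \<in> B_index n"
  shows "is_shi_fraction n (var \<gamma>)" "is_shi_fraction n (inverse_var \<gamma>)"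
proof -
  let ?h = "substitute (coordinate n)"
  obtain x where x: "x \<in> arcs n" "\<gamma> = diagonals n x" using B_index_arc[OF \<gamma> n] by blast
  obtain f g where fg: "f \<in> shi_monoid n" "g \<in> shi_monoid n"
    "var \<gamma> * ?h f - ?h g \<in> B_ideal n"
    using arc_var_fraction[OF n x(1)] unfolding arc_var_def x(2) by blast
  then show "is_shi_fraction n (var \<gamma>)"
    unfolding is_shi_fraction_def using shi_monoid_carrier by blast
  have "inverse_var \<gamma> * - (var \<gamma> * ?h f - ?h g) \<in> B_ideal n"
    using fg(3) \<gamma> by (intro B_ideal_mult B_ideal_uminus inverse_var_carrier)
  moreover have "inverse_var \<gamma> * - (var \<gamma> * ?h f - ?h g) =
      inverse_var \<gamma> * ?h g - (var \<gamma> * inverse_var \<gamma>) * ?h f"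
    by (simp add: algebra_simps)
  ultimately have "inverse_var \<gamma> * ?h g - ?h f \<in> B_ideal n" by (simp add: var_inverse_var)
  then show "is_shi_fraction n (inverse_var \<gamma>)"
    unfolding is_shi_fraction_def using fg shi_monoid_carrier by blast
qed

text \<open>A Laurent polynomial is a sum of terms, a term is a constant times integer powers of
  single variables, and such a power is a natural power of \<open>var\<close> or of
  \<open>inverse_var\<close>.\<close>

lemma laurent_ring_induct [consumes 1, case_names const add mult var inverse_var]:
  assumes "x \<in> carrier (mpoly_ring V)"
    and const: "\<And>c. P (const c)"
    and add: "\<And>x y. x \<in> carrier (mpoly_ring V) \<Longrightarrow> y \<in> carrier (mpoly_ring V) \<Longrightarrow>
      P x \<Longrightarrow> P y \<Longrightarrow> P (x + y)"
    and mult: "\<And>x y. x \<in> carrier (mpoly_ring V) \<Longrightarrow> y \<in> carrier (mpoly_ring V) \<Longrightarrow>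
      P x \<Longrightarrow> P y \<Longrightarrow> P (x * y)"
    and var: "\<And>v. v \<in> V \<Longrightarrow> P (var v)" and inverse_var: "\<And>v. v \<in> V \<Longrightarrow> P (inverse_var v)"
  shows "P (x :: ('v \<Rightarrow>\<^sub>0 int) \<Rightarrow>\<^sub>0 complex)"
proof -
  let ?C = "carrier (mpoly_ring V) :: (('v \<Rightarrow>\<^sub>0 int) \<Rightarrow>\<^sub>0 complex) set"
  let ?mon = "\<lambda>m::'v \<Rightarrow>\<^sub>0 int. Poly_Mapping.single m (1::complex)"
  have one: "P 1" using const[of 1] by simp
  have zero: "P 0" using const[of 0] by simp
  have power: "x ^ k \<in> ?C \<and> P (x ^ k)" if "x \<in> ?C" "P x" for x k
    using that by (induction k) (auto simp: one mpoly_ring_carrier intro!: mult)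
  have pow: "?mon (Poly_Mapping.single v (int k)) = var v ^ k"
      "?mon (Poly_Mapping.single v (- int k)) = inverse_var v ^ k" for v k
  proof (induction k)
    case (Suc k)
    {
      case 1
      have "?mon (Poly_Mapping.single v (int (Suc k))) = var v * ?mon (Poly_Mapping.single v (int k))"
        by (simp add: var_def mult_single single_add[symmetric])
      then show ?case using Suc by simp
    next
      case 2
      have "?mon (Poly_Mapping.single v (- int (Suc k))) =
          inverse_var v * ?mon (Poly_Mapping.single v (- int k))"
        by (simp add: inverse_var_def mult_single single_add[symmetric])
      then show ?case using Suc by simp
    }
  qed simp_all
  have single: "?mon (Poly_Mapping.single v k) \<in> ?C \<and> P (?mon (Poly_Mapping.single v k))"
    if "v \<in> V" for v k
  proof (cases k rule: int_cases2)
    case (nonneg m)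
    show ?thesis unfolding nonneg pow using that by (intro power var mpoly_ring_carrier_var)
  next
    case (nonpos m)
    show ?thesis unfolding nonpos pow using that by (intro power inverse_var inverse_var_carrier)
  qed
  have mon: "?mon (\<Sum>v\<in>X. Poly_Mapping.single v (f v)) \<in> ?C \<and>
      P (?mon (\<Sum>v\<in>X. Poly_Mapping.single v (f v)))"
    if "finite X" "X \<subseteq> V" for X f
    using that
  proof (induction X rule: finite_induct)
    case (insert v X)
    have "?mon (\<Sum>v\<in>insert v X. Poly_Mapping.single v (f v)) =
        ?mon (Poly_Mapping.single v (f v)) * ?mon (\<Sum>v\<in>X. Poly_Mapping.single v (f v))"
      using insert(1,2) by (simp add: mult_single)
    then show ?case using insert single[of v "f v"] by (simp add: mult mpoly_ring_carrier_mult)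
  qed (simp add: one)
  have decompose: "y = (\<Sum>a\<in>Poly_Mapping.keys y. Poly_Mapping.single a (Poly_Mapping.lookup y a))"
    for y :: "'x \<Rightarrow>\<^sub>0 'y::comm_monoid_add"
    by (rule poly_mapping_eqI) (simp add: lookup_sum lookup_single when_def in_keys_iff)
  have summand: "Poly_Mapping.single m c \<in> ?C \<and> P (Poly_Mapping.single m c)"
    if "Poly_Mapping.keys m \<subseteq> V" for m c
  proof -
    have "?mon m \<in> ?C \<and> P (?mon m)" using mon[OF finite_keys that] decompose[of m] by metis
    moreover have "Poly_Mapping.single m c = const c * ?mon m" by (simp add: const_def mult_single)
    ultimately show ?thesis by (simp add: mult const mpoly_ring_carrier)
  qed
  have "(\<Sum>m\<in>X. Poly_Mapping.single m (f m)) \<in> ?C \<and> P (\<Sum>m\<in>X. Poly_Mapping.single m (f m))"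
    if "finite X" "\<And>m. m \<in> X \<Longrightarrow> Poly_Mapping.keys m \<subseteq> V" for X f
    using that
    by (induction X rule: finite_induct) (simp_all add: zero add summand mpoly_ring_carrier_add)
  from this[of "Poly_Mapping.keys x" "Poly_Mapping.lookup x"] show ?thesis
    using assms(1) decompose[of x] by (simp add: mpoly_ring_def)
qed

lemma is_shi_fraction:
  assumes "n \<ge> 1" "x \<in> carrier (laurent_ring n)"
  shows "is_shi_fraction n x"
  using assms(2)
proof (induction rule: laurent_ring_induct)
  case (add x y)
  then show ?case using is_shi_fraction_add[OF assms(1)] by blast
next
  case (mult x y)
  then show ?case using is_shi_fraction_mult[OF assms(1)] by blast
qed (use assms(1) in \<open>auto intro: is_shi_fraction_const is_shi_fraction_var\<close>)

text \<open>The value 1 outside the index set keeps every coordinate nonzero, as the evaluation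
  lemmas for Laurent polynomials require of all variables.\<close>

definition shi_point :: "nat \<Rightarrow> (nat \<Rightarrow> complex) \<Rightarrow> nat set set \<Rightarrow> complex" where
  "shi_point n z \<gamma> = (if \<gamma> \<in> B_index n then shi_arc_value n z (inv_into (arcs n) (diagonals n) \<gamma>) else 1)"

lemma shi_point_diagonals:
  assumes "x \<in> arcs n"
  shows "shi_point n z (diagonals n x) = shi_arc_value n z x"
  using assms inj_on_diagonals by (simp add: shi_point_def diagonals_in_B_index)

lemma shi_point_nonzero:
  assumes "n \<ge> 1" "shi_generic n z"
  shows "shi_point n z \<gamma> \<noteq> 0"
proof (cases "\<gamma> \<in> B_index n")
  case True
  then obtain x where "x \<in> arcs n" "\<gamma> = diagonals n x" using B_index_arc assms(1) by blast
  then show ?thesis using shi_point_diagonals shi_arc_value_nonzero[OF assms(2)] by simp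
qed (simp add: shi_point_def)

text \<open>The elements vanishing at the point form an ideal, and it contains the generators by
  \<open>shi_arc_value_relation\<close>.\<close>

lemma laurent_eval_B_ideal:
  assumes n: "n \<ge> 1" and g: "shi_generic n z" and x: "x \<in> B_ideal n"
  shows "laurent_eval (shi_point n z) x = 0"
proof -
  interpret L: cring "laurent_ring n" by (rule cring_mpoly_ring)
  note nz = shi_point_nonzero[OF n g]
  interpret E: monoid_eval_hom "\<lambda>c. c" "laurent_monomial (shi_point n z)"
    rewrites "monoid_eval (\<lambda>c. c) (laurent_monomial (shi_point n z)) \<equiv> laurent_eval (shi_point n z)"
    using laurent_eval_hom[OF nz] by (simp_all add: laurent_eval_def)
  let ?K = "{x \<in> carrier (laurent_ring n). laurent_eval (shi_point n z) x = 0}"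
  have uminus: "\<ominus>\<^bsub>laurent_ring n\<^esub> a = - a" if "a \<in> carrier (laurent_ring n)" for a
    by (rule L.minus_equality) (use that in \<open>auto simp: mpoly_ring_carrier_uminus\<close>)
  have "ideal ?K (laurent_ring n)"
  proof (rule idealI[OF L.ring_axioms])
    show "subgroup ?K (add_monoid (laurent_ring n))"
    proof (rule L.add.subgroupI)
      show "\<ominus>\<^bsub>laurent_ring n\<^esub> a \<in> ?K" if "a \<in> ?K" for a
        using that E.ev_add[of "- a" a] by (simp add: uminus E.ev_zero mpoly_ring_carrier)
      show "?K \<noteq> {}" using E.ev_zero mpoly_ring_carrier_0 by blast
    qed (auto simp: E.ev_add mpoly_ring_carrier)
  qed (auto simp: E.ev_mult mpoly_ring_carrier)
  moreover have "B_relation n \<gamma> \<in> ?K" if \<gamma>: "\<gamma> \<in> B_index n" for \<gamma>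
  proof -
    obtain y where y: "y \<in> arcs n" "\<gamma> = diagonals n y" using B_index_arc[OF \<gamma> n] by blast
    have "laurent_eval (shi_point n z) (B_relation n \<gamma> + 1) =
        shi_arc_value n z y + crossing_product n (shi_arc_value n z) y"
      using y by (simp add: B_relation_def E.ev_add E.ev_prod E.ev_power laurent_eval_var[OF nz]
          prod_B_index[OF n] crossing_product_def shi_point_diagonals cong: prod.cong)
    then have "laurent_eval (shi_point n z) (B_relation n \<gamma>) = 0"
      using shi_arc_value_relation[OF g n y(1)] E.ev_add[of "B_relation n \<gamma>" 1] by (simp add: E.ev_one)
    then show ?thesis
      using B_ideal_carrier[OF B_relation_in_ideal[OF \<gamma>]] by simp
  qed
  ultimately have "B_ideal n \<subseteq> ?K"
    unfolding B_ideal_def by (intro L.genideal_minimal) auto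
  then show ?thesis using x by blast
qed

text \<open>Evaluating the image of \<open>p\<close> at the point over a generic \<open>z\<close>
  gives the value of \<open>p\<close> at \<open>z\<close> shifted by \<open>- z 1\<close>, hence at
  \<open>z\<close> by translation invariance. So \<open>p\<close> vanishes at all generic
  points.\<close>

lemma substitute_coordinate_inj:
  assumes n: "n \<ge> 1" and p: "p \<in> carrier (quotient_coordinate_ring n)"
    and I: "substitute (coordinate n) p \<in> B_ideal n"
  shows "p = 0"
proof (rule mpoly_eval_generic_zeroD[of "n + 1"])
  fix z :: "nat \<Rightarrow> complex"
  assume "\<And>a b c. 1 \<le> a \<Longrightarrow> a < b \<Longrightarrow> b \<le> n + 1 \<Longrightarrow> c \<in> {0, 1} \<Longrightarrow> z b - z a \<noteq> c"
  then have g: "shi_generic n z" by (auto simp: shi_generic_def)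
  note nz = shi_point_nonzero[OF n g]
  interpret E: monoid_eval_hom "\<lambda>c. c" "laurent_monomial (shi_point n z)"
    rewrites "monoid_eval (\<lambda>c. c) (laurent_monomial (shi_point n z)) \<equiv> laurent_eval (shi_point n z)"
    using laurent_eval_hom[OF nz] by (simp_all add: laurent_eval_def)
  have diff: "laurent_eval (shi_point n z) (1 - y) = 1 - laurent_eval (shi_point n z) y" for y
    using E.ev_add[of "1 - y" y] by (simp add: E.ev_one eq_diff_eq)
  have Z: "laurent_eval (shi_point n z) (coordinate n a) = z a + (- z 1)" if a: "a \<in> {1..n + 1}" for a
  proof -
    have "laurent_eval (shi_point n z) (coordinate n a) = (\<Sum>k=2..a. 1 - shi_arc_value n z (k, k + (n + 1)))"
      unfolding coordinate_def E.ev_sum diff arc_var_def laurent_eval_var[OF nz]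
    proof (rule sum.cong[OF refl])
      fix k assume "k \<in> {2..a}"
      then have "(k, k + (n + 1)) \<in> arcs n" using a n by (auto simp: arcs_def)
      then show "1 - shi_point n z (diagonals n (k, k + (n + 1))) = 1 - shi_arc_value n z (k, k + (n + 1))"
        by (simp only: shi_point_diagonals)
    qed
    also have "\<dots> = z a - z 1" using a by (intro sum_shi_arc_value_long) auto
    finally show ?thesis by simp
  qed
  have "\<forall>z t. mpoly_eval (\<lambda>i. z i + t) p = mpoly_eval z p"
    using p unfolding quotient_coordinate_ring_carrier by blast
  then have "mpoly_eval z p = mpoly_eval (\<lambda>i. z i + (- z 1)) p" by (rule allE) (erule allE, erule sym)
  also have "\<dots> = mpoly_eval (\<lambda>i. laurent_eval (shi_point n z) (coordinate n i)) p"
    using p Z by (intro mpoly_eval_cong[of _ "{1..n + 1}"]) (auto simp: quotient_coordinate_ring_carrier)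
  also have "\<dots> = laurent_eval (shi_point n z) (substitute (coordinate n) p)"
    by (rule laurent_eval_substitute[OF nz, symmetric])
  also have "\<dots> = 0" by (rule laurent_eval_B_ideal[OF n g I])
  finally show "mpoly_eval z p = 0" .
qed

section \<open>The cluster map as a localization, and the complement of the arrangement as an open
  set\<close>

definition cluster_map :: "nat \<Rightarrow> ((nat \<Rightarrow>\<^sub>0 nat) \<Rightarrow>\<^sub>0 complex) \<Rightarrow> laurent set" where
  "cluster_map n p = B_ideal n +>\<^bsub>laurent_ring n\<^esub> substitute (coordinate n) p"

lemma coset_eq_iff:
  assumes "x \<in> carrier (laurent_ring n)" "y \<in> carrier (laurent_ring n)"
  shows "B_ideal n +>\<^bsub>laurent_ring n\<^esub> x = B_ideal n +>\<^bsub>laurent_ring n\<^esub> y \<longleftrightarrow> x - y \<in> B_ideal n"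
  using ring.quotient_eq_iff_same_a_r_cos[OF cring.axioms(1)[OF cring_mpoly_ring] ideal_B_ideal assms]
  by (simp add: mpoly_ring_a_minus[OF assms])

lemma localization_hom_cluster_map:
  assumes n: "n \<ge> 1"
  shows "localization_hom (quotient_coordinate_ring n) (laurent_ring n Quot B_ideal n)
    (cluster_map n) (shi_monoid n)"
proof -
  let ?A = "quotient_coordinate_ring n" and ?L = "laurent_ring n" and ?\<psi> = "substitute (coordinate n)"
  let ?R = "?L Quot B_ideal n" and ?pr = "\<lambda>x. B_ideal n +>\<^bsub>?L\<^esub> x"
  interpret A: cring ?A by (rule cring_quotient_coordinate_ring)
  interpret I: ideal "B_ideal n" ?L by (rule ideal_B_ideal)
  interpret R: cring ?R by (rule I.quotient_is_cring[OF cring_mpoly_ring])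
  note pr_hom = I.rcos_ring_hom
  note \<psi>_carrier = substitute_coordinate_carrier[OF n]
  have pr_mult: "?pr (x * y) = ?pr x \<otimes>\<^bsub>?R\<^esub> ?pr y" if "x \<in> carrier ?L" "y \<in> carrier ?L" for x y
    using ring_hom_mult[OF pr_hom that] by simp
  have pr_one: "?pr 1 = \<one>\<^bsub>?R\<^esub>" using ring_hom_one[OF pr_hom] by simp
  have \<psi>_hom: "?\<psi> \<in> ring_hom ?A ?L"
    by (rule ring_hom_memI) (simp_all add: \<psi>_carrier substitute.ev_mult substitute.ev_add substitute.ev_one)
  show ?thesis
  proof (unfold_locales)
    have "cluster_map n = ?pr \<circ> ?\<psi>" by (simp add: fun_eq_iff cluster_map_def)
    then show "cluster_map n \<in> ring_hom ?A ?R" using ring_hom_trans[OF \<psi>_hom pr_hom] by simp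
    show "inj_on (cluster_map n) (carrier ?A)"
    proof (rule inj_onI)
      fix p q assume p: "p \<in> carrier ?A" and q: "q \<in> carrier ?A" and eq: "cluster_map n p = cluster_map n q"
      have "?\<psi> p - ?\<psi> q \<in> B_ideal n"
        using eq unfolding cluster_map_def coset_eq_iff[OF \<psi>_carrier[OF p] \<psi>_carrier[OF q]] .
      then have "?\<psi> (p + - q) \<in> B_ideal n" by (simp add: substitute_diff)
      moreover have "p + - q \<in> carrier ?A" using p q by (intro quotient_coordinate_ring_closed)
      ultimately have "p + - q = 0" by (intro substitute_coordinate_inj[OF n])
      then show "p = q" by simp
    qed
    show "shi_monoid n \<subseteq> carrier ?A" using shi_monoid_carrier by blast
    show "\<one>\<^bsub>?A\<^esub> \<in> shi_monoid n" by (simp add: shi_monoid.one)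
    show "s \<otimes>\<^bsub>?A\<^esub> t \<in> shi_monoid n" if "s \<in> shi_monoid n" "t \<in> shi_monoid n" for s t
      using that by (simp add: shi_monoid.mult)
    show "cluster_map n s \<in> Units ?R" if s: "s \<in> shi_monoid n" for s
    proof -
      have \<psi>s: "?\<psi> s \<in> carrier ?L" by (rule \<psi>_carrier[OF shi_monoid_carrier[OF s]])
      obtain g where g: "g \<in> carrier ?L" "?\<psi> s * g - 1 \<in> B_ideal n"
        using shi_monoid_unit[OF n s] by blast
      have "?pr (?\<psi> s * g) = ?pr 1"
        using g \<psi>s by (subst coset_eq_iff) (simp_all add: mpoly_ring_carrier)
      then have "?pr (?\<psi> s) \<otimes>\<^bsub>?R\<^esub> ?pr g = \<one>\<^bsub>?R\<^esub>" using pr_mult[OF \<psi>s g(1)] pr_one by simp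
      moreover have "?pr (?\<psi> s) \<in> carrier ?R" "?pr g \<in> carrier ?R"
        using ring_hom_closed[OF pr_hom] \<psi>s g(1) by auto
      ultimately show ?thesis
        unfolding cluster_map_def Units_def using R.m_comm by auto
    qed
    show "\<exists>a\<in>carrier ?A. \<exists>s\<in>shi_monoid n. r \<otimes>\<^bsub>?R\<^esub> cluster_map n s = cluster_map n a"
      if r: "r \<in> carrier ?R" for r
    proof -
      obtain x where x: "x \<in> carrier ?L" "r = ?pr x"
        using r unfolding FactRing_def A_RCOSETS_def' by auto
      obtain a s where a: "a \<in> carrier ?A" "s \<in> shi_monoid n" "x * ?\<psi> s - ?\<psi> a \<in> B_ideal n"
        using is_shi_fraction[OF n x(1)] unfolding is_shi_fraction_def by blast
      have \<psi>s: "?\<psi> s \<in> carrier ?L" by (rule \<psi>_carrier[OF shi_monoid_carrier[OF a(2)]])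
      have "?pr (x * ?\<psi> s) = ?pr (?\<psi> a)"
        using a(3) coset_eq_iff[OF mpoly_ring_carrier_mult[OF x(1) \<psi>s] \<psi>_carrier[OF a(1)]] by simp
      then show ?thesis using a(1,2) pr_mult[OF x(1) \<psi>s] unfolding cluster_map_def x(2) by auto
    qed
  qed
qed

text \<open>Primality extends avoidance from the forms to their products, and signs are absorbed by
  multiplying with -1. Thus the primes avoiding the monoid are the points off the
  hyperplanes.\<close>

lemma prime_disjoint_shi_monoid_iff:
  assumes P: "primeideal P (quotient_coordinate_ring n)"
  shows "P \<inter> shi_monoid n = {} \<longleftrightarrow>
    (\<forall>a b c. 1 \<le> a \<and> a < b \<and> b \<le> n + 1 \<and> c \<in> {0, 1} \<longrightarrow> var b - var a - const c \<notin> P)"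
proof
  assume "P \<inter> shi_monoid n = {}"
  then show "\<forall>a b c. 1 \<le> a \<and> a < b \<and> b \<le> n + 1 \<and> c \<in> {0, 1} \<longrightarrow> var b - var a - const c \<notin> P"
    using shi_monoid.form by blast
next
  interpret primeideal P "quotient_coordinate_ring n" by fact
  assume forms: "\<forall>a b c. 1 \<le> a \<and> a < b \<and> b \<le> n + 1 \<and> c \<in> {0, 1} \<longrightarrow> var b - var a - const c \<notin> P"
  have "f \<notin> P" if "f \<in> shi_monoid n" for f
    using that
  proof (induction rule: shi_monoid.induct)
    case one
    show ?case using one_notin_prime[OF P] by simp
  next
    case (uminus f)
    have "- 1 \<in> carrier (quotient_coordinate_ring n)"
      using quotient_coordinate_ring_closed(1)[of "-1" n] by (simp add: const_def single_uminus)
    then have "- 1 * - f \<in> P" if "- f \<in> P" using I_l_closed[OF that, of "- 1"] by simp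
    then show ?case using uminus.IH by auto
  next
    case (mult f g)
    then show ?case using I_prime[of f g] shi_monoid_carrier by auto
  next
    case (form a b c)
    then show ?case using forms by blast
  qed
  then show "P \<inter> shi_monoid n = {}" by blast
qed

lemma shi_complement_points:
  "topspace (points (affine_space_mod_line n)) - \<Union>(shi_hyperplanes n) =
    {P. primeideal P (quotient_coordinate_ring n) \<and> P \<inter> shi_monoid n = {}}"
proof -
  interpret A: cring "quotient_coordinate_ring n" by (rule cring_quotient_coordinate_ring)
  have hyperplanes: "P \<in> \<Union>(shi_hyperplanes n) \<longleftrightarrow>
      (\<exists>a b c. 1 \<le> a \<and> a < b \<and> b \<le> n + 1 \<and> c \<in> {0, 1} \<and> var b - var a - const c \<in> P)"
    if "primeideal P (quotient_coordinate_ring n)" for P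
    using that unfolding shi_hyperplanes_def vanishing_def by blast
  have top: "topspace (points (affine_space_mod_line n)) =
      {P. primeideal P (quotient_coordinate_ring n)}"
    by (simp add: affine_space_mod_line_def Spec_def A.topspace_zariski)
  show ?thesis
  proof (rule Set.set_eqI)
    fix P
    show "P \<in> topspace (points (affine_space_mod_line n)) - \<Union>(shi_hyperplanes n) \<longleftrightarrow>
        P \<in> {P. primeideal P (quotient_coordinate_ring n) \<and> P \<inter> shi_monoid n = {}}"
    proof (cases "primeideal P (quotient_coordinate_ring n)")
      case True
      show ?thesis
        unfolding top Diff_iff mem_Collect_eq hyperplanes[OF True] prime_disjoint_shi_monoid_iff[OF True]
        using True by blast
    qed (simp add: top)
  qed
qed

text \<open>The arrangement is finite, so the union of its closed hyperplanes is closed.\<close>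

lemma openin_shi_complement:
  "openin (zariski (quotient_coordinate_ring n))
    {P. primeideal P (quotient_coordinate_ring n) \<and> P \<inter> shi_monoid n = {}}"
proof -
  interpret A: cring "quotient_coordinate_ring n" by (rule cring_quotient_coordinate_ring)
  let ?T = "zariski (quotient_coordinate_ring n)"
  have "shi_hyperplanes n \<subseteq> (\<lambda>(a, b, c). vanishing (quotient_coordinate_ring n) {var b - var a - const c})
      ` ({1..n + 1} \<times> {1..n + 1} \<times> {0, 1})"
  proof
    fix H assume "H \<in> shi_hyperplanes n"
    then obtain a b and c :: complex where "1 \<le> a" "a < b" "b \<le> n + 1" "c \<in> {0, 1}"
      and "H = vanishing (quotient_coordinate_ring n) {var b - var a - const c}"
      unfolding shi_hyperplanes_def by (elim CollectE exE conjE)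
    then show "H \<in> (\<lambda>(a, b, c). vanishing (quotient_coordinate_ring n) {var b - var a - const c})
        ` ({1..n + 1} \<times> {1..n + 1} \<times> {0, 1})"
      by (intro image_eqI[of _ _ "(a, b, c)"]) simp_all
  qed
  then have "finite (shi_hyperplanes n)" by (rule finite_subset) simp
  moreover have "closedin ?T H" if H: "H \<in> shi_hyperplanes n" for H
  proof -
    obtain a b c where abc: "1 \<le> a" "a < b" "b \<le> n + 1" "c \<in> {0, 1::complex}"
      and H': "H = vanishing (quotient_coordinate_ring n) {var b - var a - const c}"
      using H unfolding shi_hyperplanes_def by blast
    have "var b - var a - const c \<in> carrier (quotient_coordinate_ring n)"
      using abc by (intro quotient_coordinate_ring_closed) auto
    then have "openin ?T (topspace ?T - H)"
      unfolding A.openin_zariski A.topspace_zariski H' by blast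
    moreover have "H \<subseteq> topspace ?T" unfolding H' A.topspace_zariski vanishing_def by blast
    ultimately show ?thesis by (simp add: closedin_def)
  qed
  ultimately have "closedin ?T (\<Union>(shi_hyperplanes n))" by (intro closedin_Union)
  then have "openin ?T (topspace ?T - \<Union>(shi_hyperplanes n))" by blast
  moreover have "topspace ?T - \<Union>(shi_hyperplanes n) =
      {P. primeideal P (quotient_coordinate_ring n) \<and> P \<inter> shi_monoid n = {}}"
    using shi_complement_points[of n] by (simp add: affine_space_mod_line_def Spec_def)
  ultimately show ?thesis by simp
qed

theorem proposition7p3:
  fixes n :: nat
  assumes "n \<ge> 1"
  shows "isomorphic_over_C (cluster_configuration_space_B n) (shi_complement n)"
proof -
  interpret localization_hom "quotient_coordinate_ring n" "laurent_ring n Quot B_ideal n"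
    "cluster_map n" "shi_monoid n"
    by (rule localization_hom_cluster_map[OF assms])
  show ?thesis
    unfolding cluster_configuration_space_B_def shi_complement_def shi_complement_points
    unfolding affine_space_mod_line_def
    by (rule Spec_isomorphic[OF openin_shi_complement])
      (simp_all add: quotient_coordinate_ring_closed cluster_map_def)
qed

end
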